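(* Let $\lambda$ be a symmetrisable function defined as in the setting below. Suppose the set $\mathrm{OPT}$ of maximisers is finite, i.e. $|\mathrm{OPT}|<\infty$. Suppose also that there exists $c>0$ such that the following hold for all large $n$ and all maximisers $\mathbf{x}=(x_1,x_2,\ldots)\in\mathrm{OPT}$, where $G=G_{n,\mathbf{x}}$: (i) For all distinct $x,y\in V(G)$ we have $\lambda(G)-\lambda(G\oplus xy)\ge c n^{-2}$, where $G\oplus xy$ has vertex set $V(G)$ and edge set $E(G)\triangle\{\{x,y\}\}$. (ii) If $G_v$ is obtained from $G$ by adding a new vertex $v$ which is complete or empty to each part of $G$ (where each $V_i$, $i\in[m]$, is a part and we have $|V_0|$ singleton parts), then the minimum number of edits at $v$ needed to make $v$ a clone of some existing vertex of $G$ is at most $n(\lambda(G)-\lambda(G_v,v))/c$. Then $\lambda$ is perfectly stable.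
   Context: Fix an integer $k\ge 3$ and a function $\gamma:\mathcal{G}_k\to\mathbb{R}$, where $\mathcal{G}_k$ is the set of graphs on $k$ vertices up to isomorphism. For a graph $G=(V,E)$ on $n\ge k$ vertices, $\lambda(G):=\binom{n}{k}^{-1}\sum_{X\in\binom{V}{k}}\gamma(G[X])$, $\Lambda(G):=\binom{n}{k}\lambda(G)$, and for $x\in V$, $\Lambda(G,x):=\sum_{X\in\binom{V}{k},X\ni x}\gamma(G[X])$ and $\lambda(G,x):=\binom{n-1}{k-1}^{-1}\Lambda(G,x)$. Let $\lambda(n)$ be the maximum of $\lambda(G)$ over $n$-vertex graphs and $\lambda_{\max}:=\lim_{n\to\infty}\lambda(n)$. $\lambda$ is symmetrisable if for every $\varepsilon>0$ there is $n_0$ such that for every graph $G=(V,E)$ of order $n\ge n_0$: (Sym1) there is a sequence of graphs $G_0=G,G_1,\ldots,G_m$ on $V$ with $G_m$ complete partite and, for all $i\in[m]$, $\lambda(G_{i-1})\le\lambda(G_i)$ and $|E(G_{i-1})\triangle E(G_i)|<\varepsilon\binom{n}{2}$; (Sym2) if $G-z$ is complete partite with partite sets $V_1,\ldots,V_t$, then there is a sequence $G_0=G,G_1,\ldots,G_m$ on $V$ with $G_i-z=G-z$, $\lambda(G_{i-1})\le\lambda(G_i)$, $|E(G_{i-1})\triangle E(G_i)|\le\varepsilon(n-1)$ for all $i\in[m]$, and for each $j\in[t]$ either $N_{G_m}(z)\supseteq V_j$ or $N_{G_m}(z)\cap V_j=\varnothing$. A sequence $\mathbf{x}=(x_1,x_2,\ldots)$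 with $x_1\ge x_2\ge\cdots\ge0$ and $\sum_i x_i\le1$ is a maximiser if there are complete partite graphs $H_n$ with $v(H_n)\to\infty$, $\lambda(H_n)\to\lambda_{\max}$ and, for every $i\ge1$, the $i$-th largest part of $H_n$ has $(x_i+o(1))v(H_n)$ vertices; $\mathrm{OPT}$ is the set of maximisers. Realisation $G_{n,\mathbf{x}}$: with $x_0:=1-\sum_{i\ge1}x_i$, it is the complete partite graph on $[n]$ with parts $V_1,\ldots,V_m$ and a set $V_0$ of universal vertices (i.e. $|V_0|$ singleton parts): if $x_0=0$, $[n]=V_1\cup\cdots\cup V_m$ with $||V_i|-x_in|<1$ and $V_0=\varnothing$; otherwise $|V_i|=\lfloor x_in\rfloor$ for all $i\ge1$ with $x_in\ge2$ and $V_0$ is the rest. If a vertex $z$ is added to $G=G_{n,\mathbf{x}}$, $z$ is a clone of $u\in V(G)$ if $u\in V_0$ and $z$ is adjacent to all of $V(G)$, or $u\notin V_0$ and $N(z)=N_G(u)$. Perfect stability: there is $C>0$ such that every graph $G$ of order $n\ge C$ has a complete partite graph $H$ of order $n$ with $\hat\delta_1(G,H)\le C(\lambda(n)-\lambda(G))$, where $\hat\delta_1(G,H)=\frac{2}{n^2}\min_{\sigma}|E(H)\triangle E(\sigma(G))|$ over bijections $\sigma:V(G)\to V(H)$. *)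

theory Defs
  imports Complex_Main "HOL-Library.Disjoint_Sets" "HOL-Library.Multiset"
begin

text \<open>Finite simple graphs. Vertices are natural numbers, which is no restriction up to
  isomorphism and leaves room for adding new vertices to any graph.\<close>

record ugraph =
  verts :: "nat set"
  edges :: "nat set set"

definition is_graph :: "ugraph \<Rightarrow> bool" where
  "is_graph G \<longleftrightarrow> finite (verts G) \<and> (\<forall>e\<in>edges G. e \<subseteq> verts G \<and> card e = 2)"

definition order :: "ugraph \<Rightarrow> nat" where
  "order G = card (verts G)"

definition iso :: "ugraph \<Rightarrow> ugraph \<Rightarrow> bool" where
  "iso G H \<longleftrightarrow> (\<exists>\<sigma>. bij_betw \<sigma> (verts G) (verts H) \<and> edges H = (`) \<sigma> ` edges G)"

definition induced :: "ugraph \<Rightarrow> nat set \<Rightarrow> ugraph" where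
  "induced G X = \<lparr>verts = X, edges = {e \<in> edges G. e \<subseteq> X}\<rparr>"

definition del_vertex :: "ugraph \<Rightarrow> nat \<Rightarrow> ugraph" where
  "del_vertex G z = induced G (verts G - {z})"

definition nbhd :: "ugraph \<Rightarrow> nat \<Rightarrow> nat set" where
  "nbhd G x = {y. {x, y} \<in> edges G}"

definition flip :: "ugraph \<Rightarrow> nat \<Rightarrow> nat \<Rightarrow> ugraph" where
  "flip G x y = \<lparr>verts = verts G, edges = sym_diff (edges G) {{x, y}}\<rparr>"

definition add_vertex :: "ugraph \<Rightarrow> nat \<Rightarrow> nat set \<Rightarrow> ugraph" where
  "add_vertex G v N = \<lparr>verts = insert v (verts G), edges = edges G \<union> {{v, u} | u. u \<in> N}\<rparr>"

text \<open>\<open>partite_sets G P\<close>: \<open>G\<close> is complete partite and \<open>P\<close> is the set of its (nonempty) parts. A single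
  part (no edges) and all parts singletons (a complete graph) are both allowed.\<close>

definition partite_sets :: "ugraph \<Rightarrow> nat set set \<Rightarrow> bool" where
  "partite_sets G P \<longleftrightarrow> partition_on (verts G) P \<and>
     edges G = {{x, y} | x y. \<exists>A\<in>P. \<exists>B\<in>P. A \<noteq> B \<and> x \<in> A \<and> y \<in> B}"

definition complete_partite :: "ugraph \<Rightarrow> bool" where
  "complete_partite G \<longleftrightarrow> is_graph G \<and> (\<exists>P. partite_sets G P)"

text \<open>A function on isomorphism classes of \<open>k\<close>-vertex graphs is represented by a function on
  graphs that is isomorphism invariant; its values on graphs of other orders are never used.\<close>

definition graph_invariant :: "nat \<Rightarrow> (ugraph \<Rightarrow> real) \<Rightarrow> bool" where
  "graph_invariant k \<gamma> \<longleftrightarrow>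
     (\<forall>F F'. is_graph F \<and> is_graph F' \<and> order F = k \<and> iso F F' \<longrightarrow> \<gamma> F = \<gamma> F')"

definition Lam :: "nat \<Rightarrow> (ugraph \<Rightarrow> real) \<Rightarrow> ugraph \<Rightarrow> real" where
  "Lam k \<gamma> G = (\<Sum>X | X \<subseteq> verts G \<and> card X = k. \<gamma> (induced G X))"

definition lam :: "nat \<Rightarrow> (ugraph \<Rightarrow> real) \<Rightarrow> ugraph \<Rightarrow> real" where
  "lam k \<gamma> G = Lam k \<gamma> G / real (order G choose k)"

definition Lam_at :: "nat \<Rightarrow> (ugraph \<Rightarrow> real) \<Rightarrow> ugraph \<Rightarrow> nat \<Rightarrow> real" where
  "Lam_at k \<gamma> G x = (\<Sum>X | X \<subseteq> verts G \<and> card X = k \<and> x \<in> X. \<gamma> (induced G X))"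

definition lam_at :: "nat \<Rightarrow> (ugraph \<Rightarrow> real) \<Rightarrow> ugraph \<Rightarrow> nat \<Rightarrow> real" where
  "lam_at k \<gamma> G x = Lam_at k \<gamma> G x / real ((order G - 1) choose (k - 1))"

definition lam_order :: "nat \<Rightarrow> (ugraph \<Rightarrow> real) \<Rightarrow> nat \<Rightarrow> real" where
  "lam_order k \<gamma> n = Max {lam k \<gamma> G | G. is_graph G \<and> order G = n}"

definition lam_max :: "nat \<Rightarrow> (ugraph \<Rightarrow> real) \<Rightarrow> real" where
  "lam_max k \<gamma> = lim (lam_order k \<gamma>)"

definition Sym1 :: "nat \<Rightarrow> (ugraph \<Rightarrow> real) \<Rightarrow> real \<Rightarrow> ugraph \<Rightarrow> bool" where
  "Sym1 k \<gamma> \<epsilon> G \<longleftrightarrow>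
     (\<exists>m (S :: nat \<Rightarrow> ugraph).
        S 0 = G \<and> complete_partite (S m) \<and>
        (\<forall>i\<le>m. is_graph (S i) \<and> verts (S i) = verts G) \<and>
        (\<forall>i\<in>{1..m}. lam k \<gamma> (S (i - 1)) \<le> lam k \<gamma> (S i) \<and>
           real (card (sym_diff (edges (S (i - 1))) (edges (S i)))) < \<epsilon> * real (order G choose 2)))"

definition Sym2 :: "nat \<Rightarrow> (ugraph \<Rightarrow> real) \<Rightarrow> real \<Rightarrow> ugraph \<Rightarrow> bool" where
  "Sym2 k \<gamma> \<epsilon> G \<longleftrightarrow>
     (\<forall>z\<in>verts G. \<forall>P. partite_sets (del_vertex G z) P \<longrightarrow>
       (\<exists>m (S :: nat \<Rightarrow> ugraph).
          S 0 = G \<and>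
          (\<forall>i\<le>m. is_graph (S i) \<and> verts (S i) = verts G) \<and>
          (\<forall>i\<in>{1..m}. del_vertex (S i) z = del_vertex G z \<and>
             lam k \<gamma> (S (i - 1)) \<le> lam k \<gamma> (S i) \<and>
             real (card (sym_diff (edges (S (i - 1))) (edges (S i)))) \<le> \<epsilon> * (real (order G) - 1)) \<and>
          (\<forall>A\<in>P. A \<subseteq> nbhd (S m) z \<or> nbhd (S m) z \<inter> A = {})))"

definition symmetrisable :: "nat \<Rightarrow> (ugraph \<Rightarrow> real) \<Rightarrow> bool" where
  "symmetrisable k \<gamma> \<longleftrightarrow>
     (\<forall>\<epsilon>>0. \<exists>n0. \<forall>G. is_graph G \<and> order G \<ge> n0 \<longrightarrow> Sym1 k \<gamma> \<epsilon> G \<and> Sym2 k \<gamma> \<epsilon> G)"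

text \<open>Size of the \<open>i\<close>-th largest set in \<open>P\<close>, for \<open>i \<ge> 1\<close>; it is \<open>0\<close> if \<open>P\<close> has fewer than \<open>i\<close> elements.\<close>

definition nth_largest :: "nat set set \<Rightarrow> nat \<Rightarrow> nat" where
  "nth_largest P i =
     (if i \<le> card P then rev (sorted_list_of_multiset (image_mset card (mset_set P))) ! (i - 1)
      else 0)"

text \<open>A sequence $(x_1, x_2, \ldots)$ is represented by a function on \<open>nat\<close> whose value at \<open>0\<close>
  is fixed to be $x_0 = 1 - \sum_{i \ge 1} x_i$. So functions of this kind correspond bijectively to
  the sequences of the mathematical definition, and in particular \<open>OPT\<close> has the right cardinality.\<close>

definition part_weights :: "(nat \<Rightarrow> real) \<Rightarrow> bool" where
  "part_weights x \<longleftrightarrow> (\<forall>i\<ge>1. x i \<ge> x (Suc i) \<and> x i \<ge> 0) \<and>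
     summable (\<lambda>i. x (Suc i)) \<and> (\<Sum>i. x (Suc i)) \<le> 1 \<and> x 0 = 1 - (\<Sum>i. x (Suc i))"

definition maximiser :: "nat \<Rightarrow> (ugraph \<Rightarrow> real) \<Rightarrow> (nat \<Rightarrow> real) \<Rightarrow> bool" where
  "maximiser k \<gamma> x \<longleftrightarrow> part_weights x \<and>
     (\<exists>(H :: nat \<Rightarrow> ugraph) (P :: nat \<Rightarrow> nat set set).
        (\<forall>n. is_graph (H n) \<and> partite_sets (H n) (P n)) \<and>
        filterlim (\<lambda>n. order (H n)) at_top sequentially \<and>
        (\<lambda>n. lam k \<gamma> (H n)) \<longlonglongrightarrow> lam_max k \<gamma> \<and>
        (\<forall>i\<ge>1. (\<lambda>n. real (nth_largest (P n) i) / real (order (H n))) \<longlonglongrightarrow> x i))"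

definition OPT :: "nat \<Rightarrow> (ugraph \<Rightarrow> real) \<Rightarrow> (nat \<Rightarrow> real) set" where
  "OPT k \<gamma> = {x. maximiser k \<gamma> x}"

text \<open>\<open>realisation_parts n x V\<close>: the sets $V_0, V_1, V_2, \ldots$ are the vertex classes of a
  realisation of \<open>x\<close> on $\{1,\ldots,n\}$; all but finitely many of them are empty. For $x_0 = 0$ the
  sizes are determined only up to rounding, so there may be several nonisomorphic realisations.\<close>

definition realisation_parts :: "nat \<Rightarrow> (nat \<Rightarrow> real) \<Rightarrow> (nat \<Rightarrow> nat set) \<Rightarrow> bool" where
  "realisation_parts n x V \<longleftrightarrow> disjoint_family V \<and> (\<Union>i. V i) = {1..n} \<and>
     (if x 0 = 0 then V 0 = {} \<and> (\<forall>i\<ge>1. \<bar>real (card (V i)) - x i * real n\<bar> < 1)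
      else (\<forall>i\<ge>1. if x i * real n \<ge> 2 then int (card (V i)) = \<lfloor>x i * real n\<rfloor> else V i = {}))"

text \<open>The vertices in \<open>V 0\<close> form singleton parts.\<close>

definition realisation_graph :: "nat \<Rightarrow> (nat \<Rightarrow> nat set) \<Rightarrow> ugraph" where
  "realisation_graph n V = \<lparr>verts = {1..n},
     edges = {{u, w} | u w. u \<in> {1..n} \<and> w \<in> {1..n} \<and> u \<noteq> w \<and> \<not> (\<exists>i\<ge>1. u \<in> V i \<and> w \<in> V i)}\<rparr>"

text \<open>A vertex added to \<open>G\<close> with neighbourhood \<open>N\<close> is a clone of \<open>u\<close>, where \<open>V0\<close> is the designated
  set of universal vertices of \<open>G\<close>.\<close>

definition is_clone :: "ugraph \<Rightarrow> nat set \<Rightarrow> nat set \<Rightarrow> nat \<Rightarrow> bool" where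
  "is_clone G V0 N u \<longleftrightarrow> u \<in> V0 \<and> N = verts G \<or> u \<notin> V0 \<and> N = nbhd G u"

definition edits_to_clone :: "ugraph \<Rightarrow> nat set \<Rightarrow> nat set \<Rightarrow> nat" where
  "edits_to_clone G V0 N =
     Min {card (sym_diff N N') | N'. \<exists>u\<in>verts G. is_clone G V0 N' u}"

definition edit_dist :: "ugraph \<Rightarrow> ugraph \<Rightarrow> real" where
  "edit_dist G H = 2 / real (order G) ^ 2 *
     real (Min {card (sym_diff (edges H) ((`) \<sigma> ` edges G)) | \<sigma>. bij_betw \<sigma> (verts G) (verts H)})"

definition perfectly_stable :: "nat \<Rightarrow> (ugraph \<Rightarrow> real) \<Rightarrow> bool" where
  "perfectly_stable k \<gamma> \<longleftrightarrow>
     (\<exists>C>0. \<forall>G. is_graph G \<and> real (order G) \<ge> C \<longrightarrow>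
        (\<exists>H. complete_partite H \<and> order H = order G \<and>
           edit_dist G H \<le> C * (lam_order k \<gamma> (order G) - lam k \<gamma> G)))"

end

theory Submission
  imports Defs "HOL-Library.Diagonal_Subsequence"
begin

text \<open>A graph whose density is nearly maximal is moved along a symmetrisation sequence to a complete
  partite graph, which by compactness is close to a realisation of some maximiser. If \<open>G\<close> is close
  to a realisation, recolour each atypical vertex like its nearest clone and call the result \<open>H\<close>. A
  vertex of \<open>G\<close> still far from every clone loses a constant proportion of its degree \<open>\<Lambda>(G,z)\<close>:
  condition (ii) applies at the end of the sequence given by (Sym2), or else the sequence passes
  through a vertex at small but positive distance from a clone, where condition (i) applies. All
  other differences between \<open>G\<close> and \<open>H\<close> form a graph of small maximum degree, so their losses,
  bounded below by condition (i), add up. Hence \<open>\<lambda>(H) - \<lambda>(G)\<close> dominates the edit distance. Finally,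
  no symmetrisation sequence can enter the neighbourhood of the realisations from outside: its first
  graph inside would be at positive distance from all of them, contrary to this local bound.\<close>

subsection \<open>Counting subsets\<close>

text \<open>Conditions (i) and (ii) speak of exact realisations only, whereas the argument needs
  them for a recoloured graph that merely resembles one. All losses are therefore kept in absolute
  form, in units of \<open>Qn k n\<close>, the order of the number of k-sets through a fixed pair: a
  flip costs a constant number of units, a misplaced vertex order n of them, and every error term
  counts k-sets that meet few vertices or contain a pair from a sparse set.

  Moving (i) to the recoloured graph needs two vertices of each colour in use, and bounding the
  value of a clone from below, by averaging, needs classes of linear size. Both follow from the fact
  that maximisers have finite support, which (i) itself forces.

  The constants are nested. Finiteness of the set of maximisers makes the choice uniform.\<close>

definition ksets :: "'a set \<Rightarrow> nat \<Rightarrow> 'a set set" where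
  "ksets W m = {X. X \<subseteq> W \<and> card X = m}"

lemma finite_ksets [simp]: "finite W \<Longrightarrow> finite (ksets W m)"
  unfolding ksets_def by (rule finite_subset[of _ "Pow W"]) auto

lemma card_ksets: "finite W \<Longrightarrow> card (ksets W m) = card W choose m"
  unfolding ksets_def by (rule n_subsets)

lemma ksets_mono: "W \<subseteq> W' \<Longrightarrow> ksets W m \<subseteq> ksets W' m"
  unfolding ksets_def by auto

lemma choose_le_pow: "n choose m \<le> n ^ m"
  by (cases "m \<le> n") (auto simp: binomial_le_pow binomial_eq_0)

lemma card_ksets_le: "finite W \<Longrightarrow> real (card (ksets W m)) \<le> real (card W) ^ m"
  unfolding card_ksets using choose_le_pow[of "card W" m] by (metis of_nat_le_iff of_nat_power)

text \<open>Removing S maps these sets injectively to subsets of size m - s, where s is the size of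
  S. In the multiplied form the bound n^(m-s) needs neither subtraction nor division, and it
  survives the degenerate cases, in which no set qualifies.\<close>

lemma card_ksets_superset:
  assumes "finite W" "finite S"
  shows "real (card {Y \<in> ksets W m. S \<subseteq> Y}) * real (card W) ^ card S \<le> real (card W) ^ m"
proof (cases "S \<subseteq> W \<and> card S \<le> m")
  case False
  have "{Y \<in> ksets W m. S \<subseteq> Y} = {}"
  proof (rule ccontr)
    assume "{Y \<in> ksets W m. S \<subseteq> Y} \<noteq> {}"
    then obtain Y where "Y \<subseteq> W" "card Y = m" "S \<subseteq> Y" by (auto simp: ksets_def)
    then show False using False card_mono[of Y S] finite_subset[OF _ assms(1)] by auto
  qed
  then have "card {Y \<in> ksets W m. S \<subseteq> Y} = 0" by (simp only: card.empty)
  then show ?thesis by simp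
next
  case True
  have inj: "inj_on (\<lambda>Y. Y - S) {Y \<in> ksets W m. S \<subseteq> Y}"
    by (rule inj_onI) blast
  have sub: "(\<lambda>Y. Y - S) ` {Y \<in> ksets W m. S \<subseteq> Y} \<subseteq> ksets W (m - card S)"
    using assms by (auto simp: ksets_def card_Diff_subset)
  have "card {Y \<in> ksets W m. S \<subseteq> Y} \<le> card (ksets W (m - card S))"
    using card_inj_on_le[OF inj sub] assms by auto
  then have "real (card {Y \<in> ksets W m. S \<subseteq> Y}) \<le> real (card W) ^ (m - card S)"
    using card_ksets_le[OF assms(1), of "m - card S"] by linarith
  then have "real (card {Y \<in> ksets W m. S \<subseteq> Y}) * real (card W) ^ card S
      \<le> real (card W) ^ (m - card S) * real (card W) ^ card S"
    by (rule mult_right_mono) auto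
  also have "\<dots> = real (card W) ^ m" using True by (simp flip: power_add)
  finally show ?thesis .
qed

lemma card_ksets_some_superset:
  assumes "finite W" "finite D" "\<And>e. e \<in> D \<Longrightarrow> finite e \<and> card e = s"
  shows "real (card {Y \<in> ksets W m. \<exists>e\<in>D. e \<subseteq> Y}) * real (card W) ^ s \<le> real (card D) * real (card W) ^ m"
proof -
  have "{Y \<in> ksets W m. \<exists>e\<in>D. e \<subseteq> Y} = (\<Union>e\<in>D. {Y \<in> ksets W m. e \<subseteq> Y})" by auto
  then have "card {Y \<in> ksets W m. \<exists>e\<in>D. e \<subseteq> Y} \<le> (\<Sum>e\<in>D. card {Y \<in> ksets W m. e \<subseteq> Y})"
    using card_UN_le[OF assms(2)] by auto
  then have "real (card {Y \<in> ksets W m. \<exists>e\<in>D. e \<subseteq> Y}) \<le> (\<Sum>e\<in>D. real (card {Y \<in> ksets W m. e \<subseteq> Y}))"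
    unfolding of_nat_sum[symmetric] of_nat_le_iff .
  then have "real (card {Y \<in> ksets W m. \<exists>e\<in>D. e \<subseteq> Y}) * real (card W) ^ s
     \<le> (\<Sum>e\<in>D. real (card {Y \<in> ksets W m. e \<subseteq> Y})) * real (card W) ^ s"
    by (rule mult_right_mono) auto
  also have "\<dots> = (\<Sum>e\<in>D. real (card {Y \<in> ksets W m. e \<subseteq> Y}) * real (card W) ^ s)"
    by (simp add: sum_distrib_right)
  also have "\<dots> \<le> (\<Sum>e\<in>D. real (card W) ^ m)"
  proof (rule sum_mono)
    fix e assume "e \<in> D"
    then show "real (card {Y \<in> ksets W m. e \<subseteq> Y}) * real (card W) ^ s \<le> real (card W) ^ m"
      using card_ksets_superset[OF assms(1), of e m] assms(3)[of e] by simp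
  qed
  finally show ?thesis by simp
qed

lemma card_ksets_hit:
  assumes "finite W" "finite B"
  shows "real (card {Y \<in> ksets W m. Y \<inter> B \<noteq> {}}) * real (card W) \<le> real (card B) * real (card W) ^ m"
proof -
  have "{Y \<in> ksets W m. Y \<inter> B \<noteq> {}} = {Y \<in> ksets W m. \<exists>e\<in>(\<lambda>b. {b}) ` B. e \<subseteq> Y}" by auto
  moreover have "card ((\<lambda>b. {b}) ` B) = card B" by (simp add: card_image)
  ultimately show ?thesis
    using card_ksets_some_superset[OF assms(1), of "(\<lambda>b. {b}) ` B" 1 m] assms(2) by fastforce
qed

lemma card_pairs_meeting:
  assumes "finite W" "finite B"
  shows "real (card {e \<in> ksets W 2. e \<inter> B \<noteq> {}}) \<le> real (card B) * real (card W)"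
proof (cases "card W = 0")
  case True
  then have "ksets W 2 = {}" using assms(1) by (auto simp: ksets_def)
  then have "card {e \<in> ksets W 2. e \<inter> B \<noteq> {}} = 0" by simp
  then show ?thesis by simp
next
  case False
  have "real (card {e \<in> ksets W 2. e \<inter> B \<noteq> {}}) * real (card W) \<le> (real (card B) * real (card W)) * real (card W)"
    using card_ksets_hit[OF assms, of 2] by (simp add: power2_eq_square mult.assoc)
  then show ?thesis using False by simp
qed

lemma abs_sum_diff_le:
  fixes \<phi> \<psi> :: "'a \<Rightarrow> real"
  assumes "finite A" "\<And>Y. Y \<in> A \<Longrightarrow> \<bar>\<phi> Y - \<psi> Y\<bar> \<le> K"
    "\<And>Y. Y \<in> A \<Longrightarrow> Y \<notin> A' \<Longrightarrow> \<phi> Y = \<psi> Y" "K \<ge> 0" "A' \<subseteq> A"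
  shows "\<bar>sum \<phi> A - sum \<psi> A\<bar> \<le> K * real (card A')"
proof -
  have "sum \<phi> A - sum \<psi> A = (\<Sum>Y\<in>A. \<phi> Y - \<psi> Y)" by (simp add: sum_subtractf)
  also have "\<dots> = (\<Sum>Y\<in>A'. \<phi> Y - \<psi> Y)"
    using assms by (intro sum.mono_neutral_right) auto
  also have "\<bar>\<dots>\<bar> \<le> (\<Sum>Y\<in>A'. \<bar>\<phi> Y - \<psi> Y\<bar>)" by (rule sum_abs)
  also have "\<dots> \<le> (\<Sum>Y\<in>A'. K)" using assms by (intro sum_mono) auto
  finally show ?thesis by (simp add: mult.commute)
qed

lemma handshake:
  assumes "finite W" "D \<subseteq> ksets W 2"
  shows "(\<Sum>z\<in>W. card {e \<in> D. z \<in> e}) = 2 * card D"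
proof -
  have fD: "finite D" using finite_subset[OF assms(2)] assms(1) by simp
  have "(\<Sum>z\<in>W. card {e \<in> D. z \<in> e}) = (\<Sum>z\<in>W. \<Sum>e\<in>D. if z \<in> e then 1 else 0)"
    using fD by (simp add: sum.If_cases Int_def)
  also have "\<dots> = (\<Sum>e\<in>D. \<Sum>z\<in>W. if z \<in> e then 1 else 0)" by (rule sum.swap)
  also have "\<dots> = (\<Sum>e\<in>D. 2)"
  proof (rule sum.cong[OF refl])
    fix e assume "e \<in> D"
    then have "e \<subseteq> W" "card e = 2" using assms(2) by (auto simp: ksets_def)
    then show "(\<Sum>z\<in>W. if z \<in> e then 1 else 0) = (2::nat)"
      using assms(1) by (simp add: sum.If_cases Int_absorb1 flip: Int_def)
  qed
  finally show ?thesis by simp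
qed

lemma card_incident:
  assumes "D \<subseteq> ksets W 2"
  shows "card {e \<in> D. z \<in> e} = card {w. {z, w} \<in> D}"
proof -
  have "bij_betw (\<lambda>w. {z, w}) {w. {z, w} \<in> D} {e \<in> D. z \<in> e}"
  proof (rule bij_betwI')
    show "({z, x} = {z, y}) = (x = y)" if "x \<in> {w. {z, w} \<in> D}" "y \<in> {w. {z, w} \<in> D}" for x y
      by (auto simp: doubleton_eq_iff)
    show "\<exists>x\<in>{w. {z, w} \<in> D}. e = {z, x}" if "e \<in> {e \<in> D. z \<in> e}" for e
    proof -
      have "card e = 2" "z \<in> e" using that assms by (auto simp: ksets_def)
      then obtain w where "e = {z, w}" by (auto simp: card_2_iff)
      then show ?thesis using that by auto
    qed
  qed auto
  then show ?thesis by (simp add: bij_betw_same_card)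
qed

text \<open>Markov's inequality for degrees, from \<open>handshake\<close>.\<close>

lemma card_high_degree:
  assumes "finite W" "D \<subseteq> ksets W 2"
  shows "real (card {z \<in> W. real (card {w. {z, w} \<in> D}) \<ge> d}) * d \<le> 2 * real (card D)"
proof -
  let ?B = "{z \<in> W. real (card {w. {z, w} \<in> D}) \<ge> d}"
  have "real (card ?B) * d = (\<Sum>z\<in>?B. d)" by simp
  also have "\<dots> \<le> (\<Sum>z\<in>?B. real (card {w. {z, w} \<in> D}))" by (intro sum_mono) auto
  also have "\<dots> \<le> (\<Sum>z\<in>W. real (card {w. {z, w} \<in> D}))"
    using assms(1) by (intro sum_mono2) auto
  also have "\<dots> = real (\<Sum>z\<in>W. card {e \<in> D. z \<in> e})" using card_incident[OF assms(2)] by simp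
  finally show ?thesis using handshake[OF assms] by simp
qed

subsection \<open>Graphs\<close>

lemma is_graph_iff: "is_graph G \<longleftrightarrow> finite (verts G) \<and> edges G \<subseteq> ksets (verts G) 2"
  unfolding is_graph_def ksets_def by auto

lemma is_graph_finite: "is_graph G \<Longrightarrow> finite (verts G)"
  unfolding is_graph_def by auto

lemma ksets_2E:
  assumes "e \<in> ksets W 2"
  obtains a b where "e = {a, b}" "a \<in> W" "b \<in> W" "a \<noteq> b"
proof -
  from assms obtain a b where "e = {a, b}" "a \<noteq> b" by (auto simp: ksets_def card_2_iff)
  then show ?thesis using that assms by (auto simp: ksets_def)
qed

lemma ksets_2_iff: "{a, b} \<in> ksets W 2 \<longleftrightarrow> a \<in> W \<and> b \<in> W \<and> a \<noteq> b"
  by (auto simp: ksets_def card_insert_if)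

lemma edge_iff: "is_graph G \<Longrightarrow> {a, b} \<in> edges G \<Longrightarrow> a \<in> verts G \<and> b \<in> verts G \<and> a \<noteq> b"
  using ksets_2_iff[of a b "verts G"] unfolding is_graph_iff by auto

lemma is_graph_induced: "is_graph G \<Longrightarrow> X \<subseteq> verts G \<Longrightarrow> is_graph (induced G X)"
  unfolding is_graph_def induced_def by (auto intro: finite_subset)

lemma induced_sel [simp]: "verts (induced G X) = X" "edges (induced G X) = {e \<in> edges G. e \<subseteq> X}"
  by (simp_all add: induced_def)

lemma order_induced [simp]: "order (induced G X) = card X"
  by (simp add: order_def)

lemma del_vertex_sel [simp]: "verts (del_vertex G z) = verts G - {z}"
  "edges (del_vertex G z) = {e \<in> edges G. e \<subseteq> verts G - {z}}"
  by (simp_all add: del_vertex_def)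

lemma is_graph_del_vertex: "is_graph G \<Longrightarrow> is_graph (del_vertex G z)"
  unfolding del_vertex_def by (rule is_graph_induced) auto

lemma add_vertex_sel [simp]: "verts (add_vertex G v N) = insert v (verts G)"
  "edges (add_vertex G v N) = edges G \<union> {{v, u} | u. u \<in> N}"
  by (simp_all add: add_vertex_def)

lemma is_graph_add_vertex:
  assumes "is_graph G" "v \<notin> verts G" "N \<subseteq> verts G"
  shows "is_graph (add_vertex G v N)"
  using assms unfolding is_graph_def by (auto simp: card_insert_if)

definition map_graph :: "(nat \<Rightarrow> nat) \<Rightarrow> ugraph \<Rightarrow> ugraph" where
  "map_graph \<sigma> G = \<lparr>verts = \<sigma> ` verts G, edges = (`) \<sigma> ` edges G\<rparr>"

lemma map_graph_sel [simp]: "verts (map_graph \<sigma> G) = \<sigma> ` verts G"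
  "edges (map_graph \<sigma> G) = (`) \<sigma> ` edges G"
  by (simp_all add: map_graph_def)

lemma is_graph_map:
  assumes "is_graph G" "inj_on \<sigma> (verts G)"
  shows "is_graph (map_graph \<sigma> G)"
proof -
  have "card (\<sigma> ` e) = 2" if "e \<in> edges G" for e
    using that assms card_image[of \<sigma> e] inj_on_subset[of \<sigma> "verts G" e] unfolding is_graph_def by auto
  then show ?thesis using assms unfolding is_graph_def by auto
qed

lemma iso_map: "inj_on \<sigma> (verts G) \<Longrightarrow> iso G (map_graph \<sigma> G)"
  unfolding iso_def by (rule exI[of _ \<sigma>]) (auto simp: inj_on_imp_bij_betw)

lemma induced_map:
  assumes "is_graph G" "inj_on \<sigma> (verts G)" "X \<subseteq> verts G"
  shows "induced (map_graph \<sigma> G) (\<sigma> ` X) = map_graph \<sigma> (induced G X)"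
proof -
  have "e \<subseteq> X" if "e \<in> edges G" "\<sigma> ` e \<subseteq> \<sigma> ` X" for e
  proof
    fix x assume "x \<in> e"
    then have "\<sigma> x \<in> \<sigma> ` X" "x \<in> verts G" using that assms(1) by (auto simp: is_graph_def)
    then show "x \<in> X" using inj_on_image_mem_iff[OF assms(2) _ assms(3)] by blast
  qed
  then show ?thesis unfolding induced_def map_graph_def by auto
qed

subsection \<open>Rooted sums\<close>

lemma bij_betw_insert_ksets:
  assumes "z \<in> W" "finite W" "m \<ge> 1"
  shows "bij_betw (insert z) (ksets (W - {z}) (m - 1)) {X. X \<subseteq> W \<and> card X = m \<and> z \<in> X}"
proof (rule bij_betwI[of _ _ _ "\<lambda>X. X - {z}"])
  show "insert z \<in> ksets (W - {z}) (m - 1) \<rightarrow> {X. X \<subseteq> W \<and> card X = m \<and> z \<in> X}"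
    using assms by (auto simp: ksets_def card_insert_if finite_subset[of _ W] subset_iff intro!: card_insert_disjoint[THEN trans])
  show "(\<lambda>X. X - {z}) \<in> {X. X \<subseteq> W \<and> card X = m \<and> z \<in> X} \<rightarrow> ksets (W - {z}) (m - 1)"
    using assms by (auto simp: ksets_def)
qed (auto simp: ksets_def)

lemma bij_betw_insert2_ksets:
  assumes "a \<in> W" "b \<in> W" "a \<noteq> b" "finite W" "m \<ge> 2"
  shows "bij_betw (\<lambda>Y. insert a (insert b Y)) (ksets (W - {a, b}) (m - 2))
           {X. X \<subseteq> W \<and> card X = m \<and> {a, b} \<subseteq> X}"
proof (rule bij_betwI[of _ _ _ "\<lambda>X. X - {a, b}"])
  show "(\<lambda>Y. insert a (insert b Y)) \<in> ksets (W - {a, b}) (m - 2) \<rightarrow> {X. X \<subseteq> W \<and> card X = m \<and> {a, b} \<subseteq> X}"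
  proof
    fix Y assume "Y \<in> ksets (W - {a, b}) (m - 2)"
    then have "Y \<subseteq> W - {a, b}" "card Y = m - 2" "finite Y" "a \<notin> Y" "b \<notin> Y"
      using assms finite_subset[of Y W] by (auto simp: ksets_def)
    then show "insert a (insert b Y) \<in> {X. X \<subseteq> W \<and> card X = m \<and> {a, b} \<subseteq> X}"
      using assms by auto
  qed
  show "(\<lambda>X. X - {a, b}) \<in> {X. X \<subseteq> W \<and> card X = m \<and> {a, b} \<subseteq> X} \<rightarrow> ksets (W - {a, b}) (m - 2)"
    using assms by (auto simp: ksets_def card_Diff_subset)
qed (auto simp: ksets_def)

text \<open>A root outside Y whose name depends on Y alone; the successor of the sum exceeds every
  member. By invariance of \<gamma> any root can be renamed to it, so rooted graphs over the same Y
  that come from different vertices or different host graphs become literally equal and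
  cancel.\<close>

definition fresh :: "nat set \<Rightarrow> nat" where
  "fresh Y = Suc (\<Sum>Y)"

lemma less_fresh: "finite Y \<Longrightarrow> y \<in> Y \<Longrightarrow> y < fresh Y"
  unfolding fresh_def using member_le_sum[of y Y "\<lambda>y. y"] by simp

lemma fresh_notin: "finite Y \<Longrightarrow> fresh Y \<notin> Y" "finite Y \<Longrightarrow> Suc (fresh Y) \<notin> Y"
  using less_fresh by fastforce+

definition rooted :: "nat set set \<Rightarrow> nat set \<Rightarrow> nat set \<Rightarrow> nat \<Rightarrow> ugraph" where
  "rooted E N Y v = \<lparr>verts = insert v Y, edges = {e \<in> E. e \<subseteq> Y} \<union> (\<lambda>u. {v, u}) ` (N \<inter> Y)\<rparr>"

definition rooted2 :: "nat set set \<Rightarrow> nat set \<Rightarrow> nat set \<Rightarrow> bool \<Rightarrow> nat set \<Rightarrow> nat \<Rightarrow> nat \<Rightarrow> ugraph" where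
  "rooted2 E N1 N2 s Y a b = \<lparr>verts = insert a (insert b Y), edges = {e \<in> E. e \<subseteq> Y} \<union>
     (\<lambda>u. {a, u}) ` (N1 \<inter> Y) \<union> (\<lambda>u. {b, u}) ` (N2 \<inter> Y) \<union> (if s then {{a, b}} else {})\<rparr>"

lemma rooted_sel [simp]: "verts (rooted E N Y v) = insert v Y"
  "edges (rooted E N Y v) = {e \<in> E. e \<subseteq> Y} \<union> (\<lambda>u. {v, u}) ` (N \<inter> Y)"
  by (simp_all add: rooted_def)

lemma rooted2_sel [simp]: "verts (rooted2 E N1 N2 s Y a b) = insert a (insert b Y)"
  "edges (rooted2 E N1 N2 s Y a b) = {e \<in> E. e \<subseteq> Y} \<union>
     (\<lambda>u. {a, u}) ` (N1 \<inter> Y) \<union> (\<lambda>u. {b, u}) ` (N2 \<inter> Y) \<union> (if s then {{a, b}} else {})"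
  by (simp_all add: rooted2_def)

lemma rooted_cong:
  assumes "{e \<in> E. e \<subseteq> Y} = {e \<in> E'. e \<subseteq> Y}" "N \<inter> Y = N' \<inter> Y"
  shows "rooted E N Y v = rooted E' N' Y v"
  unfolding rooted_def assms by simp

lemma rooted2_cong:
  assumes "{e \<in> E. e \<subseteq> Y} = {e \<in> E'. e \<subseteq> Y}" "N1 \<inter> Y = N1' \<inter> Y" "N2 \<inter> Y = N2' \<inter> Y"
  shows "rooted2 E N1 N2 s Y a b = rooted2 E' N1' N2' s Y a b"
  unfolding rooted2_def assms by simp

lemma is_graph_rooted:
  assumes "E \<subseteq> ksets UNIV 2" "finite Y" "v \<notin> Y"
  shows "is_graph (rooted E N Y v)"
  using assms unfolding is_graph_def by (auto simp: ksets_def card_insert_if)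

lemma is_graph_rooted2:
  assumes "E \<subseteq> ksets UNIV 2" "finite Y" "a \<notin> Y" "b \<notin> Y" "a \<noteq> b"
  shows "is_graph (rooted2 E N1 N2 s Y a b)"
  using assms unfolding is_graph_def by (auto simp: ksets_def card_insert_if)

lemma map_rooted:
  assumes "v \<notin> Y"
  shows "map_graph (id(v := v')) (rooted E N Y v) = rooted E N Y v'"
proof -
  let ?\<sigma> = "id(v := v')"
  have id: "?\<sigma> ` e = e" if "e \<subseteq> Y" for e using that assms by force
  have "(`) ?\<sigma> ` {e \<in> E. e \<subseteq> Y} = {e \<in> E. e \<subseteq> Y}" using id by force
  moreover have "(`) ?\<sigma> ` (\<lambda>u. {v, u}) ` (N \<inter> Y) = (\<lambda>u. {v', u}) ` (N \<inter> Y)"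
    unfolding image_image using assms by (intro image_cong) auto
  moreover have "?\<sigma> ` insert v Y = insert v' Y" by (simp only: image_insert id[OF subset_refl] fun_upd_same)
  ultimately show ?thesis unfolding map_graph_def rooted_def by (simp add: image_Un)
qed

lemma map_rooted2:
  assumes "a \<notin> Y" "b \<notin> Y" "a \<noteq> b"
  shows "map_graph (id(a := a', b := b')) (rooted2 E N1 N2 s Y a b) = rooted2 E N1 N2 s Y a' b'"
proof -
  let ?\<sigma> = "id(a := a', b := b')"
  have id: "?\<sigma> ` e = e" if "e \<subseteq> Y" for e using that assms by force
  have "(`) ?\<sigma> ` {e \<in> E. e \<subseteq> Y} = {e \<in> E. e \<subseteq> Y}" using id by force
  moreover have "(`) ?\<sigma> ` (\<lambda>u. {a, u}) ` (N1 \<inter> Y) = (\<lambda>u. {a', u}) ` (N1 \<inter> Y)"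
    unfolding image_image using assms by (intro image_cong) auto
  moreover have "(`) ?\<sigma> ` (\<lambda>u. {b, u}) ` (N2 \<inter> Y) = (\<lambda>u. {b', u}) ` (N2 \<inter> Y)"
    unfolding image_image using assms by (intro image_cong) auto
  moreover have "?\<sigma> ` insert a (insert b Y) = insert a' (insert b' Y)"
    using assms by (simp only: image_insert id[OF subset_refl]) simp
  ultimately show ?thesis unfolding map_graph_def rooted2_def using assms by (simp add: image_Un)
qed

lemma induced_insert_rooted:
  assumes "is_graph G" "z \<notin> Y"
  shows "induced G (insert z Y) = rooted (edges G) (nbhd G z) Y z"
proof -
  have "e \<in> (\<lambda>u. {z, u}) ` (nbhd G z \<inter> Y)" if e: "e \<in> edges G" "e \<subseteq> insert z Y" "\<not> e \<subseteq> Y" for e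
  proof -
    have "z \<in> e" using e by auto
    moreover have "card e = 2" using e assms by (auto simp: is_graph_def)
    ultimately obtain u where "e = {z, u}" "u \<noteq> z" by (auto simp: card_2_iff)
    then show ?thesis using e by (auto simp: nbhd_def)
  qed
  then have "{e \<in> edges G. e \<subseteq> insert z Y} = {e \<in> edges G. e \<subseteq> Y} \<union> (\<lambda>u. {z, u}) ` (nbhd G z \<inter> Y)"
    by (auto simp: nbhd_def)
  then show ?thesis unfolding induced_def rooted_def by simp
qed

lemma induced_insert_rooted2:
  assumes "is_graph G" "a \<notin> Y" "b \<notin> Y" "a \<noteq> b"
  shows "induced G (insert a (insert b Y)) = rooted2 (edges G) (nbhd G a) (nbhd G b) ({a, b} \<in> edges G) Y a b"
proof -
  have *: "e = {a, b} \<or> e \<in> (\<lambda>u. {a, u}) ` (nbhd G a \<inter> Y) \<or> e \<in> (\<lambda>u. {b, u}) ` (nbhd G b \<inter> Y)"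
    if e: "e \<in> edges G" "e \<subseteq> insert a (insert b Y)" "\<not> e \<subseteq> Y" for e
  proof -
    have "card e = 2" using e assms by (auto simp: is_graph_def)
    then obtain x y where xy: "e = {x, y}" "x \<noteq> y" by (auto simp: card_2_iff)
    consider "a \<in> e" "b \<in> e" | "a \<in> e" "b \<notin> e" | "a \<notin> e" "b \<in> e" using e by auto
    then show ?thesis
    proof cases
      case 1
      then show ?thesis using xy assms by auto
    next
      case 2
      then obtain u where "e = {a, u}" "u \<noteq> a" using xy by auto
      then show ?thesis using e 2 by (auto simp: nbhd_def)
    next
      case 3
      then obtain u where "e = {b, u}" "u \<noteq> b" using xy by auto
      then show ?thesis using e 3 by (auto simp: nbhd_def)
    qed
  qed
  have "{e \<in> edges G. e \<subseteq> insert a (insert b Y)} = {e \<in> edges G. e \<subseteq> Y} \<union>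
     (\<lambda>u. {a, u}) ` (nbhd G a \<inter> Y) \<union> (\<lambda>u. {b, u}) ` (nbhd G b \<inter> Y) \<union> (if {a, b} \<in> edges G then {{a, b}} else {})"
    (is "?L = ?R")
  proof
    show "?L \<subseteq> ?R" using * by auto
    show "?R \<subseteq> ?L" by (auto simp: nbhd_def split: if_splits)
  qed
  then show ?thesis unfolding induced_def rooted2_def by simp
qed

lemma flip_sel [simp]: "verts (flip G a b) = verts G" "edges (flip G a b) = sym_diff (edges G) {{a, b}}"
  by (simp_all add: flip_def)

lemma is_graph_flip: "is_graph G \<Longrightarrow> a \<in> verts G \<Longrightarrow> b \<in> verts G \<Longrightarrow> a \<noteq> b \<Longrightarrow> is_graph (flip G a b)"
  unfolding is_graph_def by auto

lemma nbhd_subset: "is_graph G \<Longrightarrow> nbhd G z \<subseteq> verts G - {z}"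
  using edge_iff[of G z] unfolding nbhd_def by auto

section \<open>Degree sums and flip losses of a bounded invariant\<close>

locale bounded_invariant =
  fixes k :: nat and \<gamma> :: "ugraph \<Rightarrow> real" and M :: real
  assumes k3: "k \<ge> 3" and inv: "graph_invariant k \<gamma>" and M_pos: "M > 0"
    and M_bound: "\<And>F. is_graph F \<Longrightarrow> order F = k \<Longrightarrow> \<bar>\<gamma> F\<bar> \<le> M"
begin

lemma \<gamma>_map:
  assumes "is_graph F" "order F = k" "inj_on \<sigma> (verts F)"
  shows "\<gamma> (map_graph \<sigma> F) = \<gamma> F"
  using inv is_graph_map[OF assms(1,3)] iso_map[OF assms(3)] assms unfolding graph_invariant_def by metis

text \<open>This is \<Lambda>(G,v) for a virtual vertex v with neighbourhood N attached to the graph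
  with edges E on W. Since v need not belong to a given graph, added vertices, clones and vertices
  of a perturbed graph are all measured in the same way.\<close>

definition rsum :: "nat set set \<Rightarrow> nat set \<Rightarrow> nat set \<Rightarrow> real" where
  "rsum E N W = (\<Sum>Y\<in>ksets W (k - 1). \<gamma> (rooted E N Y (fresh Y)))"

text \<open>How much better a pair with outside neighbourhoods N1 and N2 does as a non-edge than as
  an edge. The orientation is fixed, whatever the actual state of the pair.\<close>

definition psum :: "nat set set \<Rightarrow> nat set \<Rightarrow> nat set \<Rightarrow> nat set \<Rightarrow> real" where
  "psum E N1 N2 W = (\<Sum>Y\<in>ksets W (k - 2).
     \<gamma> (rooted2 E N1 N2 False Y (fresh Y) (Suc (fresh Y))) -
     \<gamma> (rooted2 E N1 N2 True Y (fresh Y) (Suc (fresh Y))))"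

lemma \<gamma>_rooted:
  assumes "E \<subseteq> ksets UNIV 2" "finite Y" "v \<notin> Y" "card Y = k - 1"
  shows "\<gamma> (rooted E N Y v) = \<gamma> (rooted E N Y (fresh Y))"
proof -
  have "inj_on (id(v := fresh Y)) (insert v Y)" using fresh_notin[OF assms(2)] assms by (auto simp: inj_on_def)
  moreover have "order (rooted E N Y v) = k" using assms k3 by (simp add: order_def)
  ultimately show ?thesis
    using \<gamma>_map[OF is_graph_rooted[OF assms(1-3)], of N "id(v := fresh Y)"] map_rooted[OF assms(3)] by simp
qed

lemma \<gamma>_rooted2:
  assumes "E \<subseteq> ksets UNIV 2" "finite Y" "a \<notin> Y" "b \<notin> Y" "a \<noteq> b" "card Y = k - 2"
  shows "\<gamma> (rooted2 E N1 N2 s Y a b) = \<gamma> (rooted2 E N1 N2 s Y (fresh Y) (Suc (fresh Y)))"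
proof -
  have "inj_on (id(a := fresh Y, b := Suc (fresh Y))) (insert a (insert b Y))"
    using fresh_notin[OF assms(2)] assms by (auto simp: inj_on_def)
  moreover have "order (rooted2 E N1 N2 s Y a b) = k" using assms k3 by (simp add: order_def)
  ultimately show ?thesis
    using \<gamma>_map[OF is_graph_rooted2[OF assms(1-5)], of N1 N2 s "id(a := fresh Y, b := Suc (fresh Y))"]
      map_rooted2[OF assms(3-5)] by simp
qed

lemma edges_pairs: "is_graph G \<Longrightarrow> edges G \<subseteq> ksets UNIV 2"
  unfolding is_graph_def ksets_def by auto

lemma Lam_at_rsum:
  assumes "is_graph G" "z \<in> verts G"
  shows "Lam_at k \<gamma> G z = rsum (edges G) (nbhd G z) (verts G - {z})"
proof -
  have fin: "finite (verts G)" using assms is_graph_finite by auto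
  have "Lam_at k \<gamma> G z = (\<Sum>Y\<in>ksets (verts G - {z}) (k - 1). \<gamma> (induced G (insert z Y)))"
    unfolding Lam_at_def
    using sum.reindex_bij_betw[OF bij_betw_insert_ksets[OF assms(2) fin, of k], of "\<lambda>X. \<gamma> (induced G X)"] k3 by simp
  also have "\<dots> = rsum (edges G) (nbhd G z) (verts G - {z})"
    unfolding rsum_def
  proof (rule sum.cong[OF refl])
    fix Y assume "Y \<in> ksets (verts G - {z}) (k - 1)"
    then have Y: "z \<notin> Y" "finite Y" "card Y = k - 1" using fin finite_subset by (auto simp: ksets_def)
    then show "\<gamma> (induced G (insert z Y)) = \<gamma> (rooted (edges G) (nbhd G z) Y (fresh Y))"
      using induced_insert_rooted[OF assms(1)] \<gamma>_rooted[OF edges_pairs[OF assms(1)]] by simp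
  qed
  finally show ?thesis .
qed

lemma rsum_cong:
  assumes "\<And>Y. Y \<in> ksets W (k - 1) \<Longrightarrow> {e \<in> E. e \<subseteq> Y} = {e \<in> E'. e \<subseteq> Y}" "\<And>Y. Y \<in> ksets W (k - 1) \<Longrightarrow> N \<inter> Y = N' \<inter> Y"
  shows "rsum E N W = rsum E' N' W"
  unfolding rsum_def using assms by (intro sum.cong refl arg_cong[of _ _ \<gamma>] rooted_cong) auto

lemma Lam_at_add_vertex:
  assumes "is_graph G" "v \<notin> verts G" "N \<subseteq> verts G"
  shows "Lam_at k \<gamma> (add_vertex G v N) v = rsum (edges G) N (verts G)"
proof -
  have nb: "nbhd (add_vertex G v N) v = N"
    using assms edge_iff[OF assms(1), of v] by (auto simp: nbhd_def doubleton_eq_iff)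
  have "Lam_at k \<gamma> (add_vertex G v N) v = rsum (edges (add_vertex G v N)) N (verts G)"
    using Lam_at_rsum[OF is_graph_add_vertex[OF assms], of v] nb assms by simp
  also have "\<dots> = rsum (edges G) N (verts G)"
    using assms by (intro rsum_cong) (auto simp: ksets_def)
  finally show ?thesis .
qed

text \<open>Only k-sets containing both ends notice the flip. The sign converts the fixed
  orientation of \<open>psum\<close> into the loss from the current state of the pair.\<close>

lemma Lam_flip:
  assumes G: "is_graph G" and ab: "a \<in> verts G" "b \<in> verts G" "a \<noteq> b"
  shows "Lam k \<gamma> G - Lam k \<gamma> (flip G a b) =
    (if {a, b} \<in> edges G then - 1 else 1) * psum (edges G) (nbhd G a) (nbhd G b) (verts G - {a, b})"
proof -
  let ?s = "{a, b} \<in> edges G"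
  have fin: "finite (verts G)" using G is_graph_finite by auto
  let ?A = "{X. X \<subseteq> verts G \<and> card X = k}" and ?A' = "{X. X \<subseteq> verts G \<and> card X = k \<and> {a, b} \<subseteq> X}"
  have finA: "finite ?A" using finite_ksets[OF fin] unfolding ksets_def .
  have "Lam k \<gamma> G - Lam k \<gamma> (flip G a b) = (\<Sum>X\<in>?A. \<gamma> (induced G X) - \<gamma> (induced (flip G a b) X))"
    unfolding Lam_def by (simp add: sum_subtractf)
  also have "\<dots> = (\<Sum>X\<in>?A'. \<gamma> (induced G X) - \<gamma> (induced (flip G a b) X))"
  proof (rule sum.mono_neutral_right[OF finA])
    show "\<forall>X\<in>?A - ?A'. \<gamma> (induced G X) - \<gamma> (induced (flip G a b) X) = 0"
    proof
      fix X assume "X \<in> ?A - ?A'"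
      then have "induced G X = induced (flip G a b) X" unfolding induced_def flip_def by auto
      then show "\<gamma> (induced G X) - \<gamma> (induced (flip G a b) X) = 0" by simp
    qed
  qed auto
  also have "\<dots> = (\<Sum>Y\<in>ksets (verts G - {a, b}) (k - 2).
      \<gamma> (induced G (insert a (insert b Y))) - \<gamma> (induced (flip G a b) (insert a (insert b Y))))"
    using sum.reindex_bij_betw[OF bij_betw_insert2_ksets[OF ab fin, of k],
        of "\<lambda>X. \<gamma> (induced G X) - \<gamma> (induced (flip G a b) X)"] k3 by simp
  also have "\<dots> = (\<Sum>Y\<in>ksets (verts G - {a, b}) (k - 2).
      \<gamma> (rooted2 (edges G) (nbhd G a) (nbhd G b) ?s Y (fresh Y) (Suc (fresh Y))) -
      \<gamma> (rooted2 (edges G) (nbhd G a) (nbhd G b) (\<not> ?s) Y (fresh Y) (Suc (fresh Y))))"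
  proof (rule sum.cong[OF refl])
    fix Y assume "Y \<in> ksets (verts G - {a, b}) (k - 2)"
    then have Y: "a \<notin> Y" "b \<notin> Y" "finite Y" "card Y = k - 2" using fin finite_subset by (auto simp: ksets_def)
    have 1: "\<gamma> (induced G (insert a (insert b Y))) =
      \<gamma> (rooted2 (edges G) (nbhd G a) (nbhd G b) ?s Y (fresh Y) (Suc (fresh Y)))"
      using induced_insert_rooted2[OF G] \<gamma>_rooted2[OF edges_pairs[OF G]] Y ab by simp
    have "induced (flip G a b) (insert a (insert b Y)) =
       rooted2 (edges (flip G a b)) (nbhd (flip G a b) a) (nbhd (flip G a b) b) (\<not> ?s) Y a b"
      using induced_insert_rooted2[OF is_graph_flip[OF G ab], of a Y b] Y ab by (simp add: flip_def)
    also have "\<dots> = rooted2 (edges G) (nbhd G a) (nbhd G b) (\<not> ?s) Y a b"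
      using Y ab by (intro rooted2_cong) (auto simp: nbhd_def doubleton_eq_iff)
    finally have 2: "\<gamma> (induced (flip G a b) (insert a (insert b Y))) =
      \<gamma> (rooted2 (edges G) (nbhd G a) (nbhd G b) (\<not> ?s) Y (fresh Y) (Suc (fresh Y)))"
      using \<gamma>_rooted2[OF edges_pairs[OF G]] Y ab by simp
    show "\<gamma> (induced G (insert a (insert b Y))) - \<gamma> (induced (flip G a b) (insert a (insert b Y))) =
      \<gamma> (rooted2 (edges G) (nbhd G a) (nbhd G b) ?s Y (fresh Y) (Suc (fresh Y))) -
      \<gamma> (rooted2 (edges G) (nbhd G a) (nbhd G b) (\<not> ?s) Y (fresh Y) (Suc (fresh Y)))"
      unfolding 1 2 ..
  qed
  also have "\<dots> = (if ?s then - 1 else 1) * psum (edges G) (nbhd G a) (nbhd G b) (verts G - {a, b})"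
    unfolding psum_def sum_distrib_left by (intro sum.cong) auto
  finally show ?thesis .
qed

lemma \<gamma>_rooted_bound:
  assumes "E \<subseteq> ksets UNIV 2" "finite W" "Y \<in> ksets W (k - 1)"
  shows "\<bar>\<gamma> (rooted E N Y (fresh Y))\<bar> \<le> M"
proof -
  have Y: "finite Y" "card Y = k - 1" using assms finite_subset by (auto simp: ksets_def)
  then show ?thesis
    using M_bound[OF is_graph_rooted[OF assms(1) Y(1) fresh_notin(1)[OF Y(1)]]] fresh_notin[OF Y(1)] k3
    by (simp add: order_def)
qed

lemma \<gamma>_rooted2_bound:
  assumes "E \<subseteq> ksets UNIV 2" "finite W" "Y \<in> ksets W (k - 2)"
  shows "\<bar>\<gamma> (rooted2 E N1 N2 s Y (fresh Y) (Suc (fresh Y)))\<bar> \<le> M"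
proof -
  have Y: "finite Y" "card Y = k - 2" using assms finite_subset by (auto simp: ksets_def)
  then show ?thesis
    using M_bound[OF is_graph_rooted2[OF assms(1) Y(1) fresh_notin[OF Y(1)]]] fresh_notin[OF Y(1)] k3
    by (simp add: order_def)
qed

lemma rsum_diff:
  assumes "E \<subseteq> ksets UNIV 2" "E' \<subseteq> ksets UNIV 2" "finite W"
  shows "\<bar>rsum E N W - rsum E' N' W\<bar> \<le>
    2 * M * real (card {Y \<in> ksets W (k - 1). {e \<in> E. e \<subseteq> Y} \<noteq> {e \<in> E'. e \<subseteq> Y} \<or> N \<inter> Y \<noteq> N' \<inter> Y})"
  unfolding rsum_def
proof (rule abs_sum_diff_le)
  show "\<bar>\<gamma> (rooted E N Y (fresh Y)) - \<gamma> (rooted E' N' Y (fresh Y))\<bar> \<le> 2 * M" if "Y \<in> ksets W (k - 1)" for Y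
    using \<gamma>_rooted_bound[OF assms(1,3) that, of N] \<gamma>_rooted_bound[OF assms(2,3) that, of N'] by linarith
  show "\<gamma> (rooted E N Y (fresh Y)) = \<gamma> (rooted E' N' Y (fresh Y))"
    if "Y \<in> ksets W (k - 1)" "Y \<notin> {Y \<in> ksets W (k - 1). {e \<in> E. e \<subseteq> Y} \<noteq> {e \<in> E'. e \<subseteq> Y} \<or> N \<inter> Y \<noteq> N' \<inter> Y}" for Y
  proof -
    from that have "{e \<in> E. e \<subseteq> Y} = {e \<in> E'. e \<subseteq> Y}" "N \<inter> Y = N' \<inter> Y" by blast+
    from rooted_cong[OF this] show ?thesis by (simp only:)
  qed
qed (use assms M_pos in auto)

lemma psum_diff:
  assumes "E \<subseteq> ksets UNIV 2" "E' \<subseteq> ksets UNIV 2" "finite W"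
  shows "\<bar>psum E N1 N2 W - psum E' N1' N2' W\<bar> \<le>
    4 * M * real (card {Y \<in> ksets W (k - 2). {e \<in> E. e \<subseteq> Y} \<noteq> {e \<in> E'. e \<subseteq> Y} \<or> N1 \<inter> Y \<noteq> N1' \<inter> Y \<or> N2 \<inter> Y \<noteq> N2' \<inter> Y})"
    (is "_ \<le> _ * real (card ?A)")
  unfolding psum_def
proof (rule abs_sum_diff_le)
  let ?g = "\<lambda>E N1 N2 s Y. \<gamma> (rooted2 E N1 N2 s Y (fresh Y) (Suc (fresh Y)))"
  show "\<bar>?g E N1 N2 False Y - ?g E N1 N2 True Y - (?g E' N1' N2' False Y - ?g E' N1' N2' True Y)\<bar> \<le> 4 * M"
    if "Y \<in> ksets W (k - 2)" for Y
    using \<gamma>_rooted2_bound[OF assms(1,3) that, of N1 N2 False] \<gamma>_rooted2_bound[OF assms(1,3) that, of N1 N2 True]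
      \<gamma>_rooted2_bound[OF assms(2,3) that, of N1' N2' False] \<gamma>_rooted2_bound[OF assms(2,3) that, of N1' N2' True]
    by linarith
  show "?g E N1 N2 False Y - ?g E N1 N2 True Y = ?g E' N1' N2' False Y - ?g E' N1' N2' True Y"
    if "Y \<in> ksets W (k - 2)" "Y \<notin> ?A" for Y
  proof -
    from that have "{e \<in> E. e \<subseteq> Y} = {e \<in> E'. e \<subseteq> Y}" "N1 \<inter> Y = N1' \<inter> Y" "N2 \<inter> Y = N2' \<inter> Y" by blast+
    from rooted2_cong[OF this] show ?thesis by (simp only:)
  qed
qed (use assms M_pos in auto)

lemma rsum_restrict:
  assumes "E \<subseteq> ksets UNIV 2" "finite W" "Z \<subseteq> W"
  shows "\<bar>rsum E N W - rsum E N (W - Z)\<bar> \<le> M * real (card {Y \<in> ksets W (k - 1). Y \<inter> Z \<noteq> {}})"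
proof -
  have "ksets (W - Z) (k - 1) = {Y \<in> ksets W (k - 1). Y \<inter> Z = {}}" by (auto simp: ksets_def)
  then have "rsum E N (W - Z) = (\<Sum>Y\<in>ksets W (k - 1). if Y \<inter> Z = {} then \<gamma> (rooted E N Y (fresh Y)) else 0)"
    unfolding rsum_def using assms(2) by (simp add: sum.inter_filter)
  then show ?thesis
    unfolding rsum_def
    by (simp only:) (rule abs_sum_diff_le, use assms M_pos \<gamma>_rooted_bound[OF assms(1,2)] in auto)
qed

lemma psum_restrict:
  assumes "E \<subseteq> ksets UNIV 2" "finite W" "Z \<subseteq> W"
  shows "\<bar>psum E N1 N2 W - psum E N1 N2 (W - Z)\<bar> \<le> 2 * M * real (card {Y \<in> ksets W (k - 2). Y \<inter> Z \<noteq> {}})"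
proof -
  let ?g = "\<lambda>s Y. \<gamma> (rooted2 E N1 N2 s Y (fresh Y) (Suc (fresh Y)))"
  have "ksets (W - Z) (k - 2) = {Y \<in> ksets W (k - 2). Y \<inter> Z = {}}" by (auto simp: ksets_def)
  then have eq: "psum E N1 N2 (W - Z) = (\<Sum>Y\<in>ksets W (k - 2). if Y \<inter> Z = {} then ?g False Y - ?g True Y else 0)"
    unfolding psum_def using assms(2) by (simp add: sum.inter_filter)
  have "\<bar>?g False Y - ?g True Y\<bar> \<le> 2 * M" if "Y \<in> ksets W (k - 2)" for Y
    using \<gamma>_rooted2_bound[OF assms(1,2) that, of N1 N2 False] \<gamma>_rooted2_bound[OF assms(1,2) that, of N1 N2 True]
    by linarith
  then show ?thesis
    unfolding eq unfolding psum_def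
    by (intro abs_sum_diff_le) (use assms M_pos in auto)
qed

end

lemma finite_graphs_on: "finite V \<Longrightarrow> finite {F. is_graph F \<and> verts F = V}"
proof -
  assume V: "finite V"
  have "{F. is_graph F \<and> verts F = V} \<subseteq> (\<lambda>E. \<lparr>verts = V, edges = E\<rparr>) ` Pow (Pow V)"
  proof
    fix F assume F: "F \<in> {F. is_graph F \<and> verts F = V}"
    then have "F = \<lparr>verts = V, edges = edges F\<rparr>" by simp
    moreover have "edges F \<in> Pow (Pow V)" using F by (auto simp: is_graph_def)
    ultimately show "F \<in> (\<lambda>E. \<lparr>verts = V, edges = E\<rparr>) ` Pow (Pow V)" by (rule image_eqI)
  qed
  then show ?thesis using V finite_subset by blast
qed

lemma ex_canonical_copy:
  assumes "is_graph G"
  obtains \<sigma> where "bij_betw \<sigma> (verts G) {1..order G}"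
proof -
  have "card (verts G) = card {1..order G}" by (simp add: order_def)
  then show ?thesis
    using finite_same_card_bij[OF is_graph_finite[OF assms] finite_atLeastAtMost] that by blast
qed

text \<open>Up to isomorphism there are finitely many graphs on k vertices. The inserted 1 keeps M
  positive when \<gamma> vanishes on all of them.\<close>

lemma ex_bounded_invariant:
  assumes "k \<ge> 3" "graph_invariant k \<gamma>"
  obtains M where "bounded_invariant k \<gamma> M"
proof -
  let ?S = "{F. is_graph F \<and> verts F = {1..k}}"
  have fin: "finite ((\<lambda>F. \<bar>\<gamma> F\<bar>) ` ?S)" using finite_graphs_on[of "{1..k}"] by simp
  define M where "M = Max (insert 1 ((\<lambda>F. \<bar>\<gamma> F\<bar>) ` ?S))"
  have "\<bar>\<gamma> F\<bar> \<le> M" if F: "is_graph F" "order F = k" for F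
  proof -
    obtain \<sigma> where \<sigma>: "bij_betw \<sigma> (verts F) {1..k}" using ex_canonical_copy[OF F(1)] F(2) by auto
    then have inj: "inj_on \<sigma> (verts F)" by (simp add: bij_betw_def)
    have "\<gamma> F = \<gamma> (map_graph \<sigma> F)"
      using assms(2) is_graph_map[OF F(1) inj] iso_map[OF inj] F unfolding graph_invariant_def by blast
    moreover have "map_graph \<sigma> F \<in> ?S" using is_graph_map[OF F(1) inj] \<sigma> by (simp add: bij_betw_def)
    ultimately show ?thesis using fin unfolding M_def by (intro Max_ge) auto
  qed
  moreover have "M > 0" using fin unfolding M_def by (intro less_le_trans[OF zero_less_one Max_ge]) auto
  ultimately have "bounded_invariant k \<gamma> M" using assms by unfold_locales auto
  then show ?thesis by (rule that)
qed

section \<open>Simultaneous change of many pairs, and vertex deletion\<close>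

definition toggle :: "ugraph \<Rightarrow> nat set set \<Rightarrow> ugraph" where
  "toggle G D = \<lparr>verts = verts G, edges = sym_diff (edges G) D\<rparr>"

lemma toggle_sel [simp]: "verts (toggle G D) = verts G" "edges (toggle G D) = sym_diff (edges G) D"
  by (simp_all add: toggle_def)

lemma toggle_empty [simp]: "toggle G {} = G"
  by (simp add: toggle_def)

lemma is_graph_toggle: "is_graph G \<Longrightarrow> D \<subseteq> ksets (verts G) 2 \<Longrightarrow> is_graph (toggle G D)"
  unfolding is_graph_iff by auto

lemma toggle_single: "toggle G {{a, b}} = flip G a b"
  by (simp add: toggle_def flip_def)

lemma toggle_sym_diff:
  assumes "verts H = verts G"
  shows "toggle G (sym_diff (edges G) (edges H)) = H"
proof -
  have "sym_diff (edges G) (sym_diff (edges G) (edges H)) = edges H" by auto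
  then show ?thesis using assms by (simp add: toggle_def)
qed

context bounded_invariant
begin

lemma Lam_ksets: "Lam k \<gamma> G = (\<Sum>X\<in>ksets (verts G) k. \<gamma> (induced G X))"
  by (simp add: Lam_def ksets_def)

lemma \<gamma>_induced_bound: "is_graph G \<Longrightarrow> X \<in> ksets (verts G) k \<Longrightarrow> \<bar>\<gamma> (induced G X)\<bar> \<le> M"
  by (intro M_bound is_graph_induced) (auto simp: ksets_def)

lemma Lam_del:
  assumes "is_graph G" "z \<in> verts G"
  shows "Lam k \<gamma> G = Lam k \<gamma> (del_vertex G z) + Lam_at k \<gamma> G z"
proof -
  let ?A = "{X. X \<subseteq> verts G \<and> card X = k}"
  have fin: "finite ?A" using finite_ksets[OF is_graph_finite[OF assms(1)]] unfolding ksets_def .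
  have "Lam k \<gamma> (del_vertex G z) = (\<Sum>X\<in>{X \<in> ?A. z \<notin> X}. \<gamma> (induced G X))"
    unfolding Lam_def
  proof (rule sum.cong)
    show "\<gamma> (induced (del_vertex G z) X) = \<gamma> (induced G X)" if "X \<in> {X \<in> ?A. z \<notin> X}" for X
      using that unfolding induced_def del_vertex_def by (intro arg_cong[of _ _ \<gamma>]) auto
  qed auto
  moreover have "Lam_at k \<gamma> G z = (\<Sum>X\<in>{X \<in> ?A. z \<in> X}. \<gamma> (induced G X))"
    unfolding Lam_at_def by (intro sum.cong) auto
  moreover have "?A = {X \<in> ?A. z \<notin> X} \<union> {X \<in> ?A. z \<in> X}" by auto
  ultimately show ?thesis
    unfolding Lam_def using sum.union_disjoint[of "{X \<in> ?A. z \<notin> X}" "{X \<in> ?A. z \<in> X}" "\<lambda>X. \<gamma> (induced G X)"] fin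
    by (metis (no_types, lifting) disjoint_iff finite_Un mem_Collect_eq)
qed

lemma sum_Lam_at:
  assumes "is_graph G"
  shows "(\<Sum>u\<in>verts G. Lam_at k \<gamma> G u) = real k * Lam k \<gamma> G"
proof -
  let ?A = "ksets (verts G) k"
  have fin: "finite (verts G)" using is_graph_finite[OF assms] .
  then have finA: "finite ?A" by simp
  have "(\<Sum>u\<in>verts G. Lam_at k \<gamma> G u) = (\<Sum>u\<in>verts G. \<Sum>X\<in>?A. if u \<in> X then \<gamma> (induced G X) else 0)"
  proof (rule sum.cong[OF refl])
    fix u
    have "{X. X \<subseteq> verts G \<and> card X = k \<and> u \<in> X} = {X \<in> ?A. u \<in> X}" by (auto simp: ksets_def)
    then show "Lam_at k \<gamma> G u = (\<Sum>X\<in>?A. if u \<in> X then \<gamma> (induced G X) else 0)"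
      unfolding Lam_at_def using finA by (simp add: sum.inter_filter)
  qed
  also have "\<dots> = (\<Sum>X\<in>?A. \<Sum>u\<in>verts G. if u \<in> X then \<gamma> (induced G X) else 0)" by (rule sum.swap)
  also have "\<dots> = (\<Sum>X\<in>?A. real k * \<gamma> (induced G X))"
  proof (rule sum.cong[OF refl])
    fix X assume "X \<in> ?A"
    then have "X \<subseteq> verts G" "card X = k" by (auto simp: ksets_def)
    then have "{u \<in> verts G. u \<in> X} = X" by auto
    then show "(\<Sum>u\<in>verts G. if u \<in> X then \<gamma> (induced G X) else 0) = real k * \<gamma> (induced G X)"
      using fin \<open>card X = k\<close> by (simp flip: sum.inter_filter)
  qed
  finally show ?thesis by (simp add: Lam_ksets sum_distrib_left)
qed

lemma sum_Lam_del:
  assumes "is_graph G"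
  shows "(\<Sum>u\<in>verts G. Lam k \<gamma> (del_vertex G u)) = (real (order G) - real k) * Lam k \<gamma> G"
proof -
  have "(\<Sum>u\<in>verts G. Lam k \<gamma> (del_vertex G u)) = (\<Sum>u\<in>verts G. Lam k \<gamma> G - Lam_at k \<gamma> G u)"
    using Lam_del[OF assms] by (intro sum.cong) auto
  then show ?thesis using sum_Lam_at[OF assms] by (simp add: sum_subtractf order_def algebra_simps)
qed

lemma Lam_map:
  assumes "is_graph G" "inj_on \<sigma> (verts G)"
  shows "Lam k \<gamma> (map_graph \<sigma> G) = Lam k \<gamma> G"
proof -
  have bij: "bij_betw ((`) \<sigma>) (ksets (verts G) k) (ksets (verts (map_graph \<sigma> G)) k)"
  proof (rule bij_betw_imageI)
    show "inj_on ((`) \<sigma>) (ksets (verts G) k)"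
    proof (rule inj_onI)
      fix X Y assume "X \<in> ksets (verts G) k" "Y \<in> ksets (verts G) k" "\<sigma> ` X = \<sigma> ` Y"
      then show "X = Y" using inj_on_image_eq_iff[OF assms(2)] by (auto simp: ksets_def)
    qed
    show "(`) \<sigma> ` ksets (verts G) k = ksets (verts (map_graph \<sigma> G)) k"
    proof
      show "(`) \<sigma> ` ksets (verts G) k \<subseteq> ksets (verts (map_graph \<sigma> G)) k"
        using assms(2) by (auto simp: ksets_def card_image inj_on_subset)
      show "ksets (verts (map_graph \<sigma> G)) k \<subseteq> (`) \<sigma> ` ksets (verts G) k"
      proof
        fix X assume "X \<in> ksets (verts (map_graph \<sigma> G)) k"
        then obtain Y where "Y \<subseteq> verts G" "X = \<sigma> ` Y" "card X = k"
          by (auto simp: ksets_def subset_image_iff)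
        then have "Y \<in> ksets (verts G) k" using card_image[OF inj_on_subset[OF assms(2)]] by (auto simp: ksets_def)
        then show "X \<in> (`) \<sigma> ` ksets (verts G) k" using \<open>X = \<sigma> ` Y\<close> by auto
      qed
    qed
  qed
  have "Lam k \<gamma> (map_graph \<sigma> G) = (\<Sum>X\<in>ksets (verts G) k. \<gamma> (induced (map_graph \<sigma> G) (\<sigma> ` X)))"
    unfolding Lam_ksets using sum.reindex_bij_betw[OF bij, of "\<lambda>X. \<gamma> (induced (map_graph \<sigma> G) X)"] by simp
  also have "\<dots> = (\<Sum>X\<in>ksets (verts G) k. \<gamma> (induced G X))"
  proof (rule sum.cong[OF refl])
    fix X assume "X \<in> ksets (verts G) k"
    then have X: "X \<subseteq> verts G" "card X = k" by (auto simp: ksets_def)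
    then show "\<gamma> (induced (map_graph \<sigma> G) (\<sigma> ` X)) = \<gamma> (induced G X)"
      using induced_map[OF assms X(1)] \<gamma>_map[OF is_graph_induced[OF assms(1) X(1)]] inj_on_subset[OF assms(2) X(1)]
      by simp
  qed
  finally show ?thesis unfolding Lam_ksets .
qed

lemma lam_map:
  assumes "is_graph G" "inj_on \<sigma> (verts G)"
  shows "lam k \<gamma> (map_graph \<sigma> G) = lam k \<gamma> G"
  using Lam_map[OF assms] card_image[OF assms(2)] by (simp add: lam_def order_def)

lemma Lam_bound: "is_graph G \<Longrightarrow> \<bar>Lam k \<gamma> G\<bar> \<le> M * real (order G choose k)"
proof -
  assume G: "is_graph G"
  have "\<bar>Lam k \<gamma> G\<bar> \<le> (\<Sum>X\<in>ksets (verts G) k. \<bar>\<gamma> (induced G X)\<bar>)" unfolding Lam_ksets by (rule sum_abs)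
  also have "\<dots> \<le> (\<Sum>X\<in>ksets (verts G) k. M)" using \<gamma>_induced_bound[OF G] by (rule sum_mono)
  finally show ?thesis using card_ksets[OF is_graph_finite[OF G]] by (simp add: order_def mult.commute)
qed

lemma lam_bound: "is_graph G \<Longrightarrow> \<bar>lam k \<gamma> G\<bar> \<le> M"
  using Lam_bound[of G] M_pos by (cases "order G choose k = 0") (auto simp: lam_def field_simps abs_divide simp del: binomial_eq_0_iff)

text \<open>Pairs are toggled one at a time. After others have been toggled, the loss at e differs
  from its loss in H only on k-sets that contain e and another pair of D, and there by at most 4M
  because four values of \<gamma> are compared. So toggles that are costly one by one are costly
  together, provided that pairs of D seldom share a k-set.\<close>

lemma Lam_toggle_le:
  assumes H: "is_graph H" and D: "D \<subseteq> ksets (verts H) 2"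
    and loss: "\<And>e. e \<in> D \<Longrightarrow> Lam k \<gamma> H - Lam k \<gamma> (toggle H {e}) \<ge> \<kappa>"
    and few: "\<And>e. e \<in> D \<Longrightarrow>
      real (card {X \<in> ksets (verts H) k. e \<subseteq> X \<and> (\<exists>e'\<in>D. e' \<noteq> e \<and> e' \<subseteq> X)}) \<le> \<rho>"
  shows "Lam k \<gamma> H - Lam k \<gamma> (toggle H D) \<ge> real (card D) * (\<kappa> - 4 * M * \<rho>)"
proof -
  have fin: "finite (verts H)" using is_graph_finite[OF H] .
  have finD: "finite D" using finite_subset[OF D] fin by simp
  have "Lam k \<gamma> H - Lam k \<gamma> (toggle H D') \<ge> real (card D') * (\<kappa> - 4 * M * \<rho>)" if "D' \<subseteq> D" for D'
    using finite_subset[OF that finD] that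
  proof (induction D' rule: finite_induct)
    case empty
    then show ?case by simp
  next
    case (insert e D')
    have eD: "e \<in> D" "D' \<subseteq> D" using insert by auto
    let ?A = "ksets (verts H) k" and ?A' = "{X \<in> ksets (verts H) k. e \<subseteq> X \<and> (\<exists>e'\<in>D. e' \<noteq> e \<and> e' \<subseteq> X)}"
    let ?h = "\<lambda>D X. \<gamma> (induced (toggle H D) X)"
    have gr: "is_graph (toggle H F)" if "F \<subseteq> D" for F using is_graph_toggle[OF H] that D by blast
    have bd: "\<bar>?h F X\<bar> \<le> M" if "F \<subseteq> D" "X \<in> ?A" for F X
      using \<gamma>_induced_bound[OF gr[OF that(1)]] that(2) by simp
    have "\<bar>(\<Sum>X\<in>?A. ?h D' X - ?h (insert e D') X) - (\<Sum>X\<in>?A. ?h {} X - ?h {e} X)\<bar> \<le> 4 * M * real (card ?A')"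
    proof (rule abs_sum_diff_le)
      show "\<bar>?h D' X - ?h (insert e D') X - (?h {} X - ?h {e} X)\<bar> \<le> 4 * M" if "X \<in> ?A" for X
        using bd[OF _ that, of D'] bd[OF _ that, of "insert e D'"] bd[OF _ that, of "{}"] bd[OF _ that, of "{e}"] eD
        by auto
      show "?h D' X - ?h (insert e D') X = ?h {} X - ?h {e} X" if X: "X \<in> ?A" "X \<notin> ?A'" for X
      proof (cases "e \<subseteq> X")
        case False
        then have "induced (toggle H D') X = induced (toggle H (insert e D')) X"
          "induced (toggle H {}) X = induced (toggle H {e}) X"
          unfolding induced_def toggle_def by auto
        then show ?thesis by simp
      next
        case True
        have no: "\<not> e' \<subseteq> X" if "e' \<in> D'" for e'
        proof
          assume "e' \<subseteq> X"
          moreover have "e' \<in> D" "e' \<noteq> e" using that eD insert.hyps by auto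
          ultimately have "X \<in> ?A'" using X(1) True by blast
          then show False using X(2) by contradiction
        qed
        have "{f \<in> edges (toggle H D'). f \<subseteq> X} = {f \<in> edges (toggle H {}). f \<subseteq> X}"
          "{f \<in> edges (toggle H (insert e D')). f \<subseteq> X} = {f \<in> edges (toggle H {e}). f \<subseteq> X}"
          unfolding toggle_sel using no by blast+
        then show ?thesis unfolding induced_def by (simp only: toggle_sel)
      qed
    qed (use fin M_pos in auto)
    then have "Lam k \<gamma> (toggle H D') - Lam k \<gamma> (toggle H (insert e D')) \<ge>
       Lam k \<gamma> (toggle H {}) - Lam k \<gamma> (toggle H {e}) - 4 * M * real (card ?A')"
      by (simp add: Lam_ksets sum_subtractf)
    moreover have "4 * M * real (card ?A') \<le> 4 * M * \<rho>" using few[OF eD(1)] M_pos by simp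
    moreover have "Lam k \<gamma> (toggle H {}) - Lam k \<gamma> (toggle H {e}) \<ge> \<kappa>"
      using loss[OF eD(1)] by simp
    moreover have "Lam k \<gamma> H - Lam k \<gamma> (toggle H D') \<ge> real (card D') * (\<kappa> - 4 * M * \<rho>)"
      using insert.IH eD by blast
    moreover have "real (card (insert e D')) * (\<kappa> - 4 * M * \<rho>) = real (card D') * (\<kappa> - 4 * M * \<rho>) + (\<kappa> - 4 * M * \<rho>)"
      using insert.hyps by (simp add: algebra_simps)
    ultimately show ?case by linarith
  qed
  then show ?thesis by blast
qed

subsection \<open>Maxima\<close>

lemma finite_lam_values: "finite {lam k \<gamma> G | G. is_graph G \<and> order G = n}"
proof -
  have "{lam k \<gamma> G | G. is_graph G \<and> order G = n} \<subseteq> lam k \<gamma> ` {F. is_graph F \<and> verts F = {1..n}}"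
  proof clarify
    fix G assume G: "is_graph G" "n = order G"
    obtain \<sigma> where \<sigma>: "bij_betw \<sigma> (verts G) {1..order G}" using ex_canonical_copy[OF G(1)] .
    then have inj: "inj_on \<sigma> (verts G)" by (simp add: bij_betw_def)
    show "lam k \<gamma> G \<in> lam k \<gamma> ` {F. is_graph F \<and> verts F = {1..order G}}"
      using lam_map[OF G(1) inj] is_graph_map[OF G(1) inj] \<sigma>
      by (intro image_eqI[of _ _ "map_graph \<sigma> G"]) (auto simp: bij_betw_def)
  qed
  then show ?thesis using finite_graphs_on[of "{1..n}"] finite_subset by blast
qed

lemma lam_values_ne: "{lam k \<gamma> G | G. is_graph G \<and> order G = n} \<noteq> {}"
proof -
  have "is_graph \<lparr>verts = {1..n}, edges = {}\<rparr>" "order \<lparr>verts = {1..n}, edges = {}\<rparr> = n"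
    by (auto simp: is_graph_def order_def)
  then show ?thesis by blast
qed

lemma lam_le_lam_order: "is_graph G \<Longrightarrow> lam k \<gamma> G \<le> lam_order k \<gamma> (order G)"
  unfolding lam_order_def by (rule Max_ge[OF finite_lam_values]) auto

lemma lam_order_attained:
  obtains G where "is_graph G" "order G = n" "lam k \<gamma> G = lam_order k \<gamma> n"
  using Max_in[OF finite_lam_values lam_values_ne, of n] unfolding lam_order_def by auto

text \<open>Averaging over vertex deletions: each k-set survives n + 1 - k of the n + 1 deletions,
  so the density of a graph is the mean of the densities of its vertex-deleted subgraphs.\<close>

lemma lam_order_Suc_le:
  assumes "n \<ge> k"
  shows "lam_order k \<gamma> (Suc n) \<le> lam_order k \<gamma> n"
proof -
  obtain G where G: "is_graph G" "order G = Suc n" "lam k \<gamma> G = lam_order k \<gamma> (Suc n)"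
    using lam_order_attained .
  have pos: "n choose k > 0" "Suc n choose k > 0" using assms by simp_all
  have id: "(real (Suc n) - real k) * real (Suc n choose k) = real (Suc n) * real (n choose k)"
  proof -
    have "(Suc n - k) * (Suc n choose k) = Suc n * (n choose k)"
      using binomial_absorb_comp[of "Suc n" k] by simp
    then have "real (Suc n - k) * real (Suc n choose k) = real (Suc n) * real (n choose k)"
      by (metis of_nat_mult)
    then show ?thesis using assms by (simp add: of_nat_diff)
  qed
  have del: "Lam k \<gamma> (del_vertex G u) \<le> lam_order k \<gamma> n * real (n choose k)" if u: "u \<in> verts G" for u
  proof -
    have "order (del_vertex G u) = n" using G u is_graph_finite[OF G(1)] by (simp add: order_def)
    then have "lam k \<gamma> (del_vertex G u) \<le> lam_order k \<gamma> n"
      using lam_le_lam_order[OF is_graph_del_vertex[OF G(1)], of u] by simp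
    then show ?thesis using pos \<open>order (del_vertex G u) = n\<close> by (simp add: lam_def divide_simps)
  qed
  have "(real (Suc n) - real k) * Lam k \<gamma> G \<le> (\<Sum>u\<in>verts G. lam_order k \<gamma> n * real (n choose k))"
  proof -
    have "(real (Suc n) - real k) * Lam k \<gamma> G = (\<Sum>u\<in>verts G. Lam k \<gamma> (del_vertex G u))"
      by (simp only: sum_Lam_del[OF G(1)] G(2))
    then show ?thesis using sum_mono[of "verts G", OF del] by (simp only:)
  qed
  also have "\<dots> = real (Suc n) * real (n choose k) * lam_order k \<gamma> n" using G(2) by (simp add: order_def)
  also have "\<dots> = (real (Suc n) - real k) * real (Suc n choose k) * lam_order k \<gamma> n" using id by simp
  finally have "(real (Suc n) - real k) * Lam k \<gamma> G \<le> (real (Suc n) - real k) * (real (Suc n choose k) * lam_order k \<gamma> n)"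
    by (simp only: mult.assoc)
  then have "Lam k \<gamma> G \<le> real (Suc n choose k) * lam_order k \<gamma> n"
    using assms by (subst (asm) mult_le_cancel_left_pos) auto
  then show ?thesis using G pos by (simp add: lam_def divide_simps mult.commute del: binomial_Suc_Suc)
qed

text \<open>\<open>lam_max\<close> is defined by \<open>lim\<close>, which says nothing until
  convergence is established.\<close>

lemma lam_order_tendsto: "lam_order k \<gamma> \<longlonglongrightarrow> lam_max k \<gamma>"
proof -
  have "decseq (\<lambda>n. lam_order k \<gamma> (n + k))"
    by (rule decseq_SucI) (use lam_order_Suc_le in auto)
  moreover have "- M \<le> lam_order k \<gamma> (n + k)" for n
    using lam_order_attained[of "n + k"] lam_bound by (metis abs_le_iff minus_le_iff)
  ultimately obtain L where "(\<lambda>n. lam_order k \<gamma> (n + k)) \<longlonglongrightarrow> L"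
    using decseq_convergent[of "\<lambda>n. lam_order k \<gamma> (n + k)" "- M"] by blast
  then have "lam_order k \<gamma> \<longlonglongrightarrow> L" by (rule LIMSEQ_offset)
  then show ?thesis unfolding lam_max_def using limI by metis
qed

end

subsection \<open>Coloured complete partite graphs\<close>

text \<open>Colour \<open>0\<close> stands for \<open>V\<^sub>0\<close>: each vertex of colour \<open>0\<close> is a part of its own.\<close>

definition cgraph :: "nat set \<Rightarrow> (nat \<Rightarrow> nat) \<Rightarrow> ugraph" where
  "cgraph W f = \<lparr>verts = W, edges = {{u, w} | u w. u \<in> W \<and> w \<in> W \<and> u \<noteq> w \<and> (f u = 0 \<or> f u \<noteq> f w)}\<rparr>"

text \<open>The neighbourhood of a new vertex of colour j. For j = 0 it is all of W, including the
  vertex that is cloned, in agreement with \<open>is_clone\<close>; the neighbourhood of an existing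
  vertex arises by removing that vertex.\<close>

definition cnb :: "nat set \<Rightarrow> (nat \<Rightarrow> nat) \<Rightarrow> nat \<Rightarrow> nat set" where
  "cnb W f j = {w \<in> W. j = 0 \<or> f w \<noteq> j}"

lemma verts_cgraph [simp]: "verts (cgraph W f) = W"
  by (simp add: cgraph_def)

lemma order_cgraph [simp]: "order (cgraph W f) = card W"
  by (simp add: order_def)

lemma cgraph_edge: "{a, b} \<in> edges (cgraph W f) \<longleftrightarrow> a \<in> W \<and> b \<in> W \<and> a \<noteq> b \<and> (f a = 0 \<or> f a \<noteq> f b)"
  by (auto simp: cgraph_def doubleton_eq_iff)

lemma cgraph_edges_subset: "edges (cgraph W f) \<subseteq> ksets W 2"
  by (auto simp: cgraph_def ksets_def)

lemma is_graph_cgraph: "finite W \<Longrightarrow> is_graph (cgraph W f)"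
  unfolding is_graph_iff using cgraph_edges_subset by simp

lemma nbhd_cgraph: "u \<in> W \<Longrightarrow> nbhd (cgraph W f) u = cnb W f (f u) - {u}"
  unfolding nbhd_def cgraph_edge cnb_def by auto

lemma pair_set_eqI:
  assumes "A \<subseteq> ksets W 2" "B \<subseteq> ksets W 2" "\<And>a b. a \<noteq> b \<Longrightarrow> {a, b} \<in> A \<longleftrightarrow> {a, b} \<in> B"
  shows "A = B"
proof (rule set_eqI)
  fix e
  show "e \<in> A \<longleftrightarrow> e \<in> B"
  proof (cases "e \<in> ksets W 2")
    case True
    then obtain a b where "e = {a, b}" "a \<noteq> b" by (auto simp: ksets_def card_2_iff)
    then show ?thesis using assms(3) by simp
  qed (use assms in auto)
qed

lemma cgraph_edges_within:
  assumes "\<And>y. y \<in> Y \<Longrightarrow> f y = g y" "Y \<subseteq> W" "Y \<subseteq> W'"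
  shows "{e \<in> edges (cgraph W f). e \<subseteq> Y} = {e \<in> edges (cgraph W' g). e \<subseteq> Y}"
proof (rule pair_set_eqI[of _ Y])
  show "{e \<in> edges (cgraph W f). e \<subseteq> Y} \<subseteq> ksets Y 2" using cgraph_edges_subset[of W f] by (auto simp: ksets_def)
  show "{e \<in> edges (cgraph W' g). e \<subseteq> Y} \<subseteq> ksets Y 2" using cgraph_edges_subset[of W' g] by (auto simp: ksets_def)
  show "{a, b} \<in> {e \<in> edges (cgraph W f). e \<subseteq> Y} \<longleftrightarrow> {a, b} \<in> {e \<in> edges (cgraph W' g). e \<subseteq> Y}" for a b
    using assms by (auto simp: cgraph_edge)
qed

lemma cgraph_recolour_diff:
  assumes "\<And>w. w \<in> W \<Longrightarrow> w \<notin> B \<Longrightarrow> f w = g w"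
  shows "sym_diff (edges (cgraph W f)) (edges (cgraph W g)) \<subseteq> {e \<in> ksets W 2. e \<inter> B \<noteq> {}}"
proof
  fix e assume e: "e \<in> sym_diff (edges (cgraph W f)) (edges (cgraph W g))"
  then have e2: "e \<in> ksets W 2" using cgraph_edges_subset[of W] by blast
  then obtain a b where ab: "e = {a, b}" "a \<in> W" "b \<in> W" by (rule ksets_2E)
  show "e \<in> {e \<in> ksets W 2. e \<inter> B \<noteq> {}}"
  proof (rule ccontr)
    assume "\<not> ?thesis"
    then have "f a = g a" "f b = g b" using ab e2 assms by auto
    then have "e \<in> edges (cgraph W f) \<longleftrightarrow> e \<in> edges (cgraph W g)" unfolding ab(1) cgraph_edge by simp
    then show False using e by blast
  qed
qed

lemma del_vertex_cgraph: "del_vertex (cgraph W f) z = cgraph (W - {z}) f"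
proof -
  have "{e \<in> edges (cgraph W f). e \<subseteq> W - {z}} = {e \<in> edges (cgraph (W - {z}) f). e \<subseteq> W - {z}}"
    by (rule cgraph_edges_within) auto
  also have "\<dots> = edges (cgraph (W - {z}) f)" using cgraph_edges_subset[of "W - {z}" f] by (auto simp: ksets_def)
  finally show ?thesis by (simp add: del_vertex_def induced_def)
qed

definition cparts :: "nat set \<Rightarrow> (nat \<Rightarrow> nat) \<Rightarrow> nat set set" where
  "cparts W f = (\<lambda>u. if f u = 0 then {u} else {w \<in> W. f w = f u}) ` W"

lemma partite_sets_cgraph: "partite_sets (cgraph W f) (cparts W f)"
proof -
  have "partition_on W (cparts W f)"
  proof (rule partition_onI)
    show "\<Union> (cparts W f) = W" by (auto simp: cparts_def split: if_splits)
    show "disjnt p p'" if "p \<in> cparts W f" "p' \<in> cparts W f" "p \<noteq> p'" for p p'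
      using that by (auto simp: cparts_def disjnt_def split: if_splits)
    show "{} \<notin> cparts W f" by (auto simp: cparts_def split: if_splits)
  qed
  moreover have "edges (cgraph W f) =
    {{x, y} | x y. \<exists>A\<in>cparts W f. \<exists>B\<in>cparts W f. A \<noteq> B \<and> x \<in> A \<and> y \<in> B}" (is "?L = ?R")
  proof
    let ?p = "\<lambda>u. if f u = 0 then {u} else {w \<in> W. f w = f u}"
    show "?L \<subseteq> ?R"
    proof
      fix e assume "e \<in> ?L"
      then obtain x y where e: "e = {x, y}" "x \<in> W" "y \<in> W" "x \<noteq> y" "f x = 0 \<or> f x \<noteq> f y"
        by (auto simp: cgraph_def)
      then have "?p x \<noteq> ?p y" by (auto split: if_splits)
      moreover have "?p x \<in> cparts W f" "?p y \<in> cparts W f" using e by (auto simp: cparts_def)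
      moreover have "x \<in> ?p x" "y \<in> ?p y" using e by auto
      ultimately show "e \<in> ?R" using e(1) by blast
    qed
    show "?R \<subseteq> ?L"
    proof
      fix e assume "e \<in> ?R"
      then obtain x y A B where e: "e = {x, y}" "A \<in> cparts W f" "B \<in> cparts W f" "A \<noteq> B" "x \<in> A" "y \<in> B" by blast
      then show "e \<in> ?L" by (auto simp: cparts_def cgraph_edge split: if_splits)
    qed
  qed
  ultimately show ?thesis by (simp add: partite_sets_def)
qed

lemma complete_partite_cgraph: "finite W \<Longrightarrow> complete_partite (cgraph W f)"
  unfolding complete_partite_def using is_graph_cgraph partite_sets_cgraph by blast

subsection \<open>Local stability\<close>

text \<open>The unit of loss: n^(k-2), the order of the number of k-sets through a pair, so that n
  times it is the order for a vertex. The quotient form matches the bound of (i) after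
  multiplication by n^k.\<close>

definition Qn :: "nat \<Rightarrow> nat \<Rightarrow> real" where
  "Qn k n = real n ^ k / real n ^ 2"

lemma Qn_pos: "n > 0 \<Longrightarrow> Qn k n > 0"
  by (simp add: Qn_def)

lemma finite_card_ksets: "e \<in> ksets W 2 \<Longrightarrow> finite e \<and> card e = 2"
  unfolding ksets_def using card.infinite by fastforce

context bounded_invariant
begin

abbreviation Q :: "nat \<Rightarrow> real" where "Q n \<equiv> Qn k n"

text \<open>The sizes k - 1 and k - 2 are those of a k-set without its one or two roots. Prescribing
  one more vertex costs a factor n.\<close>

lemma hit_bound:
  assumes "finite B" "n > 0" "U \<subseteq> {1..n}"
  shows "real (card {Y \<in> ksets U (k - 1). Y \<inter> B \<noteq> {}}) \<le> real (card B) * Q n"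
    and "real (card {Y \<in> ksets U (k - 2). Y \<inter> B \<noteq> {}}) \<le> real (card B) * Q n / real n"
proof -
  have le: "real (card {Y \<in> ksets U m. Y \<inter> B \<noteq> {}}) \<le> real (card {Y \<in> ksets {1..n} m. Y \<inter> B \<noteq> {}})" for m
    using ksets_mono[OF assms(3), of m] by (intro of_nat_mono card_mono) auto
  have h: "real (card {Y \<in> ksets {1..n} m. Y \<inter> B \<noteq> {}}) * real n \<le> real (card B) * real n ^ m" for m
    using card_ksets_hit[of "{1..n}" B m] assms by simp
  have "k = (k - 1) + 1" "k = (k - 2) + 2" using k3 by simp_all
  then have k1: "real n ^ k = real n ^ (k - 1) * real n" "real n ^ k = real n ^ (k - 2) * real n ^ 2"
    by (metis power_add power_one_right)+
  show "real (card {Y \<in> ksets U (k - 1). Y \<inter> B \<noteq> {}}) \<le> real (card B) * Q n"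
    using order_trans[OF mult_right_mono[OF le[of "k - 1"], of "real n"] h[of "k - 1"]] assms(2)
    unfolding Qn_def k1(1) by (simp add: field_simps power2_eq_square)
  show "real (card {Y \<in> ksets U (k - 2). Y \<inter> B \<noteq> {}}) \<le> real (card B) * Q n / real n"
    using order_trans[OF mult_right_mono[OF le[of "k - 2"], of "real n"] h[of "k - 2"]] assms(2)
    unfolding Qn_def k1(2) by (simp add: field_simps power2_eq_square)
qed

lemma contain_bound:
  assumes "finite D" "\<And>e. e \<in> D \<Longrightarrow> finite e \<and> card e = 2" "n > 0" "U \<subseteq> {1..n}"
  shows "real (card {Y \<in> ksets U (k - 1). \<exists>e\<in>D. e \<subseteq> Y}) \<le> real (card D) * Q n / real n"
proof -
  have "real (card {Y \<in> ksets U (k - 1). \<exists>e\<in>D. e \<subseteq> Y}) \<le> real (card {Y \<in> ksets {1..n} (k - 1). \<exists>e\<in>D. e \<subseteq> Y})"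
    using ksets_mono[OF assms(4)] by (intro of_nat_mono card_mono) auto
  moreover have "real (card {Y \<in> ksets {1..n} (k - 1). \<exists>e\<in>D. e \<subseteq> Y}) * real n ^ 2 \<le> real (card D) * real n ^ (k - 1)"
    using card_ksets_some_superset[of "{1..n}" D 2 "k - 1"] assms by simp
  ultimately have "real (card {Y \<in> ksets U (k - 1). \<exists>e\<in>D. e \<subseteq> Y}) * real n ^ 2 \<le> real (card D) * real n ^ (k - 1)"
    using mult_right_mono[of _ _ "real n ^ 2"] by (meson order_trans zero_le_power2)
  moreover have "real n ^ k = real n ^ (k - 1) * real n" using k3 power_add[of "real n" "k - 1" 1] by simp
  then have eq: "Q n / real n = real n ^ (k - 1) / real n ^ 2" using assms(3) by (simp add: Qn_def)
  ultimately have "real (card {Y \<in> ksets U (k - 1). \<exists>e\<in>D. e \<subseteq> Y}) \<le> real (card D) * real n ^ (k - 1) / real n ^ 2"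
    using assms(3) by (simp add: pos_le_divide_eq)
  also have "\<dots> = real (card D) * (real n ^ (k - 1) / real n ^ 2)" by simp
  also have "\<dots> = real (card D) * (Q n / real n)" using eq by (simp only:)
  finally show ?thesis by (simp only: times_divide_eq_right)
qed

text \<open>The error budget for comparing degrees: a bad vertex costs one unit, a bad pair only a
  fraction 1/n of it. Hence a small multiple of n^2 bad pairs weighs no more than a small multiple
  of n bad vertices.\<close>

lemma rsum_close:
  assumes "U \<subseteq> {1..n}" "n > 0" "E \<subseteq> ksets UNIV 2" "E' \<subseteq> ksets UNIV 2" "finite B" "finite D"
    "\<And>e. e \<in> D \<Longrightarrow> finite e \<and> card e = 2"
    "\<And>Y. Y \<subseteq> U \<Longrightarrow> Y \<inter> B = {} \<Longrightarrow> \<forall>e\<in>D. \<not> e \<subseteq> Y \<Longrightarrow> {e \<in> E. e \<subseteq> Y} = {e \<in> E'. e \<subseteq> Y} \<and> N \<inter> Y = N' \<inter> Y"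
  shows "\<bar>rsum E N U - rsum E' N' U\<bar> \<le> 2 * M * (real (card B) + real (card D) / real n) * Q n"
proof -
  have finU: "finite U" using assms(1) finite_subset by blast
  let ?A = "{Y \<in> ksets U (k - 1). {e \<in> E. e \<subseteq> Y} \<noteq> {e \<in> E'. e \<subseteq> Y} \<or> N \<inter> Y \<noteq> N' \<inter> Y}"
  let ?A1 = "{Y \<in> ksets U (k - 1). Y \<inter> B \<noteq> {}}" and ?A2 = "{Y \<in> ksets U (k - 1). \<exists>e\<in>D. e \<subseteq> Y}"
  have "?A \<subseteq> ?A1 \<union> ?A2"
  proof
    fix Y assume Y: "Y \<in> ?A"
    then have "Y \<subseteq> U" by (simp add: ksets_def)
    then show "Y \<in> ?A1 \<union> ?A2" using assms(8)[of Y] Y by blast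
  qed
  then have "card ?A \<le> card (?A1 \<union> ?A2)" using finU by (intro card_mono) auto
  also have "\<dots> \<le> card ?A1 + card ?A2" by (rule card_Un_le)
  finally have "real (card ?A) \<le> real (card ?A1) + real (card ?A2)" by linarith
  also have "\<dots> \<le> (real (card B) + real (card D) / real n) * Q n"
    using hit_bound(1)[OF assms(5,2,1)] contain_bound[OF assms(6,7,2,1)] by (simp add: algebra_simps)
  finally have "2 * M * real (card ?A) \<le> 2 * M * ((real (card B) + real (card D) / real n) * Q n)"
    using M_pos by (intro mult_left_mono) auto
  then show ?thesis using rsum_diff[OF assms(3,4) finU, of N N'] by (simp add: mult.assoc)
qed

lemma psum_close:
  assumes "U \<subseteq> {1..n}" "n > 0" "E \<subseteq> ksets UNIV 2" "E' \<subseteq> ksets UNIV 2" "finite B"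
    "\<And>Y. Y \<subseteq> U \<Longrightarrow> Y \<inter> B = {} \<Longrightarrow> {e \<in> E. e \<subseteq> Y} = {e \<in> E'. e \<subseteq> Y} \<and> N1 \<inter> Y = N1' \<inter> Y \<and> N2 \<inter> Y = N2' \<inter> Y"
  shows "\<bar>psum E N1 N2 U - psum E' N1' N2' U\<bar> \<le> 4 * M * real (card B) * Q n / real n"
proof -
  have finU: "finite U" using assms(1) finite_subset by blast
  let ?A = "{Y \<in> ksets U (k - 2). {e \<in> E. e \<subseteq> Y} \<noteq> {e \<in> E'. e \<subseteq> Y} \<or> N1 \<inter> Y \<noteq> N1' \<inter> Y \<or> N2 \<inter> Y \<noteq> N2' \<inter> Y}"
  let ?A1 = "{Y \<in> ksets U (k - 2). Y \<inter> B \<noteq> {}}"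
  have "?A \<subseteq> ?A1"
  proof
    fix Y assume Y: "Y \<in> ?A"
    then have "Y \<subseteq> U" by (simp add: ksets_def)
    then show "Y \<in> ?A1" using assms(6)[of Y] Y by blast
  qed
  then have "real (card ?A) \<le> real (card ?A1)" using finU by (intro of_nat_mono card_mono) auto
  also have "\<dots> \<le> real (card B) * Q n / real n" using hit_bound(2)[OF assms(5,2,1)] .
  finally have "4 * M * real (card ?A) \<le> 4 * M * (real (card B) * Q n / real n)"
    using M_pos by (intro mult_left_mono) auto
  then show ?thesis using psum_diff[OF assms(3,4) finU, of N1 N2 N1' N2'] by (simp add: mult.assoc)
qed

end

section \<open>Colourings with linear classes: averaging and perturbation\<close>

lemma cgraph_pairs: "edges (cgraph W f) \<subseteq> ksets UNIV 2"
  using cgraph_edges_subset[of W f] by (auto simp: ksets_def)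

lemma card_sym_diff_triangle:
  assumes "finite A" "finite B" "finite C"
  shows "card (sym_diff A C) \<le> card (sym_diff A B) + card (sym_diff B C)"
proof -
  have "card (sym_diff A C) \<le> card (sym_diff A B \<union> sym_diff B C)"
    using assms by (intro card_mono) auto
  then show ?thesis using card_Un_le[of "sym_diff A B" "sym_diff B C"] by linarith
qed

lemma sym_diff_commute: "sym_diff A B = sym_diff B A"
  by auto

text \<open>The properties of a realisation that local stability relies on. \<open>flip_loss\<close>
  and \<open>clone_loss\<close> are (i) and (ii) rescaled from densities to sums over k-sets. The
  closure condition on N makes it a union of parts; colour 0 is exempt because its vertices are
  singleton parts.\<close>

locale good_colouring = bounded_invariant +
  fixes \<kappa> \<beta> :: real and n :: nat and g :: "nat \<Rightarrow> nat"
  assumes \<kappa>_pos: "\<kappa> > 0" and \<beta>_pos: "\<beta> > 0" and nk: "n \<ge> k"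
    and large_class: "\<And>a. a \<in> {1..n} \<Longrightarrow> real (card {b \<in> {1..n}. g b = g a}) \<ge> \<beta> * real n"
    and flip_loss: "\<And>a b. a \<in> {1..n} \<Longrightarrow> b \<in> {1..n} \<Longrightarrow> a \<noteq> b \<Longrightarrow>
      Lam k \<gamma> (cgraph {1..n} g) - Lam k \<gamma> (flip (cgraph {1..n} g) a b) \<ge> \<kappa> * Qn k n"
    and clone_loss: "\<And>N. N \<subseteq> {1..n} \<Longrightarrow> (\<And>a b. a \<in> {1..n} \<Longrightarrow> b \<in> {1..n} \<Longrightarrow> g a \<noteq> 0 \<Longrightarrow> g a = g b \<Longrightarrow> a \<in> N \<Longrightarrow> b \<in> N) \<Longrightarrow>
      \<exists>u\<in>{1..n}. \<kappa> * real (card (sym_diff N (cnb {1..n} g (g u)))) * Qn k n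
        \<le> lam k \<gamma> (cgraph {1..n} g) * real (n choose (k - 1)) - rsum (edges (cgraph {1..n} g)) N {1..n}"
begin

abbreviation W :: "nat set" where "W \<equiv> {1..n}"
abbreviation R :: ugraph where "R \<equiv> cgraph W g"

text \<open>\<open>apex\<close> is the value \<open>\<Lambda>(G,v)\<close> of a vertex contributing exactly its share of \<open>\<lambda>(G)\<close>.\<close>

definition apex :: real where "apex = lam k \<gamma> R * real (n choose (k - 1))"

lemma n_pos: "n > 0" using nk k3 by simp

lemma Q_pos: "Q n > 0" using Qn_pos n_pos by simp

text \<open>The neighbourhood of a clone is itself a union of parts, and the deficit in (ii) is
  never negative.\<close>

lemma clone_le_apex:
  assumes "u \<in> W"
  shows "rsum (edges R) (cnb W g (g u)) W \<le> apex"
proof -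
  obtain v where "\<kappa> * real (card (sym_diff (cnb W g (g u)) (cnb W g (g v)))) * Q n \<le> apex - rsum (edges R) (cnb W g (g u)) W"
    using clone_loss[of "cnb W g (g u)"] unfolding apex_def cnb_def by (smt (verit) mem_Collect_eq subsetI)
  moreover have "0 \<le> \<kappa> * real (card (sym_diff (cnb W g (g u)) (cnb W g (g v)))) * Q n"
    using \<kappa>_pos Q_pos by simp
  ultimately show ?thesis by linarith
qed

text \<open>The vertex u and an added clone of u differ only through the sets that contain u next to
  the clone.\<close>

lemma Lam_at_clone:
  assumes "u \<in> W"
  shows "\<bar>Lam_at k \<gamma> R u - rsum (edges R) (cnb W g (g u)) W\<bar> \<le> M * Q n"
proof -
  have "Lam_at k \<gamma> R u = rsum (edges R) (cnb W g (g u) - {u}) (W - {u})"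
    using Lam_at_rsum[OF is_graph_cgraph, of W u g] nbhd_cgraph[OF assms, of g] assms by simp
  also have "\<dots> = rsum (edges R) (cnb W g (g u)) (W - {u})"
    by (intro rsum_cong) (auto simp: ksets_def)
  finally have "\<bar>Lam_at k \<gamma> R u - rsum (edges R) (cnb W g (g u)) W\<bar> \<le> M * real (card {Y \<in> ksets W (k - 1). Y \<inter> {u} \<noteq> {}})"
    using rsum_restrict[OF cgraph_pairs, of W "{u}" W g "cnb W g (g u)"] assms by (simp add: abs_minus_commute)
  also have "\<dots> \<le> M * Q n"
    using hit_bound(1)[of "{u}" n W] n_pos M_pos by simp
  finally show ?thesis .
qed

text \<open>An added vertex sees all n vertices, a vertex of R only the n - 1 others; this replaces
  n by n - k + 1. The mean degree in R thus differs from \<open>apex\<close> by (k - 1)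
  \<open>apex\<close> / n, which is of order \<open>Q n\<close>.\<close>

lemma apex_times: "(real n - real k + 1) * apex = real k * Lam k \<gamma> R"
proof -
  obtain j where j: "k = Suc j" using k3 by (cases k) auto
  have "k * (n choose k) = (n - j) * (n choose j)"
    unfolding j binomial_absorption binomial_absorb_comp ..
  then have "real (k * (n choose k)) = real ((n - j) * (n choose j))" by (simp only:)
  then have "real k * real (n choose k) = (real n - real k + 1) * real (n choose (k - 1))"
    using nk by (simp add: j of_nat_diff algebra_simps del: binomial_Suc_Suc)
  note eq = this
  have pos: "real (n choose k) > 0" using nk by simp
  have "(real n - real k + 1) * apex = Lam k \<gamma> R / real (n choose k) * ((real n - real k + 1) * real (n choose (k - 1)))"
    unfolding apex_def lam_def by simp
  also have "\<dots> = real k * Lam k \<gamma> R" unfolding eq[symmetric] using pos by simp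
  finally show ?thesis .
qed

lemma apex_bound: "\<bar>apex\<bar> \<le> M * (real n * Q n)"
proof -
  have "k = (k - 1) + 1" using k3 by simp
  then have "real n ^ k = real n ^ (k - 1) * real n" by (metis power_add power_one_right)
  then have nQ: "real n * Q n = real n ^ (k - 1)" using n_pos by (simp add: Qn_def power2_eq_square)
  have "\<bar>apex\<bar> = \<bar>lam k \<gamma> R\<bar> * real (n choose (k - 1))" by (simp add: apex_def abs_mult)
  also have "\<dots> \<le> M * real n ^ (k - 1)"
    using lam_bound[OF is_graph_cgraph[of W g]] choose_le_pow[of n "k - 1"] M_pos
    by (intro mult_mono) (simp_all flip: of_nat_power)
  finally show ?thesis using nQ by simp
qed

text \<open>By \<open>clone_le_apex\<close> the deficits of clones below \<open>apex\<close> are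
  nonnegative, and since the degrees of R sum to k \<Lambda>(R) these deficits add up to at most k M
  n \<open>Q n\<close>. The class of u contains at least \<beta> n vertices with the same deficit,
  so a single one is of order \<open>Q n\<close>.\<close>

lemma apex_le_clone:
  assumes u: "u \<in> W"
  shows "apex - real k * M / \<beta> * Q n \<le> rsum (edges R) (cnb W g (g u)) W"
proof -
  let ?q = "\<lambda>u. rsum (edges R) (cnb W g (g u)) W"
  let ?C = "{b \<in> W. g b = g u}"
  have "real (card ?C) * (apex - ?q u) = (\<Sum>b\<in>?C. apex - ?q b)" by simp
  also have "\<dots> \<le> (\<Sum>b\<in>W. apex - ?q b)" using clone_le_apex by (intro sum_mono2) auto
  also have "\<dots> = real n * apex - (\<Sum>b\<in>W. ?q b)" by (simp add: sum_subtractf)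
  also have "(\<Sum>b\<in>W. ?q b) \<ge> (\<Sum>b\<in>W. Lam_at k \<gamma> R b - M * Q n)"
  proof (rule sum_mono)
    fix b assume "b \<in> W"
    then show "Lam_at k \<gamma> R b - M * Q n \<le> ?q b" using Lam_at_clone[of b] by linarith
  qed
  then have "real n * apex - (\<Sum>b\<in>W. ?q b) \<le> real n * apex - (real k * Lam k \<gamma> R - real n * (M * Q n))"
    using sum_Lam_at[OF is_graph_cgraph[of W g]] by (simp add: sum_subtractf)
  also have "\<dots> = (real k - 1) * apex + real n * (M * Q n)"
    unfolding apex_times[symmetric] by (simp add: algebra_simps)
  also have "\<dots> \<le> (real k - 1) * (M * (real n * Q n)) + real n * (M * Q n)"
    using apex_bound k3 by (intro add_right_mono mult_left_mono) auto
  also have "\<dots> = real k * M * Q n * real n" by (simp add: algebra_simps)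
  finally have "real (card ?C) * (apex - ?q u) \<le> real k * M * Q n * real n" .
  moreover have "(\<beta> * real n) * (apex - ?q u) \<le> real (card ?C) * (apex - ?q u)"
    using large_class[OF u] clone_le_apex[OF u] by (intro mult_right_mono) auto
  ultimately have "(\<beta> * (apex - ?q u)) * real n \<le> (real k * M * Q n) * real n" by (simp add: algebra_simps)
  then have "\<beta> * (apex - ?q u) \<le> real k * M * Q n" using n_pos by simp
  then show ?thesis using \<beta>_pos by (simp add: field_simps)
qed

text \<open>Since classes are large, the two ends of any pair can be moved to vertices of the same colours
  in the unperturbed colouring.\<close>

lemma perturbed_flip_loss:
  assumes B: "finite B" "\<And>w. w \<in> W \<Longrightarrow> w \<notin> B \<Longrightarrow> f w = g w" and f: "f ` W \<subseteq> g ` W"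
    and ab: "a \<in> W" "b \<in> W" "a \<noteq> b" and \<beta>2: "\<beta> * real n \<ge> 2"
  shows "Lam k \<gamma> (cgraph W f) - Lam k \<gamma> (flip (cgraph W f) a b) \<ge>
    \<kappa> * Q n - 4 * M * (real (card B) + 2) * Q n / real n"
proof -
  let ?H = "cgraph W f"
  obtain a' where a': "a' \<in> W" "g a' = f a" using f ab(1) by (metis imageE image_eqI subsetD)
  obtain b0 where b0: "b0 \<in> W" "g b0 = f b" using f ab(2) by (metis imageE image_eqI subsetD)
  \<comment> \<open>If a and b have the same colour, the substitute for b must be a second vertex of
    that class.\<close>
  have "card {c \<in> W. g c = g b0} \<ge> 2" using large_class[OF b0(1)] \<beta>2 by linarith
  then have "\<not> {c \<in> W. g c = g b0} \<subseteq> {a'}" using card_mono[of "{a'}" "{c \<in> W. g c = g b0}"] by auto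
  then obtain b' where b': "b' \<in> W" "g b' = f b" "a' \<noteq> b'" using b0(2) by auto
  let ?s = "\<lambda>G a b. if {a, b} \<in> edges G then - 1 else 1 :: real"
  have s: "?s ?H a b = ?s R a' b'" using ab a' b' by (simp add: cgraph_edge)
  have loss: "Lam k \<gamma> (cgraph W h) - Lam k \<gamma> (flip (cgraph W h) u v) =
     ?s (cgraph W h) u v * psum (edges (cgraph W h)) (cnb W h (h u)) (cnb W h (h v)) (W - {u, v})"
    if "u \<in> W" "v \<in> W" "u \<noteq> v" for h u v
  proof -
    have "psum (edges (cgraph W h)) (nbhd (cgraph W h) u) (nbhd (cgraph W h) v) (W - {u, v}) =
       psum (edges (cgraph W h)) (cnb W h (h u)) (cnb W h (h v)) (W - {u, v})"
      unfolding psum_def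
    proof (rule sum.cong[OF refl])
      fix Y assume "Y \<in> ksets (W - {u, v}) (k - 2)"
      then have "nbhd (cgraph W h) u \<inter> Y = cnb W h (h u) \<inter> Y" "nbhd (cgraph W h) v \<inter> Y = cnb W h (h v) \<inter> Y"
        unfolding nbhd_cgraph[OF that(1)] nbhd_cgraph[OF that(2)] by (auto simp: ksets_def)
      from rooted2_cong[OF refl this]
      show "\<gamma> (rooted2 (edges (cgraph W h)) (nbhd (cgraph W h) u) (nbhd (cgraph W h) v) False Y (fresh Y) (Suc (fresh Y))) -
        \<gamma> (rooted2 (edges (cgraph W h)) (nbhd (cgraph W h) u) (nbhd (cgraph W h) v) True Y (fresh Y) (Suc (fresh Y))) =
        \<gamma> (rooted2 (edges (cgraph W h)) (cnb W h (h u)) (cnb W h (h v)) False Y (fresh Y) (Suc (fresh Y))) -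
        \<gamma> (rooted2 (edges (cgraph W h)) (cnb W h (h u)) (cnb W h (h v)) True Y (fresh Y) (Suc (fresh Y)))"
        by (simp only:)
    qed
    then show ?thesis using Lam_flip[OF is_graph_cgraph[of W h], of u v] that by simp
  qed
  let ?pH = "psum (edges ?H) (cnb W f (f a)) (cnb W f (f b))"
  let ?pR = "psum (edges R) (cnb W g (g a')) (cnb W g (g b'))"
  have res: "\<bar>psum (edges (cgraph W h)) N1 N2 W - psum (edges (cgraph W h)) N1 N2 (W - {u, v})\<bar> \<le> 4 * M * (Q n / real n)"
    if "u \<in> W" "v \<in> W" "u \<noteq> v" for u v h N1 N2
  proof -
    have "\<bar>psum (edges (cgraph W h)) N1 N2 W - psum (edges (cgraph W h)) N1 N2 (W - {u, v})\<bar>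
      \<le> 2 * M * real (card {Y \<in> ksets W (k - 2). Y \<inter> {u, v} \<noteq> {}})"
      using that by (intro psum_restrict[OF cgraph_pairs]) auto
    also have "\<dots> \<le> 2 * M * (2 * Q n / real n)"
      using hit_bound(2)[of "{u, v}" n W] that n_pos M_pos by (intro mult_left_mono) auto
    finally show ?thesis by simp
  qed
  have "\<bar>?pH W - ?pR W\<bar> \<le> 4 * M * real (card B) * Q n / real n"
  proof (rule psum_close[OF subset_refl n_pos cgraph_pairs cgraph_pairs B(1)])
    fix Y assume Y: "Y \<subseteq> W" "Y \<inter> B = {}"
    then have fg: "f y = g y" if "y \<in> Y" for y using that B(2) by blast
    have "{e \<in> edges ?H. e \<subseteq> Y} = {e \<in> edges R. e \<subseteq> Y}" by (rule cgraph_edges_within[OF fg Y(1) Y(1)])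
    moreover have "cnb W f j \<inter> Y = cnb W g j \<inter> Y" for j using fg by (auto simp: cnb_def)
    ultimately show "{e \<in> edges ?H. e \<subseteq> Y} = {e \<in> edges R. e \<subseteq> Y} \<and> cnb W f (f a) \<inter> Y = cnb W g (g a') \<inter> Y
      \<and> cnb W f (f b) \<inter> Y = cnb W g (g b') \<inter> Y" using a' b' by simp
  qed
  with res[OF ab, of f "cnb W f (f a)" "cnb W f (f b)"] res[OF a'(1) b'(1,3), of g "cnb W g (g a')" "cnb W g (g b')"]
  have "\<bar>?pH (W - {a, b}) - ?pR (W - {a', b'})\<bar> \<le> 4 * M * real (card B) * Q n / real n + 8 * M * (Q n / real n)"
    by linarith
  \<comment> \<open>Deleting the two ends from W costs 4M \<open>Q n\<close> / n in each of the two
    graphs; together this is the summand 2.\<close>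
  also have "\<dots> = 4 * M * (real (card B) + 2) * Q n / real n"
    by (simp add: field_simps add_divide_distrib)
  finally have "\<bar>?pH (W - {a, b}) - ?pR (W - {a', b'})\<bar> \<le> 4 * M * (real (card B) + 2) * Q n / real n" .
  moreover have "?s R a' b' * ?pR (W - {a', b'}) \<ge> \<kappa> * Q n"
    using flip_loss[OF a'(1) b'(1,3)] loss[OF a'(1) b'(1,3), of g] by simp
  ultimately show ?thesis unfolding loss[OF ab] s by (auto split: if_splits)
qed

end

section \<open>Changing the neighbourhood of a single vertex\<close>

lemma discrete_crossing:
  fixes m :: nat
  assumes "P 0" "\<not> P m"
  obtains i where "i < m" "P i" "\<not> P (Suc i)"
proof -
  have "\<exists>i<m. P i \<and> \<not> P (Suc i)"
  proof (rule ccontr)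
    assume "\<not> ?thesis"
    then have "i \<le> m \<Longrightarrow> P i" for i using assms(1) by (induction i) auto
    then show False using assms(2) by blast
  qed
  then show ?thesis using that by blast
qed

lemma del_vertex_add_vertex:
  assumes "is_graph G" "v \<notin> verts G"
  shows "del_vertex (add_vertex G v N) v = G"
proof -
  have "{e \<in> edges (add_vertex G v N). e \<subseteq> verts G} = edges G"
    using assms by (auto simp: is_graph_def)
  moreover have "insert v (verts G) - {v} = verts G" using assms by auto
  ultimately show ?thesis unfolding del_vertex_def induced_def add_vertex_sel by simp
qed

lemma sym_diff_edges_at:
  assumes "is_graph G" "is_graph G'" "del_vertex G z = del_vertex G' z" "verts G = verts G'"
  shows "sym_diff (edges G) (edges G') = (\<lambda>u. {z, u}) ` sym_diff (nbhd G z) (nbhd G' z)"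
proof (rule pair_set_eqI[of _ "verts G"])
  show "sym_diff (edges G) (edges G') \<subseteq> ksets (verts G) 2" using assms(1,2,4) unfolding is_graph_iff by auto
  show "(\<lambda>u. {z, u}) ` sym_diff (nbhd G z) (nbhd G' z) \<subseteq> ksets (verts G) 2"
    using assms(1,2,4) unfolding is_graph_iff nbhd_def by auto
  fix a b :: nat assume "a \<noteq> b"
  have eq: "{e \<in> edges G. e \<subseteq> verts G - {z}} = {e \<in> edges G'. e \<subseteq> verts G - {z}}"
    using arg_cong[OF assms(3), of edges] assms(4) by simp
  show "{a, b} \<in> sym_diff (edges G) (edges G') \<longleftrightarrow> {a, b} \<in> (\<lambda>u. {z, u}) ` sym_diff (nbhd G z) (nbhd G' z)"
  proof (cases "a = z \<or> b = z")
    case True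
    then show ?thesis using \<open>a \<noteq> b\<close> by (auto simp: nbhd_def doubleton_eq_iff insert_commute image_iff)
  next
    case False
    have "{a, b} \<in> edges G \<longleftrightarrow> {a, b} \<in> edges G'"
    proof (cases "a \<in> verts G \<and> b \<in> verts G")
      case True
      then have "{a, b} \<subseteq> verts G - {z}" using False by auto
      then show ?thesis using eq by blast
    next
      case F: False
      then show ?thesis using edge_iff[OF assms(1)] edge_iff[OF assms(2)] assms(4) by metis
    qed
    then show ?thesis using False by (auto simp: doubleton_eq_iff)
  qed
qed

lemma card_sym_diff_edges_at:
  assumes "is_graph G" "is_graph G'" "del_vertex G z = del_vertex G' z" "verts G = verts G'"
  shows "card (sym_diff (edges G) (edges G')) = card (sym_diff (nbhd G z) (nbhd G' z))"
  unfolding sym_diff_edges_at[OF assms] by (rule card_image) (auto simp: inj_on_def doubleton_eq_iff)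

lemma del_vertex_recolour: "del_vertex (cgraph W (f(z := j))) z = cgraph (W - {z}) f"
proof -
  have "{e \<in> edges (cgraph (W - {z}) (f(z := j))). e \<subseteq> W - {z}} = {e \<in> edges (cgraph (W - {z}) f). e \<subseteq> W - {z}}"
    by (rule cgraph_edges_within) auto
  moreover have "{e \<in> edges (cgraph (W - {z}) h). e \<subseteq> W - {z}} = edges (cgraph (W - {z}) h)" for h
    using cgraph_edges_subset[of "W - {z}" h] by (auto simp: ksets_def)
  ultimately show ?thesis unfolding del_vertex_cgraph by (simp add: cgraph_def)
qed

context bounded_invariant
begin

text \<open>Only the second summand depends on how z is joined. Along a sequence that fixes the
  graph without z, growth of \<lambda> is therefore growth of \<open>rsum\<close>.\<close>

lemma Lam_rsum:
  assumes "is_graph G" "z \<in> verts G" "del_vertex G z = K"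
  shows "Lam k \<gamma> G = Lam k \<gamma> K + rsum (edges K) (nbhd G z) (verts G - {z})"
proof -
  have "rsum (edges G) (nbhd G z) (verts G - {z}) = rsum (edges K) (nbhd G z) (verts G - {z})"
    unfolding assms(3)[symmetric] by (intro rsum_cong) (auto simp: ksets_def)
  then show ?thesis using Lam_del[OF assms(1,2)] Lam_at_rsum[OF assms(1,2)] assms(3) by simp
qed

end

context good_colouring
begin

text \<open>Carries (ii), which concerns a vertex added to R, over to a vertex z inside a perturbed
  colouring. Each vertex of B costs 2M, and readmitting the position of z to W costs M.\<close>

lemma transfer:
  assumes B: "finite B" "\<And>w. w \<in> W \<Longrightarrow> w \<notin> B \<Longrightarrow> f w = g w" and z: "z \<in> W"
    and N: "\<And>w. w \<in> W \<Longrightarrow> w \<notin> B \<Longrightarrow> w \<noteq> z \<Longrightarrow> w \<in> N \<longleftrightarrow> w \<in> N'"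
  shows "\<bar>rsum (edges (cgraph (W - {z}) f)) N (W - {z}) - rsum (edges R) N' W\<bar> \<le> 3 * M * (real (card B) + 1) * Q n"
proof -
  have "\<bar>rsum (edges (cgraph (W - {z}) f)) N (W - {z}) - rsum (edges R) N' (W - {z})\<bar> \<le>
      2 * M * (real (card B) + real (card ({} :: nat set set)) / real n) * Q n"
  proof (rule rsum_close[OF _ n_pos cgraph_pairs cgraph_pairs B(1)])
    fix Y assume Y: "Y \<subseteq> W - {z}" "Y \<inter> B = {}"
    have "{e \<in> edges (cgraph (W - {z}) f). e \<subseteq> Y} = {e \<in> edges R. e \<subseteq> Y}"
      using Y B(2) by (intro cgraph_edges_within) blast+
    moreover have "N \<inter> Y = N' \<inter> Y" using Y N by blast
    ultimately show "{e \<in> edges (cgraph (W - {z}) f). e \<subseteq> Y} = {e \<in> edges R. e \<subseteq> Y} \<and> N \<inter> Y = N' \<inter> Y" ..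
  qed auto
  moreover have "\<bar>rsum (edges R) N' W - rsum (edges R) N' (W - {z})\<bar> \<le> M * (real (card {z}) * Q n)"
  proof (rule order_trans)
    show "\<bar>rsum (edges R) N' W - rsum (edges R) N' (W - {z})\<bar> \<le> M * real (card {Y \<in> ksets W (k - 1). Y \<inter> {z} \<noteq> {}})"
      using z by (intro rsum_restrict[OF cgraph_pairs]) auto
    show "M * real (card {Y \<in> ksets W (k - 1). Y \<inter> {z} \<noteq> {}}) \<le> M * (real (card {z}) * Q n)"
      using hit_bound(1)[of "{z}" n W] M_pos n_pos by (intro mult_left_mono) auto
  qed
  moreover have "0 \<le> M * (real (card B) + 2) * Q n" using M_pos Q_pos by simp
  ultimately show ?thesis by (simp add: algebra_simps)
qed

text \<open>The tolerance \<xi>/2 in (Sym2) keeps the distance from a clone from jumping over the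
  interval between \<xi> n / 2 and \<xi> n. A member in that interval is far enough from the clone
  to lose linearly many flips, yet so close that these flips barely interact. The value at z only
  grows along the sequence, so an upper bound at any member is an upper bound at the start.\<close>

lemma bad_vertex:
  assumes B: "finite B" "\<And>w. w \<in> W \<Longrightarrow> w \<notin> B \<Longrightarrow> f w = g w" and f: "f ` W \<subseteq> g ` W"
    and z: "z \<in> W" and N0: "N0 \<subseteq> W - {z}" and \<xi>: "\<xi> > 0"
    and far: "\<And>j. j \<in> g ` W \<Longrightarrow> real (card (sym_diff N0 (cnb (W - {z}) f j))) \<ge> \<xi> * real n"
    and \<zeta>: "real (card B) + 5 \<le> \<zeta> * real n" "\<zeta> \<le> \<xi> / 4" "48 * M * \<zeta> \<le> \<kappa> * \<xi>" "16 * M * \<zeta> \<le> \<kappa>" "16 * M * \<xi> \<le> \<kappa>"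
    and \<beta>2: "\<beta> * real n \<ge> 2"
    and sym: "Sym2 k \<gamma> (\<xi> / 2) (add_vertex (cgraph (W - {z}) f) z N0)"
  shows "rsum (edges (cgraph (W - {z}) f)) N0 (W - {z}) \<le> apex - \<kappa> * \<xi> / 8 * (real n * Q n)"
proof -
  let ?U = "W - {z}"
  let ?K = "cgraph ?U f"
  let ?J = "add_vertex ?K z N0"
  let ?r = "\<lambda>N. rsum (edges ?K) N ?U"
  have K: "is_graph ?K" by (rule is_graph_cgraph) simp
  have J: "is_graph ?J" using is_graph_add_vertex[OF K] N0 by simp
  have vJ: "verts ?J = W" using z by auto
  have dJ: "del_vertex ?J z = ?K" using del_vertex_add_vertex[OF K] by simp
  have "partite_sets (del_vertex ?J z) (cparts ?U f)" using dJ partite_sets_cgraph by simp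
  moreover have "z \<in> verts ?J" by simp
  ultimately have "\<exists>m (S :: nat \<Rightarrow> ugraph). S 0 = ?J \<and>
      (\<forall>i\<le>m. is_graph (S i) \<and> verts (S i) = verts ?J) \<and>
      (\<forall>i\<in>{1..m}. del_vertex (S i) z = del_vertex ?J z \<and> lam k \<gamma> (S (i - 1)) \<le> lam k \<gamma> (S i) \<and>
         real (card (sym_diff (edges (S (i - 1))) (edges (S i)))) \<le> \<xi> / 2 * (real (order ?J) - 1)) \<and>
      (\<forall>A\<in>cparts ?U f. A \<subseteq> nbhd (S m) z \<or> nbhd (S m) z \<inter> A = {})"
    using sym[unfolded Sym2_def] by (simp only:)
  then obtain m and S :: "nat \<Rightarrow> ugraph" where S0: "S 0 = ?J"
    and S1: "\<forall>i\<le>m. is_graph (S i) \<and> verts (S i) = verts ?J"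
    and S2: "\<forall>i\<in>{1..m}. del_vertex (S i) z = del_vertex ?J z \<and> lam k \<gamma> (S (i - 1)) \<le> lam k \<gamma> (S i) \<and>
       real (card (sym_diff (edges (S (i - 1))) (edges (S i)))) \<le> \<xi> / 2 * (real (order ?J) - 1)"
    and S3: "\<forall>A\<in>cparts ?U f. A \<subseteq> nbhd (S m) z \<or> nbhd (S m) z \<inter> A = {}"
    by blast
  let ?N = "\<lambda>i. nbhd (S i) z"
  have gS: "is_graph (S i)" "verts (S i) = W" "del_vertex (S i) z = ?K" if "i \<le> m" for i
  proof -
    show "is_graph (S i)" "verts (S i) = W" using S1 that vJ by auto
    show "del_vertex (S i) z = ?K" using S2 S0 dJ that by (cases "i = 0") auto
  qed
  have NU: "?N i \<subseteq> ?U" if "i \<le> m" for i using nbhd_subset[OF gS(1)[OF that]] gS(2)[OF that] by simp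
  have LamS: "Lam k \<gamma> (S i) = Lam k \<gamma> ?K + ?r (?N i)" if "i \<le> m" for i
    using Lam_rsum[OF gS(1)[OF that] _ gS(3)[OF that]] gS(2)[OF that] z by simp
  have step: "?r (?N i) \<le> ?r (?N (Suc i))" "real (card (sym_diff (?N i) (?N (Suc i)))) \<le> \<xi> / 2 * real n"
    if "Suc i \<le> m" for i
  proof -
    have i: "i \<le> m" using that by simp
    have S2i: "lam k \<gamma> (S i) \<le> lam k \<gamma> (S (Suc i))"
      "real (card (sym_diff (edges (S i)) (edges (S (Suc i))))) \<le> \<xi> / 2 * (real (order ?J) - 1)"
      using bspec[OF S2, of "Suc i"] that by auto
    have "order (S i) = n" "order (S (Suc i)) = n" using gS(2)[OF i] gS(2)[OF that] by (simp_all add: order_def)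
    then have "Lam k \<gamma> (S i) \<le> Lam k \<gamma> (S (Suc i))"
      using S2i(1) nk by (simp add: lam_def divide_le_cancel)
    then show "?r (?N i) \<le> ?r (?N (Suc i))" using LamS[OF i] LamS[OF that] by simp
    have "\<xi> / 2 * (real (order ?J) - 1) \<le> \<xi> / 2 * real n"
      using \<xi> vJ by (intro mult_left_mono) (auto simp: order_def)
    then show "real (card (sym_diff (?N i) (?N (Suc i)))) \<le> \<xi> / 2 * real n"
      using S2i(2) card_sym_diff_edges_at[OF gS(1)[OF i] gS(1)[OF that], of z] gS(2,3)[OF i] gS(2,3)[OF that] by simp
  qed
  have mono: "?r (?N 0) \<le> ?r (?N i)" if "i \<le> m" for i
    using that
  proof (induction i)
    case (Suc i)
    then show ?case using step(1)[OF Suc.prems] by simp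
  qed simp
  have nb0: "?N 0 = N0"
    using S0 N0 edge_iff[OF K, of z] by (auto simp: nbhd_def doubleton_eq_iff)
  have nQ: "real n * Q n > 0" using n_pos Q_pos by simp
  \<comment> \<open>As 48 = 3 * 16, one use of \<open>transfer\<close> costs at most a sixteenth of
    \<kappa> \<xi> n \<open>Q n\<close>, which both cases can afford.\<close>
  have BQ: "3 * M * (real (card B) + 1) * Q n \<le> \<kappa> * \<xi> / 16 * (real n * Q n)"
  proof -
    have "3 * M * (real (card B) + 1) \<le> 3 * M * (\<zeta> * real n)" using \<zeta>(1) M_pos by (intro mult_left_mono) auto
    also have "\<dots> = (48 * M * \<zeta>) * (real n / 16)" by simp
    also have "\<dots> \<le> (\<kappa> * \<xi>) * (real n / 16)" using \<zeta>(3) by (intro mult_right_mono) auto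
    finally have "3 * M * (real (card B) + 1) * Q n \<le> (\<kappa> * \<xi>) * (real n / 16) * Q n"
      using Q_pos by (intro mult_right_mono) auto
    then show ?thesis by (simp add: mult_ac)
  qed
  define Far where "Far i \<longleftrightarrow> (\<forall>j\<in>g ` W. real (card (sym_diff (?N i) (cnb ?U f j))) \<ge> \<xi> * real n)" for i
  have far0: "Far 0" using far nb0 by (simp add: Far_def)
  show ?thesis
  proof (cases "Far m")
    case True
    let ?T = "?N m"
    \<comment> \<open>(Sym2) gives a union of classes of f, while \<open>clone_loss\<close> asks for
      a union of classes of g. This set is the g-version; it agrees with ?T away from B and
      z.\<close>
    define N' where "N' = {w \<in> W. (g w = 0 \<and> w \<in> ?T) \<or> (g w \<noteq> 0 \<and> (\<exists>y\<in>?U. f y = g w \<and> y \<in> ?T))}"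
    have TN': "w \<in> ?T \<longleftrightarrow> w \<in> N'" if w: "w \<in> W" "w \<notin> B" "w \<noteq> z" for w
    proof (cases "g w = 0")
      case True then show ?thesis using w by (simp add: N'_def)
    next
      case False
      have fw: "f w = g w" using B(2) w by simp
      let ?A = "{v \<in> ?U. f v = g w}"
      have "?A \<in> cparts ?U f" using w fw False unfolding cparts_def by (intro image_eqI[of _ _ w]) auto
      then have AT: "?A \<subseteq> ?T \<or> ?T \<inter> ?A = {}" by (rule S3[rule_format])
      have wA: "w \<in> ?A" using w fw by simp
      have "w \<in> ?T \<longleftrightarrow> (\<exists>y\<in>?U. f y = g w \<and> y \<in> ?T)"
      proof
        assume "w \<in> ?T"
        then show "\<exists>y\<in>?U. f y = g w \<and> y \<in> ?T" using w fw by (intro bexI[of _ w]) auto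
      next
        assume "\<exists>y\<in>?U. f y = g w \<and> y \<in> ?T"
        then obtain y where "y \<in> ?U" "f y = g w" and yT: "y \<in> ?T" by (elim bexE conjE)
        then have "y \<in> ?A" by simp
        then show "w \<in> ?T" using AT wA yT by (meson disjoint_iff subsetD)
      qed
      then show ?thesis using w False by (simp add: N'_def)
    qed
    obtain u where u: "u \<in> W" "\<kappa> * real (card (sym_diff N' (cnb W g (g u)))) * Q n \<le> apex - rsum (edges R) N' W"
    proof -
      have "\<exists>u\<in>W. \<kappa> * real (card (sym_diff N' (cnb W g (g u)))) * Q n \<le> apex - rsum (edges R) N' W"
        unfolding apex_def
      proof (rule clone_loss)
        show "N' \<subseteq> W" by (auto simp: N'_def)
        show "b \<in> N'" if "a \<in> W" "b \<in> W" "g a \<noteq> 0" "g a = g b" "a \<in> N'" for a b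
          using that unfolding N'_def by simp
      qed
      then show ?thesis using that by blast
    qed
    let ?C = "cnb ?U f (g u)" and ?C' = "cnb W g (g u)"
    have "sym_diff ?T ?C \<subseteq> sym_diff N' ?C' \<union> insert z B"
    proof
      fix w assume w: "w \<in> sym_diff ?T ?C"
      then have "w \<in> W" using NU[of m] by (auto simp: cnb_def)
      show "w \<in> sym_diff N' ?C' \<union> insert z B"
      proof (cases "w = z \<or> w \<in> B")
        case False
        then have "w \<in> ?C \<longleftrightarrow> w \<in> ?C'" using B(2) \<open>w \<in> W\<close> by (simp add: cnb_def)
        then show ?thesis using TN'[of w] \<open>w \<in> W\<close> False w by blast
      qed auto
    qed
    moreover have finN': "finite (sym_diff N' ?C')"
      by (rule finite_subset[of _ W]) (auto simp: N'_def cnb_def)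
    ultimately have "card (sym_diff ?T ?C) \<le> card (sym_diff N' ?C' \<union> insert z B)"
      using B(1) by (intro card_mono) auto
    also have "\<dots> \<le> card (sym_diff N' ?C') + (card B + 1)"
      using card_Un_le[of "sym_diff N' ?C'" "insert z B"] card_insert_le_m1[of "card B + 1" B z] B(1)
      by (simp add: card_insert_if split: if_splits)
    finally have "real (card (sym_diff ?T ?C)) \<le> real (card (sym_diff N' ?C')) + real (card B) + 1" by linarith
    moreover have "\<xi> * real n \<le> real (card (sym_diff ?T ?C))" using True u(1) by (auto simp: Far_def)
    moreover have "\<zeta> * real n \<le> \<xi> / 4 * real n" using \<zeta>(2) by (intro mult_right_mono) auto
    ultimately have "\<xi> / 2 * real n \<le> real (card (sym_diff N' ?C'))" using \<zeta>(1) by linarith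
    then have "\<kappa> * (\<xi> / 2 * real n) * Q n \<le> \<kappa> * real (card (sym_diff N' ?C')) * Q n"
      using \<kappa>_pos Q_pos by (intro mult_right_mono mult_left_mono) auto
    then have "rsum (edges R) N' W \<le> apex - \<kappa> * \<xi> / 2 * (real n * Q n)" using u(2) by (simp add: mult_ac)
    moreover have "?r ?T \<le> rsum (edges R) N' W + \<kappa> * \<xi> / 16 * (real n * Q n)"
    proof -
      have "\<bar>?r ?T - rsum (edges R) N' W\<bar> \<le> 3 * M * (real (card B) + 1) * Q n"
        by (rule transfer[OF B(1) _ z]) (erule (1) B(2), erule (2) TN')
      then show ?thesis using BQ by linarith
    qed
    ultimately have "?r ?T \<le> apex - 7 * (\<kappa> * \<xi> / 16 * (real n * Q n))" by simp
    moreover have "\<kappa> * \<xi> / 16 * (real n * Q n) > 0" using \<kappa>_pos \<xi> nQ by simp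
    moreover have "\<kappa> * \<xi> / 8 * (real n * Q n) = 2 * (\<kappa> * \<xi> / 16 * (real n * Q n))" by simp
    ultimately show ?thesis using mono[of m] nb0 by simp
  next
    case False
    obtain i where i: "i < m" "Far i" "\<not> Far (Suc i)" using discrete_crossing[of Far m] far0 False by blast
    let ?T = "?N (Suc i)"
    obtain u where u: "u \<in> W" "real (card (sym_diff ?T (cnb ?U f (g u)))) < \<xi> * real n"
      using i(3) by (auto simp: Far_def not_le)
    let ?j = "g u"
    let ?C = "cnb ?U f ?j"
    define f' where "f' = f(z := ?j)"
    define H where "H = cgraph W f'"
    define D where "D = (\<lambda>w. {z, w}) ` sym_diff ?T ?C"
    have Si: "Suc i \<le> m" using i by simp
    have H: "is_graph H" "verts H = W" "del_vertex H z = ?K"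
      unfolding H_def f'_def by (simp_all only: is_graph_cgraph finite_atLeastAtMost verts_cgraph del_vertex_recolour)
    have nH: "nbhd H z = ?C" using nbhd_cgraph[OF z, of f'] unfolding H_def by (auto simp: cnb_def f'_def)
    have D: "D = sym_diff (edges H) (edges (S (Suc i)))"
    proof -
      have "sym_diff (edges H) (edges (S (Suc i))) = (\<lambda>u. {z, u}) ` sym_diff (nbhd H z) ?T"
        by (rule sym_diff_edges_at) (simp_all only: H gS[OF Si])
      then show ?thesis unfolding D_def by (simp only: nH sym_diff_commute[of ?T ?C])
    qed
    then have tog: "toggle H D = S (Suc i)" using toggle_sym_diff gS(2)[OF Si] H(2) by simp
    have D2: "D \<subseteq> ksets (verts H) 2" unfolding D using H gS(1,2)[OF Si] by (auto simp: is_graph_iff)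
    have finT: "finite (sym_diff ?T ?C)"
      by (rule finite_subset[of _ W]) (use NU[OF Si] in \<open>auto simp: cnb_def\<close>)
    have cardD: "card D = card (sym_diff ?T ?C)"
      unfolding D_def by (rule card_image) (auto simp: inj_on_def doubleton_eq_iff)
    have f'W: "f' ` W \<subseteq> g ` W" using f u(1) by (auto simp: f'_def)
    have loss: "Lam k \<gamma> H - Lam k \<gamma> (toggle H {e}) \<ge> \<kappa> * Q n - 4 * M * \<zeta> * Q n" if "e \<in> D" for e
    proof -
      have "e \<in> ksets W 2" using subsetD[OF D2 that] by (simp only: H(2))
      then obtain a b where e: "e = {a, b}" "a \<in> W" "b \<in> W" "a \<noteq> b" by (rule ksets_2E)
      have "Lam k \<gamma> H - Lam k \<gamma> (toggle H {e}) \<ge> \<kappa> * Q n - 4 * M * (real (card (insert z B)) + 2) * Q n / real n"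
        unfolding H_def e(1) toggle_single
        by (rule perturbed_flip_loss[OF _ _ f'W e(2-4) \<beta>2]) (use B in \<open>auto simp: f'_def\<close>)
      moreover have "4 * M * (real (card (insert z B)) + 2) * Q n / real n \<le> 4 * M * \<zeta> * Q n"
      proof -
        have "real (card (insert z B)) + 2 \<le> \<zeta> * real n" using \<zeta>(1) B(1) by (simp add: card_insert_if)
        then have "(4 * M * Q n) * (real (card (insert z B)) + 2) \<le> (4 * M * Q n) * (\<zeta> * real n)"
          using M_pos Q_pos by (intro mult_left_mono) auto
        then show ?thesis using n_pos by (simp add: pos_divide_le_eq mult_ac)
      qed
      ultimately show ?thesis by linarith
    qed
    have few: "real (card {X \<in> ksets (verts H) k. e \<subseteq> X \<and> (\<exists>e'\<in>D. e' \<noteq> e \<and> e' \<subseteq> X)}) \<le> \<xi> * Q n" if e: "e \<in> D" for e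
    proof -
      obtain w where w: "e = {z, w}" "w \<in> sym_diff ?T ?C" using e by (auto simp: D_def)
      then have wz: "w \<noteq> z" using NU[OF Si] by (auto simp: cnb_def)
      \<comment> \<open>All pairs of D contain z, so a second pair inside X produces a triple
        through z and w, and there are fewer than \<xi> n candidates for its third vertex.\<close>
      let ?F = "(\<lambda>v. {z, w, v}) ` (sym_diff ?T ?C - {w})"
      have zn: "z \<notin> ?T" "z \<notin> ?C" using NU[OF Si] by (auto simp: cnb_def)
      have "card {X \<in> ksets W k. e \<subseteq> X \<and> (\<exists>e'\<in>D. e' \<noteq> e \<and> e' \<subseteq> X)} \<le> card {X \<in> ksets W k. \<exists>s\<in>?F. s \<subseteq> X}"
        by (rule card_mono) (use w in \<open>auto simp: D_def\<close>)
      moreover have "real (card {X \<in> ksets W k. \<exists>s\<in>?F. s \<subseteq> X}) * real (card W) ^ 3 \<le> real (card ?F) * real (card W) ^ k"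
        by (rule card_ksets_some_superset) (use finT wz zn in \<open>auto simp: card_insert_if\<close>)
      moreover have "real (card ?F) \<le> \<xi> * real n"
      proof -
        have "card ?F \<le> card (sym_diff ?T ?C - {w})" using finT by (intro card_image_le) auto
        also have "\<dots> \<le> card (sym_diff ?T ?C)" using finT by (intro card_mono) auto
        finally show ?thesis using u(2) by linarith
      qed
      then have "real (card ?F) * real n ^ k \<le> \<xi> * real n * real n ^ k" by (intro mult_right_mono) auto
      ultimately have "real (card {X \<in> ksets W k. e \<subseteq> X \<and> (\<exists>e'\<in>D. e' \<noteq> e \<and> e' \<subseteq> X)}) * real n ^ 3 \<le> \<xi> * real n * real n ^ k"
        by (simp) (meson mult_right_mono of_nat_le_iff order_trans zero_le_power of_nat_0_le_iff)
      then show ?thesis using n_pos H(2) by (simp add: Qn_def field_simps power2_eq_square power3_eq_cube)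
    qed
    have "Lam k \<gamma> H - Lam k \<gamma> (S (Suc i)) \<ge> real (card D) * (\<kappa> * Q n - 4 * M * \<zeta> * Q n - 4 * M * (\<xi> * Q n))"
      using Lam_toggle_le[OF H(1) D2 loss few] tog by simp
    moreover have "real (card D) * (\<kappa> * Q n - 4 * M * \<zeta> * Q n - 4 * M * (\<xi> * Q n)) \<ge> (\<xi> / 2 * real n) * (\<kappa> / 2 * Q n)"
    proof (rule mult_mono)
      \<comment> \<open>Before the step the distance from this clone was at least \<xi> n, and the
        step changes at most half of that.\<close>
      have "card (sym_diff (?N i) ?C) \<le> card (sym_diff (?N i) ?T) + card (sym_diff ?T ?C)"
      proof (rule card_sym_diff_triangle)
        show "finite (?N i)" using finite_subset[OF NU[of i]] i(1) by simp
        show "finite ?T" using finite_subset[OF NU[OF Si]] by simp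
        show "finite ?C" by (simp add: cnb_def)
      qed
      moreover have "\<xi> * real n \<le> real (card (sym_diff (?N i) ?C))" using i(2) u(1) by (auto simp: Far_def)
      ultimately show "\<xi> / 2 * real n \<le> real (card D)" using step(2)[OF Si] cardD by linarith
      have "4 * M * \<zeta> * Q n \<le> \<kappa> / 4 * Q n" "4 * M * \<xi> * Q n \<le> \<kappa> / 4 * Q n"
        using \<zeta>(4,5) Q_pos by (auto intro: mult_right_mono)
      then show "\<kappa> / 2 * Q n \<le> \<kappa> * Q n - 4 * M * \<zeta> * Q n - 4 * M * (\<xi> * Q n)" by (simp add: mult.assoc)
    qed (use \<kappa>_pos Q_pos in auto)
    moreover have "Lam k \<gamma> H = Lam k \<gamma> ?K + ?r ?C" using Lam_rsum[OF H(1) _ H(3)] H(2) nH z by simp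
    moreover have "Lam k \<gamma> (S (Suc i)) = Lam k \<gamma> ?K + ?r ?T" by (rule LamS[OF Si])
    moreover have "(\<xi> / 2 * real n) * (\<kappa> / 2 * Q n) = \<kappa> * \<xi> / 4 * (real n * Q n)" by simp
    ultimately have "?r ?T \<le> ?r ?C - \<kappa> * \<xi> / 4 * (real n * Q n)" by linarith
    moreover have "?r ?C \<le> rsum (edges R) (cnb W g ?j) W + \<kappa> * \<xi> / 16 * (real n * Q n)"
    proof -
      have "w \<in> ?C \<longleftrightarrow> w \<in> cnb W g ?j" if "w \<in> W" "w \<notin> B" "w \<noteq> z" for w
        using that B(2) by (simp add: cnb_def)
      then have "\<bar>?r ?C - rsum (edges R) (cnb W g ?j) W\<bar> \<le> 3 * M * (real (card B) + 1) * Q n"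
        using B(2) by (intro transfer[OF B(1) _ z]) simp_all
      then show ?thesis using BQ by linarith
    qed
    moreover have "\<kappa> * \<xi> / 16 * (real n * Q n) > 0" using \<kappa>_pos \<xi> nQ by simp
    \<comment> \<open>In units of \<kappa> \<xi> n \<open>Q n\<close> / 16 the flips lose 4 and
      \<open>transfer\<close> returns at most 1, which leaves more than the 2 units claimed.\<close>
    moreover have "\<kappa> * \<xi> / 8 * (real n * Q n) = 2 * (\<kappa> * \<xi> / 16 * (real n * Q n))"
      "\<kappa> * \<xi> / 4 * (real n * Q n) = 4 * (\<kappa> * \<xi> / 16 * (real n * Q n))" by simp_all
    ultimately show ?thesis using mono[OF Si, unfolded nb0] clone_le_apex[OF u(1)] by linarith
  qed
qed

end

section \<open>Recolouring a graph close to a good colouring\<close>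

context good_colouring
begin

lemma pow_eq: "real n ^ k = Q n * real n ^ 2"
  using n_pos by (simp add: Qn_def)

text \<open>The recoloured graph \<open>cgraph W f\<close> is produced in two steps: vertices of large degree in the
  difference are given their best colour, and those which are still far from every clone are then
  corrected one at a time.\<close>

lemma local_stability:
  assumes G: "is_graph G" "verts G = W"
    and close: "real (card (sym_diff (edges G) (edges R))) \<le> \<eta> * real n ^ 2"
    and \<xi>: "0 < \<xi>" "\<xi> \<le> 1" "64 * M * \<xi> \<le> \<kappa>"
    and \<zeta>: "0 < \<zeta>" "\<zeta> \<le> \<xi> / 4" "768 * M * \<zeta> \<le> \<kappa> * \<xi>"
    and \<eta>: "4 * \<eta> \<le> \<xi> * \<zeta>"
    and large: "10 \<le> \<zeta> * real n" "2 \<le> \<beta> * real n" "32 * (real k * M / \<beta>) \<le> \<kappa> * \<xi> * real n"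
    and sym: "\<And>J. is_graph J \<Longrightarrow> order J = n \<Longrightarrow> Sym2 k \<gamma> (\<xi> / 2) J"
  shows "\<exists>f. \<kappa> * \<xi> / 16 * Q n * real (card (sym_diff (edges G) (edges (cgraph W f))))
    \<le> Lam k \<gamma> (cgraph W f) - Lam k \<gamma> G"
proof -
  define D0 where "D0 = sym_diff (edges G) (edges R)"
  define B0 where "B0 = {z \<in> W. real (card {w. {z, w} \<in> D0}) \<ge> \<xi> * real n}"
  define c where "c z j = card (sym_diff (nbhd G z) (cnb W g j))" for z j
  define f where "f z = (if z \<in> B0 then arg_min_on (c z) (g ` W) else g z)" for z
  define H where "H = cgraph W f"
  define D where "D = sym_diff (edges G) (edges H)"
  \<comment> \<open>The threshold is twice that of B0 for two reasons. Outside B0, recolouring the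
    few vertices of B0 cannot raise a degree this far (\<open>BB0\<close>), and a vertex of B
    remains \<xi> n away from every clone after g is replaced by f (\<open>far\<close>).\<close>
  define B where "B = {z \<in> W. real (card {w. {z, w} \<in> D}) \<ge> 2 * \<xi> * real n}"
  have gW: "finite (g ` W)" "g ` W \<noteq> {}" using n_pos by auto
  have H: "is_graph H" "verts H = W" unfolding H_def by (simp_all add: is_graph_cgraph)
  have D0W: "D0 \<subseteq> ksets W 2" unfolding D0_def using G cgraph_edges_subset[of W g] by (auto simp: is_graph_iff)
  have DW: "D \<subseteq> ksets W 2" unfolding D_def using G H by (auto simp: is_graph_iff)
  have finD: "finite D" by (rule finite_subset[OF DW]) simp
  have finB0: "finite B0" "B0 \<subseteq> W" by (auto simp: B0_def)
  have fg: "f w = g w" if "w \<in> W" "w \<notin> B0" for w using that by (simp add: f_def)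
  have fmin: "f z \<in> g ` W" "\<And>j. j \<in> g ` W \<Longrightarrow> c z (f z) \<le> c z j" if "z \<in> B0" for z
    using arg_min_if_finite(1)[OF gW, of "c z"] arg_min_least[OF gW, of _ "c z"] that by (simp_all add: f_def)
  have fW: "f ` W \<subseteq> g ` W" using fmin(1) fg by (metis image_eqI image_subsetI)
  have \<eta>\<zeta>: "\<eta> \<le> \<zeta>" using \<eta> \<xi>(2) \<zeta>(1) mult_right_mono[of \<xi> 1 \<zeta>] by linarith
  have cardB0: "real (card B0) + 5 \<le> \<zeta> * real n"
  proof -
    have "real (card B0) * (\<xi> * real n) \<le> 2 * real (card D0)"
      unfolding B0_def by (rule card_high_degree[OF _ D0W]) simp
    also have "\<dots> \<le> 2 * (\<eta> * real n ^ 2)" using close by (simp add: D0_def)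
    also have "\<dots> \<le> (\<xi> * \<zeta> / 2) * real n ^ 2"
      using mult_right_mono[OF \<eta>, of "real n ^ 2"] by simp
    also have "\<dots> = (\<zeta> / 2 * real n) * (\<xi> * real n)" by (simp add: power2_eq_square)
    \<comment> \<open>Half of \<zeta> n is left over, and since 10 \<le> \<zeta> n it covers the
      additive 5.\<close>
    finally have "real (card B0) \<le> \<zeta> / 2 * real n" using \<xi>(1) n_pos by simp
    then show ?thesis using large(1) by linarith
  qed
  have cnb_fg: "sym_diff (cnb W f j) (cnb W g j) \<subseteq> B0" for j
    using fg by (auto simp: cnb_def)
  have edge_fg: "sym_diff (edges H) (edges R) \<subseteq> {e \<in> ksets W 2. e \<inter> B0 \<noteq> {}}"
    unfolding H_def by (rule cgraph_recolour_diff) (rule fg)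
  have cardD: "real (card D) \<le> 2 * \<zeta> * real n ^ 2"
  proof -
    have "D \<subseteq> D0 \<union> {e \<in> ksets W 2. e \<inter> B0 \<noteq> {}}" using edge_fg unfolding D_def D0_def by blast
    then have "card D \<le> card (D0 \<union> {e \<in> ksets W 2. e \<inter> B0 \<noteq> {}})"
      using finite_subset[OF D0W] by (intro card_mono) auto
    also have "\<dots> \<le> card D0 + card {e \<in> ksets W 2. e \<inter> B0 \<noteq> {}}" by (rule card_Un_le)
    finally have "real (card D) \<le> \<eta> * real n ^ 2 + real (card B0) * real n"
      using close card_pairs_meeting[of W B0] finB0(1) unfolding D0_def by simp
    also have "\<dots> \<le> \<zeta> * real n ^ 2 + (\<zeta> * real n) * real n"
      using \<eta>\<zeta> cardB0 by (intro add_mono mult_right_mono) auto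
    finally show ?thesis by (simp add: power2_eq_square algebra_simps)
  qed
  have degD: "{w. {z, w} \<in> D} = sym_diff (nbhd G z) (nbhd H z)" for z
    by (auto simp: D_def nbhd_def)
  have finnb: "finite (nbhd G z)" "finite (nbhd H z)" for z
    using finite_subset[OF nbhd_subset[OF G(1)]] finite_subset[OF nbhd_subset[OF H(1)]] G(2) H(2) by simp_all
  have fincnb: "finite (cnb U h j)" if "finite U" for U h j using that by (simp add: cnb_def)
  have BB0: "B \<subseteq> B0"
  proof
    fix z assume z: "z \<in> B"
    show "z \<in> B0"
    proof (rule ccontr)
      assume nz: "z \<notin> B0"
      have zW: "z \<in> W" using z by (simp add: B_def)
      have "{w. {z, w} \<in> D} \<subseteq> {w. {z, w} \<in> D0} \<union> B0"
      proof
        fix w assume "w \<in> {w. {z, w} \<in> D}"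
        then show "w \<in> {w. {z, w} \<in> D0} \<union> B0" using edge_fg nz unfolding D_def D0_def by blast
      qed
      moreover have "finite {w. {z, w} \<in> D0}"
        by (rule finite_subset[of _ W]) (use D0W in \<open>auto simp: ksets_def\<close>)
      ultimately have "card {w. {z, w} \<in> D} \<le> card ({w. {z, w} \<in> D0} \<union> B0)"
        using finB0 by (intro card_mono) auto
      also have "\<dots> \<le> card {w. {z, w} \<in> D0} + card B0" by (rule card_Un_le)
      finally have "2 * \<xi> * real n \<le> real (card {w. {z, w} \<in> D0}) + real (card B0)"
        using z by (simp add: B_def)
      moreover have "real (card {w. {z, w} \<in> D0}) < \<xi> * real n" using nz zW by (simp add: B0_def)
      moreover have "\<zeta> * real n \<le> \<xi> / 4 * real n" using \<zeta>(2) by (intro mult_right_mono) auto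
      moreover have "\<xi> * real n > 0" using \<xi>(1) n_pos by simp
      ultimately show False using cardB0 by linarith
    qed
  qed
  have finB: "finite B" using finite_subset[OF BB0 finB0(1)] .
  \<comment> \<open>The colour of z minimises the distance to clones with respect to g. If some
    clone with respect to f were within \<xi> n, then H would agree with G at z up to \<xi> n + 2
    (|B0| + 1), which is below the threshold 2 \<xi> n of B.\<close>
  have far: "\<xi> * real n \<le> real (card (sym_diff (nbhd G z) (cnb (W - {z}) f j)))"
    if z: "z \<in> B" and j: "j \<in> g ` W" for z j
  proof -
    have zB0: "z \<in> B0" and zW: "z \<in> W" using z BB0 finB0 by auto
    have ins: "card A \<le> card B0 + 1" if "A \<subseteq> insert z B0" for A
      using card_mono[OF _ that] finB0(1) by (auto simp: card_insert_if split: if_splits)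
    have "card (sym_diff (nbhd G z) (nbhd H z)) \<le> c z (f z) + card (sym_diff (cnb W g (f z)) (nbhd H z))"
      unfolding c_def by (rule card_sym_diff_triangle) (use finnb fincnb in auto)
    moreover have "card (sym_diff (cnb W g (f z)) (nbhd H z)) \<le> card B0 + 1"
      using cnb_fg[of "f z"] unfolding H_def nbhd_cgraph[OF zW] by (intro ins) auto
    moreover have "c z (f z) \<le> c z j" by (rule fmin(2)[OF zB0 j])
    moreover have "c z j \<le> card (sym_diff (nbhd G z) (cnb (W - {z}) f j)) + card (sym_diff (cnb (W - {z}) f j) (cnb W g j))"
      unfolding c_def by (rule card_sym_diff_triangle) (use finnb fincnb in auto)
    moreover have "card (sym_diff (cnb (W - {z}) f j) (cnb W g j)) \<le> card B0 + 1"
    proof (rule ins)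
      show "sym_diff (cnb (W - {z}) f j) (cnb W g j) \<subseteq> insert z B0"
        using fg by (auto simp: cnb_def)
    qed
    moreover have "2 * \<xi> * real n \<le> real (card (sym_diff (nbhd G z) (nbhd H z)))"
      using z unfolding B_def degD by simp
    moreover have "\<zeta> * real n \<le> \<xi> / 4 * real n" using \<zeta>(2) by (intro mult_right_mono) auto
    ultimately show ?thesis using cardB0 by linarith
  qed
  have nQ: "real n * Q n > 0" using n_pos Q_pos by simp
  have M\<zeta>: "M * \<zeta> \<le> \<kappa> * \<xi> / 768" "16 * M * \<zeta> \<le> \<kappa>" "16 * M * \<xi> \<le> \<kappa>" "48 * M * \<zeta> \<le> \<kappa> * \<xi>"
  proof -
    show a: "M * \<zeta> \<le> \<kappa> * \<xi> / 768" using \<zeta>(3) by simp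
    have "\<kappa> * \<xi> \<le> \<kappa>" "0 < M * \<zeta>" "0 < M * \<xi>" using \<xi> \<kappa>_pos M_pos \<zeta>(1) by simp_all
    then show "16 * M * \<zeta> \<le> \<kappa>" "16 * M * \<xi> \<le> \<kappa>" "48 * M * \<zeta> \<le> \<kappa> * \<xi>" using a \<xi>(3) \<zeta>(3) by linarith+
  qed
  \<comment> \<open>Interpolates between G and H: pairs meeting A come from H, all others from G.
    Passing from A to \<open>insert z A\<close> changes pairs at z only, so both graphs have the
    same vertex-deleted graph K.\<close>
  define GA where "GA A = \<lparr>verts = W, edges = {e \<in> edges G. e \<inter> A = {}} \<union> {e \<in> edges H. e \<inter> A \<noteq> {}}\<rparr>" for A
  have GA: "is_graph (GA A)" "verts (GA A) = W" for A
    using G H unfolding GA_def is_graph_iff by auto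
  have GA0: "GA {} = G" unfolding GA_def using G(2) by auto
  have gain: "Lam k \<gamma> (GA (insert z A)) - Lam k \<gamma> (GA A) \<ge> \<kappa> * \<xi> / 16 * (real n * Q n)"
    if z: "z \<in> B" "z \<notin> A" and A: "A \<subseteq> B" for z A
  proof -
    let ?U = "W - {z}"
    let ?F = "edges (cgraph ?U f)"
    define K where "K = del_vertex (GA A) z"
    have zW: "z \<in> W" using z by (simp add: B_def)
    have K': "del_vertex (GA (insert z A)) z = K"
      unfolding K_def del_vertex_def induced_def GA_def by auto
    have EK: "edges K \<subseteq> ksets UNIV 2"
      using edges_pairs[OF is_graph_del_vertex[OF GA(1)]] unfolding K_def .
    have KY: "{e \<in> edges K. e \<subseteq> Y} = {e \<in> ?F. e \<subseteq> Y}"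
      if Y: "Y \<subseteq> ?U" "Y \<inter> B0 = {}" "\<forall>e\<in>D. \<not> e \<subseteq> Y" for Y
    proof -
      have "Y \<inter> A = {}" using Y(2) A BB0 by blast
      then have "{e \<in> edges K. e \<subseteq> Y} = {e \<in> edges G. e \<subseteq> Y}"
        using Y(1) unfolding K_def GA_def del_vertex_sel by auto
      also have "\<dots> = {e \<in> edges H. e \<subseteq> Y}" using Y(3) unfolding D_def by blast
      also have "\<dots> = {e \<in> ?F. e \<subseteq> Y}" unfolding H_def using Y(1) by (intro cgraph_edges_within) auto
      finally show ?thesis .
    qed
    have fc: "finite e \<and> card e = 2" if "e \<in> D" for e
      using finite_card_ksets subsetD[OF DW that] by blast
    let ?err = "2 * M * (real (card B0) + real (card D) / real n) * Q n"
    have 1: "\<bar>rsum (edges K) (nbhd (GA A) z) ?U - rsum ?F (nbhd G z) ?U\<bar> \<le> ?err"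
    proof (rule rsum_close[OF _ n_pos EK cgraph_pairs finB0(1) finD fc])
      fix Y assume Y: "Y \<subseteq> ?U" "Y \<inter> B0 = {}" "\<forall>e\<in>D. \<not> e \<subseteq> Y"
      have "Y \<inter> A = {}" using Y(2) A BB0 by blast
      then have "nbhd (GA A) z \<inter> Y = nbhd G z \<inter> Y"
        using z(2) unfolding nbhd_def GA_def by auto
      then show "{e \<in> edges K. e \<subseteq> Y} = {e \<in> ?F. e \<subseteq> Y} \<and> nbhd (GA A) z \<inter> Y = nbhd G z \<inter> Y"
        using KY[OF Y] by simp
    qed auto
    have nb: "nbhd (GA (insert z A)) z = nbhd H z" unfolding nbhd_def GA_def by auto
    have 2: "\<bar>rsum (edges K) (nbhd H z) ?U - rsum ?F (nbhd H z) ?U\<bar> \<le> ?err"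
    proof (rule rsum_close[OF _ n_pos EK cgraph_pairs finB0(1) finD fc])
      fix Y assume Y: "Y \<subseteq> ?U" "Y \<inter> B0 = {}" "\<forall>e\<in>D. \<not> e \<subseteq> Y"
      show "{e \<in> edges K. e \<subseteq> Y} = {e \<in> ?F. e \<subseteq> Y} \<and> nbhd H z \<inter> Y = nbhd H z \<inter> Y"
        using KY[OF Y] by simp
    qed auto
    obtain u where u: "u \<in> W" "g u = f z" using fW zW by (metis imageE image_eqI subsetD)
    have 3: "\<bar>rsum ?F (nbhd H z) ?U - rsum (edges R) (cnb W g (g u)) W\<bar> \<le> 3 * M * (real (card B0) + 1) * Q n"
    proof (rule transfer[OF finB0(1) _ zW])
      show "w \<in> nbhd H z \<longleftrightarrow> w \<in> cnb W g (g u)" if "w \<in> W" "w \<notin> B0" "w \<noteq> z" for w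
        using that fg u unfolding H_def nbhd_cgraph[OF zW] by (simp add: cnb_def)
    qed (rule fg)
    have 4: "rsum ?F (nbhd G z) ?U \<le> apex - \<kappa> * \<xi> / 8 * (real n * Q n)"
    proof (rule bad_vertex[OF finB0(1) fg fW zW _ \<xi>(1) far[OF z(1)] cardB0 \<zeta>(2) M\<zeta>(4,2,3) large(2) sym])
      show N: "nbhd G z \<subseteq> ?U" using nbhd_subset[OF G(1)] G(2) by simp
      show "is_graph (add_vertex (cgraph ?U f) z (nbhd G z))"
        using N by (intro is_graph_add_vertex is_graph_cgraph) auto
      have "insert z ?U = W" using zW by auto
      then show "order (add_vertex (cgraph ?U f) z (nbhd G z)) = n" unfolding order_def add_vertex_sel verts_cgraph by simp
    qed
    have 5: "apex - real k * M / \<beta> * Q n \<le> rsum (edges R) (cnb W g (g u)) W" by (rule apex_le_clone[OF u(1)])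
    have L1: "Lam k \<gamma> (GA A) = Lam k \<gamma> K + rsum (edges K) (nbhd (GA A) z) ?U"
      using Lam_rsum[OF GA(1), of z A K] GA(2) zW K_def by simp
    have L2: "Lam k \<gamma> (GA (insert z A)) = Lam k \<gamma> K + rsum (edges K) (nbhd H z) ?U"
      using Lam_rsum[OF GA(1) _ K'] GA(2) zW nb by simp
    have e1: "?err \<le> 6 * M * \<zeta> * (real n * Q n)"
    proof -
      have "real (card D) / real n \<le> 2 * \<zeta> * real n"
        using cardD n_pos by (simp add: pos_divide_le_eq power2_eq_square)
      then have "real (card B0) + real (card D) / real n \<le> 3 * \<zeta> * real n" using cardB0 by linarith
      then have "2 * M * (real (card B0) + real (card D) / real n) * Q n \<le> 2 * M * (3 * \<zeta> * real n) * Q n"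
        using M_pos Q_pos by (intro mult_right_mono mult_left_mono) auto
      then show ?thesis by (simp add: mult_ac)
    qed
    have e2: "3 * M * (real (card B0) + 1) * Q n \<le> 3 * M * \<zeta> * (real n * Q n)"
    proof -
      have "3 * M * (real (card B0) + 1) * Q n \<le> 3 * M * (\<zeta> * real n) * Q n"
        using cardB0 M_pos Q_pos by (intro mult_right_mono mult_left_mono) auto
      then show ?thesis by (simp add: mult_ac)
    qed
    have e3: "real k * M / \<beta> * Q n \<le> \<kappa> * \<xi> / 32 * (real n * Q n)"
      using mult_right_mono[OF large(3), of "Q n"] Q_pos by (simp add: mult_ac)
    have e4: "M * \<zeta> * (real n * Q n) \<le> \<kappa> * \<xi> / 768 * (real n * Q n)"
      using M\<zeta>(1) nQ by (intro mult_right_mono) auto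
    \<comment> \<open>In units of \<kappa> \<xi> n \<open>Q n\<close> / 768:
      \<open>bad_vertex\<close> yields 96, \<open>apex_le_clone\<close> takes 24, the two
      comparisons of K with the coloured graph take 6 each and \<open>transfer\<close> takes 3. The
      remaining 57 exceed the 48 claimed.\<close>
    have "\<kappa> * \<xi> / 768 * (real n * Q n) > 0" using \<kappa>_pos \<xi>(1) nQ by simp
    moreover have "\<kappa> * \<xi> / 8 * (real n * Q n) = 96 * (\<kappa> * \<xi> / 768 * (real n * Q n))"
      "\<kappa> * \<xi> / 32 * (real n * Q n) = 24 * (\<kappa> * \<xi> / 768 * (real n * Q n))"
      "\<kappa> * \<xi> / 16 * (real n * Q n) = 48 * (\<kappa> * \<xi> / 768 * (real n * Q n))"
      "6 * M * \<zeta> * (real n * Q n) = 6 * (M * \<zeta> * (real n * Q n))"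
      "3 * M * \<zeta> * (real n * Q n) = 3 * (M * \<zeta> * (real n * Q n))" by simp_all
    ultimately show ?thesis using 1 2 3 4 5 e1 e2 e3 e4 unfolding L1 L2 by linarith
  qed
  have step1: "Lam k \<gamma> (GA B) - Lam k \<gamma> G \<ge> real (card B) * (\<kappa> * \<xi> / 16 * (real n * Q n))"
  proof -
    have "A \<subseteq> B \<Longrightarrow> Lam k \<gamma> (GA A) - Lam k \<gamma> G \<ge> real (card A) * (\<kappa> * \<xi> / 16 * (real n * Q n))" if "finite A" for A
      using that
    proof (induction A)
      case empty
      then show ?case by (simp add: GA0)
    next
      case (insert z A)
      have "Lam k \<gamma> (GA (insert z A)) - Lam k \<gamma> (GA A) \<ge> \<kappa> * \<xi> / 16 * (real n * Q n)"
        using insert by (intro gain) auto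
      moreover have "real (card (insert z A)) * (\<kappa> * \<xi> / 16 * (real n * Q n)) =
         real (card A) * (\<kappa> * \<xi> / 16 * (real n * Q n)) + \<kappa> * \<xi> / 16 * (real n * Q n)"
        using insert.hyps by (simp add: distrib_right)
      moreover have "Lam k \<gamma> (GA A) - Lam k \<gamma> G \<ge> real (card A) * (\<kappa> * \<xi> / 16 * (real n * Q n))"
        using insert by auto
      ultimately show ?case by linarith
    qed
    then show ?thesis using finB by blast
  qed
  \<comment> \<open>The pairs avoiding B have maximum degree at most 2 \<xi> n and number at most 2
    \<zeta> n^2. These two bounds limit the interaction of their flips.\<close>
  define D' where "D' = {e \<in> D. e \<inter> B = {}}"
  have D'W: "D' \<subseteq> ksets (verts H) 2" using DW H(2) by (auto simp: D'_def)
  have tog: "toggle H D' = GA B"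
  proof -
    have "sym_diff (edges H) D' = edges (GA B)" unfolding D'_def D_def GA_def by auto
    then show ?thesis using H(2) by (simp add: toggle_def GA_def)
  qed
  have loss: "Lam k \<gamma> H - Lam k \<gamma> (toggle H {e}) \<ge> \<kappa> * Q n - 4 * M * \<zeta> * Q n" if "e \<in> D'" for e
  proof -
    have "e \<in> ksets W 2" using that DW by (auto simp: D'_def)
    then obtain a b where e: "e = {a, b}" "a \<in> W" "b \<in> W" "a \<noteq> b" by (rule ksets_2E)
    have "Lam k \<gamma> H - Lam k \<gamma> (toggle H {e}) \<ge> \<kappa> * Q n - 4 * M * (real (card B0) + 2) * Q n / real n"
      unfolding H_def e(1) toggle_single
      by (rule perturbed_flip_loss[OF finB0(1) fg fW e(2-4) large(2)])
    moreover have "4 * M * (real (card B0) + 2) * Q n / real n \<le> 4 * M * \<zeta> * Q n"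
    proof -
      have "(4 * M * Q n) * (real (card B0) + 2) \<le> (4 * M * Q n) * (\<zeta> * real n)"
        using M_pos Q_pos cardB0 by (intro mult_left_mono) auto
      then show ?thesis using n_pos by (simp add: pos_divide_le_eq mult_ac)
    qed
    ultimately show ?thesis by linarith
  qed
  have few: "real (card {X \<in> ksets (verts H) k. e \<subseteq> X \<and> (\<exists>e'\<in>D'. e' \<noteq> e \<and> e' \<subseteq> X)}) \<le> (4 * \<xi> + 2 * \<zeta>) * Q n"
    if e: "e \<in> D'" for e
  proof -
    have "e \<in> ksets W 2" using e DW by (auto simp: D'_def)
    then obtain a b where ab: "e = {a, b}" "a \<in> W" "b \<in> W" "a \<noteq> b" by (rule ksets_2E)
    let ?Na = "{w. {a, w} \<in> D}" and ?Nb = "{w. {b, w} \<in> D}"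
    have finN: "finite {w. {v, w} \<in> D}" for v
      by (rule finite_subset[of _ W]) (use DW in \<open>auto simp: ksets_def\<close>)
    have ne: "w \<noteq> v" if "{v, w} \<in> D" for v w using subsetD[OF DW that] by (simp add: ksets_2_iff)
    have degs: "real (card {w. {v, w} \<in> D}) \<le> 2 * \<xi> * real n" if "v \<in> e" for v
      using e that ab unfolding D'_def B_def by auto
    \<comment> \<open>A second pair inside X either meets e, which gives a triple controlled by the
      degrees of a and b, or is disjoint from e, which gives a quadruple controlled by the size of
      D.\<close>
    let ?F3 = "(\<lambda>w. {a, b, w}) ` ((?Na \<union> ?Nb) - {a, b})"
    let ?F4 = "(\<lambda>e'. e \<union> e') ` {e' \<in> D. e' \<inter> e = {}}"
    have sub: "{X \<in> ksets W k. e \<subseteq> X \<and> (\<exists>e'\<in>D'. e' \<noteq> e \<and> e' \<subseteq> X)} \<subseteq>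
      {X \<in> ksets W k. \<exists>s\<in>?F3. s \<subseteq> X} \<union> {X \<in> ksets W k. \<exists>s\<in>?F4. s \<subseteq> X}"
    proof
      fix X assume "X \<in> {X \<in> ksets W k. e \<subseteq> X \<and> (\<exists>e'\<in>D'. e' \<noteq> e \<and> e' \<subseteq> X)}"
      then obtain e' where X: "X \<in> ksets W k" "e \<subseteq> X" and e': "e' \<in> D" "e' \<noteq> e" "e' \<subseteq> X"
        by (auto simp: D'_def)
      have "e' \<in> ksets W 2" using e'(1) DW by auto
      then obtain p q where pq: "e' = {p, q}" "p \<noteq> q" by (rule ksets_2E)
      show "X \<in> {X \<in> ksets W k. \<exists>s\<in>?F3. s \<subseteq> X} \<union> {X \<in> ksets W k. \<exists>s\<in>?F4. s \<subseteq> X}"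
      proof (cases "e' \<inter> e = {}")
        case True
        then have "e \<union> e' \<in> ?F4" using e'(1) by auto
        moreover have "e \<union> e' \<subseteq> X" using X(2) e'(3) by simp
        ultimately show ?thesis using X(1) by (intro UnI2 CollectI conjI bexI)
      next
        case False
        obtain w where w: "w \<in> ?Na \<union> ?Nb" "w \<in> X" "w \<notin> {a, b}"
        proof -
          consider "p \<in> e" "q \<notin> e" | "q \<in> e" "p \<notin> e"
            using False pq e'(2) ab(1,4) by auto
          then show ?thesis
          proof cases
            case 1
            then show ?thesis using that[of q] pq(1) e' ab(1) by auto
          next
            case 2
            then show ?thesis using that[of p] pq(1) e' ab(1) by (auto simp: insert_commute)
          qed
        qed
        then have "{a, b, w} \<in> ?F3" by blast
        moreover have "{a, b, w} \<subseteq> X" using X(2) w(2) ab(1) by simp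
        ultimately show ?thesis using X(1) by (intro UnI1 CollectI conjI bexI)
      qed
    qed
    have c3: "real (card {X \<in> ksets W k. \<exists>s\<in>?F3. s \<subseteq> X}) \<le> 4 * \<xi> * Q n"
    proof -
      have "real (card {X \<in> ksets W k. \<exists>s\<in>?F3. s \<subseteq> X}) * real (card W) ^ 3 \<le> real (card ?F3) * real (card W) ^ k"
        by (rule card_ksets_some_superset) (use finN ab(4) in auto)
      moreover have "real (card ?F3) \<le> 4 * \<xi> * real n"
      proof -
        have "card ?F3 \<le> card ((?Na \<union> ?Nb) - {a, b})" using finN by (intro card_image_le) auto
        also have "\<dots> \<le> card (?Na \<union> ?Nb)" using finN by (intro card_mono) auto
        also have "\<dots> \<le> card ?Na + card ?Nb" by (rule card_Un_le)
        finally show ?thesis using degs[of a] degs[of b] ab(1) by simp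
      qed
      then have "real (card ?F3) * real n ^ k \<le> 4 * \<xi> * real n * real n ^ k" by (intro mult_right_mono) auto
      ultimately have "real (card {X \<in> ksets W k. \<exists>s\<in>?F3. s \<subseteq> X}) * real n ^ 3 \<le> 4 * \<xi> * real n * real n ^ k"
        by simp
      also have "\<dots> = (4 * \<xi> * Q n) * real n ^ 3" unfolding pow_eq by (simp add: power2_eq_square power3_eq_cube)
      finally show ?thesis using n_pos by simp
    qed
    have c4: "real (card {X \<in> ksets W k. \<exists>s\<in>?F4. s \<subseteq> X}) \<le> 2 * \<zeta> * Q n"
    proof -
      have "finite s \<and> card s = 4" if s: "s \<in> ?F4" for s
      proof -
        obtain e' where e': "s = e \<union> e'" "e' \<in> D" "e' \<inter> e = {}" using s by auto
        have "finite e" "card e = 2" "finite e'" "card e' = 2"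
          using finite_card_ksets \<open>e \<in> ksets W 2\<close> subsetD[OF DW e'(2)] by blast+
        then show ?thesis using e' by (simp add: card_Un_disjoint Int_commute)
      qed
      then have "real (card {X \<in> ksets W k. \<exists>s\<in>?F4. s \<subseteq> X}) * real (card W) ^ 4 \<le> real (card ?F4) * real (card W) ^ k"
        using finD by (intro card_ksets_some_superset) auto
      moreover have "real (card ?F4) \<le> 2 * \<zeta> * real n ^ 2"
      proof -
        have "card ?F4 \<le> card {e' \<in> D. e' \<inter> e = {}}" using finD by (intro card_image_le) auto
        also have "\<dots> \<le> card D" using finD by (intro card_mono) auto
        finally show ?thesis using cardD by linarith
      qed
      then have "real (card ?F4) * real n ^ k \<le> 2 * \<zeta> * real n ^ 2 * real n ^ k" by (intro mult_right_mono) auto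
      ultimately have "real (card {X \<in> ksets W k. \<exists>s\<in>?F4. s \<subseteq> X}) * real n ^ 4 \<le> 2 * \<zeta> * real n ^ 2 * real n ^ k"
        by simp
      also have "\<dots> = (2 * \<zeta> * Q n) * real n ^ 4" unfolding pow_eq by (simp add: power2_eq_square power4_eq_xxxx)
      finally show ?thesis using n_pos by simp
    qed
    have "card {X \<in> ksets W k. e \<subseteq> X \<and> (\<exists>e'\<in>D'. e' \<noteq> e \<and> e' \<subseteq> X)} \<le>
      card ({X \<in> ksets W k. \<exists>s\<in>?F3. s \<subseteq> X} \<union> {X \<in> ksets W k. \<exists>s\<in>?F4. s \<subseteq> X})"
      using sub by (intro card_mono) auto
    also have "\<dots> \<le> card {X \<in> ksets W k. \<exists>s\<in>?F3. s \<subseteq> X} + card {X \<in> ksets W k. \<exists>s\<in>?F4. s \<subseteq> X}"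
      by (rule card_Un_le)
    finally have "real (card {X \<in> ksets W k. e \<subseteq> X \<and> (\<exists>e'\<in>D'. e' \<noteq> e \<and> e' \<subseteq> X)}) \<le> 4 * \<xi> * Q n + 2 * \<zeta> * Q n"
      using c3 c4 by linarith
    then show ?thesis unfolding H(2) by (simp add: distrib_right)
  qed
  have step2: "Lam k \<gamma> H - Lam k \<gamma> (GA B) \<ge> real (card D') * (\<kappa> * \<xi> / 16 * Q n)"
  proof -
    have "Lam k \<gamma> H - Lam k \<gamma> (GA B) \<ge> real (card D') * (\<kappa> * Q n - 4 * M * \<zeta> * Q n - 4 * M * ((4 * \<xi> + 2 * \<zeta>) * Q n))"
      using Lam_toggle_le[OF H(1) D'W loss few] tog by simp
    moreover have "\<kappa> * \<xi> / 16 * Q n \<le> \<kappa> * Q n - 4 * M * \<zeta> * Q n - 4 * M * ((4 * \<xi> + 2 * \<zeta>) * Q n)"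
    proof -
      have k1: "\<kappa> * \<xi> \<le> \<kappa>" using \<xi> \<kappa>_pos by simp
      then have "\<kappa> * \<xi> / 16 \<le> \<kappa> - 12 * (M * \<zeta>) - 16 * (M * \<xi>)"
        using \<xi>(3) M\<zeta>(1) \<kappa>_pos by linarith
      then have "\<kappa> * \<xi> / 16 * Q n \<le> (\<kappa> - 12 * (M * \<zeta>) - 16 * (M * \<xi>)) * Q n"
        using Q_pos by (intro mult_right_mono) auto
      then show ?thesis by (simp add: algebra_simps)
    qed
    then have "real (card D') * (\<kappa> * \<xi> / 16 * Q n) \<le> real (card D') * (\<kappa> * Q n - 4 * M * \<zeta> * Q n - 4 * M * ((4 * \<xi> + 2 * \<zeta>) * Q n))"
      by (rule mult_left_mono) simp
    ultimately show ?thesis by linarith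
  qed
  \<comment> \<open>A vertex of B lies in at most n pairs and has gained a multiple of n
    \<open>Q n\<close>, so both stages pay for the pairs of D at the same rate \<kappa> \<xi>
    \<open>Q n\<close> / 16.\<close>
  have "real (card D) \<le> real (card D') + real (card B) * real n"
  proof -
    have "D \<subseteq> D' \<union> {e \<in> ksets W 2. e \<inter> B \<noteq> {}}" using DW unfolding D'_def by blast
    then have "card D \<le> card (D' \<union> {e \<in> ksets W 2. e \<inter> B \<noteq> {}})"
      using finD by (intro card_mono) (auto simp: D'_def)
    also have "\<dots> \<le> card D' + card {e \<in> ksets W 2. e \<inter> B \<noteq> {}}" by (rule card_Un_le)
    finally show ?thesis using card_pairs_meeting[of W B] finB by simp
  qed
  then have "\<kappa> * \<xi> / 16 * Q n * real (card D) \<le> \<kappa> * \<xi> / 16 * Q n * (real (card D') + real (card B) * real n)"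
    using \<kappa>_pos \<xi>(1) Q_pos by (intro mult_left_mono) auto
  also have "\<dots> = real (card D') * (\<kappa> * \<xi> / 16 * Q n) + real (card B) * (\<kappa> * \<xi> / 16 * (real n * Q n))"
    by (simp add: algebra_simps)
  also have "\<dots> \<le> Lam k \<gamma> H - Lam k \<gamma> G" using step1 step2 by linarith
  finally show ?thesis unfolding D_def H_def by blast
qed

end

section \<open>Choice of constants, and an obstruction to small classes\<close>

lemma eventually_le_mult:
  fixes a b :: real
  assumes "a > 0"
  obtains N :: nat where "\<And>n. n \<ge> N \<Longrightarrow> b \<le> a * real n"
proof -
  obtain N :: nat where N: "b / a < real N" using reals_Archimedean2 by blast
  have "b \<le> a * real n" if "n \<ge> N" for n
  proof -
    have "b / a \<le> real n" using N that by linarith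
    then show ?thesis using assms by (simp add: pos_divide_le_eq mult.commute)
  qed
  then show ?thesis by (rule that)
qed

context bounded_invariant
begin

text \<open>The constants depend on \<kappa>, \<beta> and the invariant but not on n or g, so they
  serve all realisations of a maximiser at once.\<close>

lemma uniform_local_stability:
  assumes "symmetrisable k \<gamma>" "\<kappa> > 0" "\<beta> > 0"
  obtains \<eta> c N where "\<eta> > 0" "c > 0"
    "\<And>n g G. n \<ge> N \<Longrightarrow> good_colouring k \<gamma> M \<kappa> \<beta> n g \<Longrightarrow> is_graph G \<Longrightarrow> verts G = {1..n} \<Longrightarrow>
      real (card (sym_diff (edges G) (edges (cgraph {1..n} g)))) \<le> \<eta> * real n ^ 2 \<Longrightarrow>
      \<exists>f. c * real (card (sym_diff (edges G) (edges (cgraph {1..n} f))))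
        \<le> (lam k \<gamma> (cgraph {1..n} f) - lam k \<gamma> G) * real n ^ 2"
proof -
  \<comment> \<open>The inequalities demanded by \<open>local_stability\<close> are solved in the
    order \<xi>, \<zeta>, \<eta>, each constant being limited by the earlier ones.\<close>
  define \<xi> where "\<xi> = min 1 (\<kappa> / (64 * M))"
  define \<zeta> where "\<zeta> = min (\<xi> / 4) (\<kappa> * \<xi> / (768 * M))"
  define \<eta> where "\<eta> = \<xi> * \<zeta> / 4"
  define c where "c = \<kappa> * \<xi> / 16"
  have \<xi>0: "0 < \<xi>" "\<xi> \<le> 1" "\<xi> \<le> \<kappa> / (64 * M)" using assms(2) M_pos by (simp_all add: \<xi>_def)
  have "64 * M * \<xi> \<le> \<kappa>" using \<xi>0(3) M_pos by (simp add: pos_le_divide_eq mult_ac)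
  note \<xi> = \<xi>0(1,2) this
  have \<zeta>0: "0 < \<zeta>" "\<zeta> \<le> \<xi> / 4" "\<zeta> \<le> \<kappa> * \<xi> / (768 * M)"
    using assms(2) M_pos \<xi> by (simp_all add: \<zeta>_def)
  have "768 * M * \<zeta> \<le> \<kappa> * \<xi>" using \<zeta>0(3) M_pos by (simp add: pos_le_divide_eq mult_ac)
  note \<zeta> = \<zeta>0(1,2) this
  have \<eta>: "\<eta> > 0" "4 * \<eta> \<le> \<xi> * \<zeta>" using \<xi> \<zeta> by (simp_all add: \<eta>_def)
  have c: "c > 0" using assms(2) \<xi> by (simp add: c_def)
  obtain N1 where N1: "\<And>n. n \<ge> N1 \<Longrightarrow> 10 \<le> \<zeta> * real n" using eventually_le_mult[OF \<zeta>(1)] by blast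
  obtain N2 where N2: "\<And>n. n \<ge> N2 \<Longrightarrow> 2 \<le> \<beta> * real n" using eventually_le_mult[OF assms(3)] by blast
  have "\<kappa> * \<xi> > 0" using assms(2) \<xi>(1) by simp
  then obtain N3 where N3: "\<And>n. n \<ge> N3 \<Longrightarrow> 32 * (real k * M / \<beta>) \<le> \<kappa> * \<xi> * real n"
    using eventually_le_mult by blast
  obtain N4 where N4: "\<And>J. is_graph J \<Longrightarrow> order J \<ge> N4 \<Longrightarrow> Sym2 k \<gamma> (\<xi> / 2) J"
    using assms(1) \<xi>(1) unfolding symmetrisable_def by (meson half_gt_zero)
  show ?thesis
  proof (rule that[OF \<eta>(1) c, of "max (max N1 N2) (max N3 N4)"])
    fix n g G
    assume n: "max (max N1 N2) (max N3 N4) \<le> n" and g: "good_colouring k \<gamma> M \<kappa> \<beta> n g"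
      and G: "is_graph G" "verts G = {1..n}"
      and close: "real (card (sym_diff (edges G) (edges (cgraph {1..n} g)))) \<le> \<eta> * real n ^ 2"
    interpret good_colouring k \<gamma> M \<kappa> \<beta> n g by (rule g)
    obtain f where f: "c * Q n * real (card (sym_diff (edges G) (edges (cgraph W f)))) \<le> Lam k \<gamma> (cgraph W f) - Lam k \<gamma> G"
      using local_stability[OF G close \<xi> \<zeta> \<eta>(2)] N1[of n] N2[of n] N3[of n] N4 n unfolding c_def by auto
    let ?d = "real (card (sym_diff (edges G) (edges (cgraph W f))))" and ?\<Delta> = "lam k \<gamma> (cgraph W f) - lam k \<gamma> G"
    let ?C = "real (n choose k)"
    have C: "?C > 0" "?C \<le> real n ^ k" using nk choose_le_pow[of n k] by (simp_all flip: of_nat_power)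
    have \<Delta>: "Lam k \<gamma> (cgraph W f) - Lam k \<gamma> G = ?C * ?\<Delta>"
      using C(1) G(2) by (simp add: lam_def order_def field_simps)
    \<comment> \<open>The sign of the increase must be known before the binomial coefficient may be
      replaced by the larger n^k.\<close>
    have "0 \<le> c * Q n * ?d" using c Q_pos by simp
    then have "0 \<le> ?C * ?\<Delta>" using f \<Delta> by linarith
    then have "?\<Delta> \<ge> 0" using C(1) by (simp add: zero_le_mult_iff)
    then have "?C * ?\<Delta> \<le> real n ^ k * ?\<Delta>" using C(2) by (rule mult_right_mono[rotated])
    then have "Q n * (c * ?d) \<le> Q n * (?\<Delta> * real n ^ 2)" using f \<Delta> unfolding pow_eq by (simp add: mult_ac)
    then have "c * ?d \<le> ?\<Delta> * real n ^ 2" using Q_pos by simp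
    then show "\<exists>f. c * real (card (sym_diff (edges G) (edges (cgraph {1..n} f))))
        \<le> (lam k \<gamma> (cgraph {1..n} f) - lam k \<gamma> G) * real n ^ 2" by blast
  qed
qed

text \<open>Joining two vertices of a small class and separating two vertices of different small classes
  are nearly inverse operations, so they cannot both be expensive.\<close>

lemma two_small_classes:
  assumes n: "n > 0" and abd: "a \<in> {1..n}" "b \<in> {1..n}" "d \<in> {1..n}" "a \<noteq> b"
    and g: "g a = i" "g b = i" "g d = j" "i \<noteq> j" "i \<noteq> 0" "j \<noteq> 0"
    and loss: "Lam k \<gamma> (cgraph {1..n} g) - Lam k \<gamma> (flip (cgraph {1..n} g) a b) \<ge> \<kappa> * Q n"
      "Lam k \<gamma> (cgraph {1..n} g) - Lam k \<gamma> (flip (cgraph {1..n} g) a d) \<ge> \<kappa> * Q n"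
  shows "\<kappa> * real n \<le> 2 * M * real (card {w \<in> {1..n}. g w = i \<or> g w = j})"
proof -
  let ?W = "{1..n}" and ?R = "cgraph {1..n} g"
  let ?Z = "{w \<in> ?W. g w = i \<or> g w = j}"
  have Qp: "Q n > 0" using Qn_pos[OF n] .
  have R: "is_graph ?R" by (rule is_graph_cgraph) simp
  have ad: "a \<noteq> d" using g by auto
  have res: "\<bar>psum (edges ?R) N1 N2 (?W - {u, v}) - psum (edges ?R) N1 N2 (?W - ?Z)\<bar> \<le> 2 * M * (real (card ?Z) * Q n / real n)"
    if "u \<in> ?Z" "v \<in> ?Z" for u v N1 N2
  proof -
    have eq: "?W - ?Z = (?W - {u, v}) - (?Z - {u, v})" using that by auto
    have "\<bar>psum (edges ?R) N1 N2 (?W - {u, v}) - psum (edges ?R) N1 N2 (?W - ?Z)\<bar>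
      \<le> 2 * M * real (card {Y \<in> ksets (?W - {u, v}) (k - 2). Y \<inter> (?Z - {u, v}) \<noteq> {}})"
      unfolding eq by (rule psum_restrict[OF cgraph_pairs]) auto
    also have "\<dots> \<le> 2 * M * (real (card (?Z - {u, v})) * Q n / real n)"
      using M_pos by (intro mult_left_mono hit_bound(2)[OF _ n]) auto
    also have "\<dots> \<le> 2 * M * (real (card ?Z) * Q n / real n)"
      using M_pos Qp by (intro mult_left_mono divide_right_mono mult_right_mono) (auto intro: card_mono)
    finally show ?thesis .
  qed
  \<comment> \<open>Outside ?Z both b and d are adjacent to everything. Thus the same sum decides
    whether a should be joined to b and whether it should be separated from d, with opposite
    signs.\<close>
  have same: "psum (edges ?R) (nbhd ?R a) (nbhd ?R b) (?W - ?Z) = psum (edges ?R) (nbhd ?R a) (nbhd ?R d) (?W - ?Z)"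
    unfolding psum_def
  proof (rule sum.cong[OF refl])
    fix Y assume "Y \<in> ksets (?W - ?Z) (k - 2)"
    then have Y: "Y \<subseteq> ?W - ?Z" by (simp add: ksets_def)
    have "nbhd ?R b \<inter> Y = Y" "nbhd ?R d \<inter> Y = Y"
      using Y abd g by (auto simp: nbhd_def cgraph_edge)
    then have "nbhd ?R b \<inter> Y = nbhd ?R d \<inter> Y" by simp
    from rooted2_cong[OF refl refl this]
    show "\<gamma> (rooted2 (edges ?R) (nbhd ?R a) (nbhd ?R b) False Y (fresh Y) (Suc (fresh Y))) -
        \<gamma> (rooted2 (edges ?R) (nbhd ?R a) (nbhd ?R b) True Y (fresh Y) (Suc (fresh Y))) =
        \<gamma> (rooted2 (edges ?R) (nbhd ?R a) (nbhd ?R d) False Y (fresh Y) (Suc (fresh Y))) -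
        \<gamma> (rooted2 (edges ?R) (nbhd ?R a) (nbhd ?R d) True Y (fresh Y) (Suc (fresh Y)))"
      by (simp only:)
  qed
  have "{a, b} \<notin> edges ?R" "{a, d} \<in> edges ?R" using abd g ad by (simp_all add: cgraph_edge)
  then have l1: "\<kappa> * Q n \<le> psum (edges ?R) (nbhd ?R a) (nbhd ?R b) (?W - {a, b})"
    and l2: "\<kappa> * Q n \<le> - psum (edges ?R) (nbhd ?R a) (nbhd ?R d) (?W - {a, d})"
    using loss Lam_flip[OF R, of a b] Lam_flip[OF R, of a d] abd ad by simp_all
  have "2 * (\<kappa> * Q n) \<le> 4 * M * (real (card ?Z) * Q n / real n)"
  proof -
    have "a \<in> ?Z" "b \<in> ?Z" "d \<in> ?Z" using abd g by simp_all
    with res[of a b "nbhd ?R a" "nbhd ?R b"] res[of a d "nbhd ?R a" "nbhd ?R d"]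
    have "\<bar>psum (edges ?R) (nbhd ?R a) (nbhd ?R b) (?W - {a, b}) - psum (edges ?R) (nbhd ?R a) (nbhd ?R b) (?W - ?Z)\<bar>
        \<le> 2 * M * (real (card ?Z) * Q n / real n)"
      "\<bar>psum (edges ?R) (nbhd ?R a) (nbhd ?R d) (?W - {a, d}) - psum (edges ?R) (nbhd ?R a) (nbhd ?R d) (?W - ?Z)\<bar>
        \<le> 2 * M * (real (card ?Z) * Q n / real n)"
      by blast+
    then show ?thesis using l1 l2 same by linarith
  qed
  then have "\<kappa> * Q n * real n \<le> 2 * M * real (card ?Z) * Q n" using n by (simp add: field_simps)
  then have "Q n * (\<kappa> * real n) \<le> Q n * (2 * M * real (card ?Z))" by (simp add: mult_ac)
  then show ?thesis using Qp by simp
qed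

end

subsection \<open>Realisations\<close>

definition part_index :: "(nat \<Rightarrow> nat set) \<Rightarrow> nat \<Rightarrow> nat" where
  "part_index V w = (THE i. w \<in> V i)"

lemma part_index_eq: "disjoint_family V \<Longrightarrow> w \<in> V i \<Longrightarrow> part_index V w = i"
  unfolding part_index_def disjoint_family_on_def by (rule the_equality) auto

lemma part_index_iff:
  assumes "realisation_parts n x V" "w \<in> {1..n}"
  shows "part_index V w = i \<longleftrightarrow> w \<in> V i"
proof -
  have d: "disjoint_family V" "(\<Union>i. V i) = {1..n}" using assms(1) by (auto simp: realisation_parts_def)
  then obtain j where "w \<in> V j" using assms(2) by blast
  then show ?thesis using part_index_eq[OF d(1)] by blast
qed

lemma part_index_mem: "realisation_parts n x V \<Longrightarrow> w \<in> {1..n} \<Longrightarrow> w \<in> V (part_index V w)"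
  by (rule part_index_iff[THEN iffD1]) auto

lemma realisation_graph_cgraph:
  assumes V: "realisation_parts n x V"
  shows "realisation_graph n V = cgraph {1..n} (part_index V)"
proof -
  have "(\<not> (\<exists>i\<ge>1. u \<in> V i \<and> w \<in> V i)) \<longleftrightarrow> (part_index V u = 0 \<or> part_index V u \<noteq> part_index V w)"
    if "u \<in> {1..n}" "w \<in> {1..n}" for u w
    using part_index_iff[OF V that(1)] part_index_iff[OF V that(2)]
    by (metis One_nat_def less_one not_less)
  then have "{{u, w} | u w. u \<in> {1..n} \<and> w \<in> {1..n} \<and> u \<noteq> w \<and> \<not> (\<exists>i\<ge>1. u \<in> V i \<and> w \<in> V i)} =
    {{u, w} | u w. u \<in> {1..n} \<and> w \<in> {1..n} \<and> u \<noteq> w \<and> (part_index V u = 0 \<or> part_index V u \<noteq> part_index V w)}"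
    by blast
  then show ?thesis unfolding realisation_graph_def cgraph_def by simp
qed

lemma realisation_part_subset: "realisation_parts n x V \<Longrightarrow> V i \<subseteq> {1..n}"
  unfolding realisation_parts_def by blast

lemma part_index_class:
  assumes "realisation_parts n x V"
  shows "{w \<in> {1..n}. part_index V w = i} = V i"
  using part_index_iff[OF assms] realisation_part_subset[OF assms, of i] by blast

lemma part_weights_antimono:
  assumes "part_weights x" "1 \<le> i" "i \<le> j"
  shows "x j \<le> x i"
  using assms(3)
proof (induction j rule: dec_induct)
  case (step m)
  then have "x (Suc m) \<le> x m" using assms(1,2) unfolding part_weights_def by auto
  then show ?case using step by simp
qed simp

lemma part_weights_nonneg: "part_weights x \<Longrightarrow> x i \<ge> 0"
  unfolding part_weights_def by (cases i) auto

lemma part_weights_tendsto_0: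
  assumes "part_weights x"
  shows "(\<lambda>i. x (Suc i)) \<longlonglongrightarrow> 0"
  using assms summable_LIMSEQ_zero unfolding part_weights_def by blast

text \<open>From the threshold 2 on, both rounding rules agree with x i * n up to one vertex. Below
  it, a class may be empty for x 0 \<noteq> 0 although it would be rounded for x 0 = 0.\<close>

lemma realisation_part_size:
  assumes "realisation_parts n x V" "part_weights x" "i \<ge> 1" "x i * real n \<ge> 2"
  shows "\<bar>real (card (V i)) - x i * real n\<bar> \<le> 1"
proof (cases "x 0 = 0")
  case True
  then have "\<bar>real (card (V i)) - x i * real n\<bar> < 1" using assms unfolding realisation_parts_def by auto
  then show ?thesis by simp
next
  case False
  then have "int (card (V i)) = \<lfloor>x i * real n\<rfloor>" using assms unfolding realisation_parts_def by auto
  then have "real (card (V i)) = of_int \<lfloor>x i * real n\<rfloor>" by (metis of_int_of_nat_eq)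
  then show ?thesis by linarith
qed

text \<open>Weight 0 leaves no room for a vertex: for x 0 = 0 the class has fewer than one vertex,
  otherwise it falls below the threshold. So every class that occurs has linear size once the
  positive weights are bounded below.\<close>

lemma realisation_part_pos:
  assumes "realisation_parts n x V" "part_weights x" "i \<ge> 1" "V i \<noteq> {}"
  shows "x i > 0" "real (card (V i)) \<ge> x i * real n - 1"
proof -
  have fin: "finite (V i)" using finite_subset[OF realisation_part_subset[OF assms(1)]] by simp
  then have c: "real (card (V i)) \<ge> 1" using assms(4) by (simp add: Suc_le_eq card_gt_0_iff)
  have "x i > 0 \<and> real (card (V i)) \<ge> x i * real n - 1"
  proof (cases "x 0 = 0")
    case True
    then have *: "\<bar>real (card (V i)) - x i * real n\<bar> < 1" using assms unfolding realisation_parts_def by auto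
    then have "x i * real n > 0" using c by linarith
    then have "x i > 0" using zero_less_mult_pos2 part_weights_nonneg[OF assms(2), of i] by (simp add: zero_less_mult_iff)
    then show ?thesis using * by linarith
  next
    case False
    then have 2: "x i * real n \<ge> 2" using assms unfolding realisation_parts_def by auto
    then have "x i * real n > 0" by linarith
    then have "x i > 0" using part_weights_nonneg[OF assms(2), of i] by (simp add: zero_less_mult_iff)
    then show ?thesis using realisation_part_size[OF assms(1-3) 2] by linarith
  qed
  then show "x i > 0" "real (card (V i)) \<ge> x i * real n - 1" by auto
qed

section \<open>Realisations satisfying (i) and (ii) are good colourings\<close>

lemma pow_le_choose:
  assumes "1 \<le> j" "j \<le> k" "k \<le> n"
  shows "real n ^ j / real k ^ k \<le> real (n choose j)"
proof -
  have "real j ^ j \<le> real k ^ j" using assms by (intro power_mono) auto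
  also have "\<dots> \<le> real k ^ k" using assms by (intro power_increasing) auto
  finally have "real n ^ j / real k ^ k \<le> real n ^ j / real j ^ j"
    using assms by (intro divide_left_mono) auto
  also have "\<dots> = (real n / real j) ^ j" by (simp add: power_divide)
  also have "\<dots> \<le> real (n choose j)" using assms by (intro binomial_ge_n_over_k_pow_k) auto
  finally show ?thesis .
qed

text \<open>A single weight sequence with (i) and (ii) in force for its realisations. These live on
  {1..n}, so 0 can always play the new vertex of (ii).\<close>

locale strict_realisations = bounded_invariant +
  fixes x :: "nat \<Rightarrow> real" and V :: "nat \<Rightarrow> nat \<Rightarrow> nat set" and c :: real and N0 :: nat
  assumes x: "part_weights x" and V: "\<And>n. realisation_parts n x (V n)" and c_pos: "c > 0"
    and strict1: "\<And>n a b. n \<ge> N0 \<Longrightarrow> a \<in> {1..n} \<Longrightarrow> b \<in> {1..n} \<Longrightarrow> a \<noteq> b \<Longrightarrow>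
      lam k \<gamma> (realisation_graph n (V n)) - lam k \<gamma> (flip (realisation_graph n (V n)) a b) \<ge> c / real n ^ 2"
    and strict2: "\<And>n N. n \<ge> N0 \<Longrightarrow> N \<subseteq> {1..n} \<Longrightarrow> (\<forall>i\<ge>1. V n i \<subseteq> N \<or> V n i \<inter> N = {}) \<Longrightarrow>
      real (edits_to_clone (realisation_graph n (V n)) (V n 0) N)
        \<le> real n * (lam k \<gamma> (realisation_graph n (V n)) - lam_at k \<gamma> (add_vertex (realisation_graph n (V n)) 0 N) 0) / c"
begin

abbreviation g :: "nat \<Rightarrow> nat \<Rightarrow> nat" where "g n \<equiv> part_index (V n)"
abbreviation R :: "nat \<Rightarrow> ugraph" where "R n \<equiv> cgraph {1..n} (g n)"

text \<open>The factor comes from \<open>pow_le_choose\<close>, when densities are multiplied by a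
  binomial coefficient.\<close>

definition \<kappa> :: real where "\<kappa> = c / real k ^ k"

lemma \<kappa>_pos: "\<kappa> > 0" using c_pos k3 by (simp add: \<kappa>_def)

lemma real_R: "realisation_graph n (V n) = R n"
  by (rule realisation_graph_cgraph[OF V])

lemma flip_loss_R:
  assumes "n \<ge> N0" "n \<ge> k" "a \<in> {1..n}" "b \<in> {1..n}" "a \<noteq> b"
  shows "Lam k \<gamma> (R n) - Lam k \<gamma> (flip (R n) a b) \<ge> \<kappa> * Q n"
proof -
  let ?C = "real (n choose k)"
  have C: "?C > 0" using assms by simp
  have "Lam k \<gamma> (R n) - Lam k \<gamma> (flip (R n) a b) = ?C * (lam k \<gamma> (R n) - lam k \<gamma> (flip (R n) a b))"
    using C by (simp add: lam_def order_def field_simps)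
  moreover have "?C * (lam k \<gamma> (R n) - lam k \<gamma> (flip (R n) a b)) \<ge> ?C * (c / real n ^ 2)"
    using strict1[OF assms(1,3-5)] unfolding real_R by (intro mult_left_mono) auto
  moreover have "?C * (c / real n ^ 2) \<ge> real n ^ k / real k ^ k * (c / real n ^ 2)"
    using pow_le_choose[of k k n] k3 assms c_pos by (intro mult_right_mono) auto
  moreover have "real n ^ k / real k ^ k * (c / real n ^ 2) = \<kappa> * Q n" by (simp add: \<kappa>_def Qn_def)
  ultimately show ?thesis by linarith
qed

lemma clone_loss_R:
  assumes n: "n \<ge> N0" "n \<ge> k" and N: "N \<subseteq> {1..n}"
    and closed: "\<And>a b. a \<in> {1..n} \<Longrightarrow> b \<in> {1..n} \<Longrightarrow> g n a \<noteq> 0 \<Longrightarrow> g n a = g n b \<Longrightarrow> a \<in> N \<Longrightarrow> b \<in> N"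
  shows "\<exists>u\<in>{1..n}. \<kappa> * real (card (sym_diff N (cnb {1..n} (g n) (g n u)))) * Q n
    \<le> lam k \<gamma> (R n) * real (n choose (k - 1)) - rsum (edges (R n)) N {1..n}"
proof -
  let ?S = "{card (sym_diff N N') | N'. \<exists>u\<in>verts (R n). is_clone (R n) (V n 0) N' u}"
  have clone: "N' = cnb {1..n} (g n) (g n u)" if "is_clone (R n) (V n 0) N' u" "u \<in> {1..n}" for N' u
  proof (cases "u \<in> V n 0")
    case True
    then have "g n u = 0" using part_index_iff[OF V that(2)] by simp
    then show ?thesis using that True by (auto simp: is_clone_def cnb_def)
  next
    case False
    then have "g n u \<noteq> 0" using part_index_iff[OF V that(2)] by simp
    then show ?thesis using that False nbhd_cgraph[OF that(2), of "g n"] by (auto simp: is_clone_def cnb_def)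
  qed
  have "?S \<subseteq> (\<lambda>u. card (sym_diff N (cnb {1..n} (g n) (g n u)))) ` {1..n}"
  proof
    fix s assume "s \<in> ?S"
    then obtain N' u where s: "s = card (sym_diff N N')" "u \<in> {1..n}" "is_clone (R n) (V n 0) N' u" by auto
    then show "s \<in> (\<lambda>u. card (sym_diff N (cnb {1..n} (g n) (g n u)))) ` {1..n}"
      unfolding s(1) clone[OF s(3,2)] by (intro imageI)
  qed
  note sub = this
  then have finS: "finite ?S" by (rule finite_subset) simp
  \<comment> \<open>The minimum of an empty set would carry no information; a clone of vertex 1
    shows that there is a candidate.\<close>
  have "1 \<in> verts (R n)" using n k3 by simp
  moreover have "is_clone (R n) (V n 0) (if 1 \<in> V n 0 then verts (R n) else nbhd (R n) 1) 1"
    by (simp add: is_clone_def)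
  ultimately have neS: "?S \<noteq> {}" by blast
  have "Min ?S \<in> (\<lambda>u. card (sym_diff N (cnb {1..n} (g n) (g n u)))) ` {1..n}"
    using Min_in[OF finS neS] sub by blast
  then obtain u where u: "u \<in> {1..n}" "edits_to_clone (R n) (V n 0) N = card (sym_diff N (cnb {1..n} (g n) (g n u)))"
    unfolding edits_to_clone_def by (elim imageE)
  let ?d = "real (card (sym_diff N (cnb {1..n} (g n) (g n u))))" and ?C = "real (n choose (k - 1))"
  have C: "?C > 0" using n by simp
  have "V n i \<subseteq> N \<or> V n i \<inter> N = {}" if i: "i \<ge> 1" for i
  proof (rule ccontr)
    assume "\<not> ?thesis"
    then obtain a b where ab: "a \<in> V n i" "a \<in> N" "b \<in> V n i" "b \<notin> N" by blast
    then have "a \<in> {1..n}" "b \<in> {1..n}" using realisation_part_subset[OF V] by blast+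
    moreover from this have "g n a = i" "g n b = i" using ab part_index_iff[OF V] by blast+
    ultimately show False using closed[of a b] ab i by auto
  qed
  then have e: "?d \<le> real n * (lam k \<gamma> (R n) - lam_at k \<gamma> (add_vertex (R n) 0 N) 0) / c"
    using strict2[OF n(1) N] u(2) unfolding real_R by simp
  have "Lam_at k \<gamma> (add_vertex (R n) 0 N) 0 = rsum (edges (R n)) N {1..n}"
    using Lam_at_add_vertex[OF is_graph_cgraph, of "{1..n}" 0 "g n" N] N by simp
  then have "lam_at k \<gamma> (add_vertex (R n) 0 N) 0 = rsum (edges (R n)) N {1..n} / ?C"
    by (simp add: lam_at_def order_def)
  then have "?d \<le> real n * (lam k \<gamma> (R n) - rsum (edges (R n)) N {1..n} / ?C) / c" using e by simp
  then have "c * ?d / real n \<le> lam k \<gamma> (R n) - rsum (edges (R n)) N {1..n} / ?C"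
    using c_pos n k3 by (simp add: pos_le_divide_eq pos_divide_le_eq mult_ac)
  then have "?C * (c * ?d / real n) \<le> ?C * (lam k \<gamma> (R n) - rsum (edges (R n)) N {1..n} / ?C)"
    by (intro mult_left_mono) auto
  also have "\<dots> = lam k \<gamma> (R n) * ?C - rsum (edges (R n)) N {1..n}" using C by (simp add: field_simps)
  finally have "?C * (c * ?d / real n) \<le> lam k \<gamma> (R n) * ?C - rsum (edges (R n)) N {1..n}" .
  moreover have "real n ^ (k - 1) / real k ^ k * (c * ?d / real n) \<le> ?C * (c * ?d / real n)"
    using pow_le_choose[of "k - 1" k n] k3 n c_pos by (intro mult_right_mono) auto
  moreover have "real n ^ (k - 1) / real k ^ k * (c * ?d / real n) = \<kappa> * ?d * Q n"
  proof -
    have "k = (k - 1) + 1" using k3 by simp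
    then have "real n ^ k = real n ^ (k - 1) * real n" by (metis power_add power_one_right)
    then have "Q n = real n ^ (k - 1) / real n" using n k3 by (simp add: Qn_def power2_eq_square)
    then show ?thesis by (simp add: \<kappa>_def)
  qed
  ultimately show ?thesis using u(1) by (intro bexI[of _ u]) linarith+
qed

text \<open>Infinitely many positive weights would tend to 0. Two of them with consecutive indices
  then give classes with enough vertices for \<open>two_small_classes\<close> but with too small a
  union.\<close>

lemma finite_support: "\<exists>t. \<forall>i>t. x i = 0"
proof (rule ccontr)
  assume nt: "\<nexists>t. \<forall>i>t. x i = 0"
  have pos: "x i > 0" if "i \<ge> 1" for i
  proof -
    obtain j where "j > i" "x j \<noteq> 0" using nt by blast
    then have "x j > 0" using part_weights_nonneg[OF x, of j] by simp
    then show ?thesis using part_weights_antimono[OF x that, of j] \<open>j > i\<close> by simp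
  qed
  \<comment> \<open>Two classes of weight below \<epsilon> have at most 2 \<epsilon> n + 2 \<le> 4
    \<epsilon> n vertices, which turns the right side of \<open>two_small_classes\<close> into
    \<kappa> n / 2.\<close>
  define \<epsilon> where "\<epsilon> = \<kappa> / (16 * M)"
  have \<epsilon>: "\<epsilon> > 0" using \<kappa>_pos M_pos by (simp add: \<epsilon>_def)
  obtain m where "\<forall>i\<ge>m. norm (x (Suc i) - 0) < \<epsilon>"
    using LIMSEQ_D[OF part_weights_tendsto_0[OF x] \<epsilon>] by blast
  then have small: "x (Suc m) < \<epsilon>" "x (Suc (Suc m)) < \<epsilon>"
    using part_weights_nonneg[OF x] by (auto dest: spec[of _ m] spec[of _ "Suc m"])
  let ?i = "Suc m" and ?j = "Suc (Suc m)"
  obtain N1 where N1: "\<And>n. n \<ge> N1 \<Longrightarrow> 3 \<le> x ?i * real n" using eventually_le_mult[OF pos[of ?i]] by auto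
  obtain N2 where N2: "\<And>n. n \<ge> N2 \<Longrightarrow> 3 \<le> x ?j * real n" using eventually_le_mult[OF pos[of ?j]] by auto
  obtain N3 where N3: "\<And>n. n \<ge> N3 \<Longrightarrow> 1 \<le> \<epsilon> * real n" using eventually_le_mult[OF \<epsilon>] by auto
  define n where "n = Max {N0, N1, N2, N3, k}"
  have n: "n \<ge> N0" "n \<ge> N1" "n \<ge> N2" "n \<ge> N3" "n \<ge> k" by (simp_all add: n_def)
  have n0: "n > 0" using n k3 by simp
  have si: "\<bar>real (card (V n ?i)) - x ?i * real n\<bar> \<le> 1"
    using realisation_part_size[OF V x, of ?i n] N1[OF n(2)] by simp
  have sj: "\<bar>real (card (V n ?j)) - x ?j * real n\<bar> \<le> 1"
    using realisation_part_size[OF V x, of ?j n] N2[OF n(3)] by simp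
  have "card (V n ?i) \<ge> 2" using si N1[OF n(2)] by linarith
  then obtain T where "T \<subseteq> V n ?i" "card T = 2" by (meson obtain_subset_with_card_n)
  then obtain a b where ab: "a \<in> V n ?i" "b \<in> V n ?i" "a \<noteq> b" by (auto simp: card_2_iff)
  have "card (V n ?j) \<noteq> 0" using sj N2[OF n(3)] by linarith
  then obtain d where d: "d \<in> V n ?j" by fastforce
  have W: "a \<in> {1..n}" "b \<in> {1..n}" "d \<in> {1..n}" using ab d realisation_part_subset[OF V] by blast+
  then have gs: "g n a = ?i" "g n b = ?i" "g n d = ?j" using ab d part_index_iff[OF V] by blast+
  have "a \<noteq> d" using gs by auto
  have "\<kappa> * real n \<le> 2 * M * real (card {w \<in> {1..n}. g n w = ?i \<or> g n w = ?j})"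
    using two_small_classes[OF n0 W ab(3) gs _ _ _ flip_loss_R[OF n(1,5) W(1,2) ab(3)] flip_loss_R[OF n(1,5) W(1,3) \<open>a \<noteq> d\<close>]]
    by simp
  moreover have "{w \<in> {1..n}. g n w = ?i \<or> g n w = ?j} = V n ?i \<union> V n ?j"
    using part_index_class[OF V, of n ?i] part_index_class[OF V, of n ?j] by blast
  moreover have "real (card (V n ?i \<union> V n ?j)) \<le> 4 * (\<epsilon> * real n)"
  proof -
    have "x ?i * real n \<le> \<epsilon> * real n" "x ?j * real n \<le> \<epsilon> * real n" using small by (auto intro: mult_right_mono)
    then show ?thesis using card_Un_le[of "V n ?i" "V n ?j"] si sj N3[OF n(4)] by linarith
  qed
  then have "2 * M * real (card (V n ?i \<union> V n ?j)) \<le> 2 * M * (4 * (\<epsilon> * real n))"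
    using M_pos by (intro mult_left_mono) auto
  ultimately have "\<kappa> * real n \<le> 2 * M * (4 * (\<epsilon> * real n))" by (simp only:)
  also have "\<dots> = \<kappa> / 2 * real n" using M_pos by (simp add: \<epsilon>_def)
  finally show False using \<kappa>_pos n0 by simp
qed

lemma good_colouring_R: "\<exists>\<beta>>0. \<exists>N. \<forall>n\<ge>N. good_colouring k \<gamma> M \<kappa> \<beta> n (g n)"
proof -
  obtain t where t: "\<And>i. i > t \<Longrightarrow> x i = 0" using finite_support by blast
  let ?P = "{x i | i. i \<le> t \<and> x i > 0}"
  have finP: "finite ?P" by simp
  \<comment> \<open>Half of the least positive weight, x 0 included, so that the other half absorbs
    a rounding loss of one vertex. The inserted 1 makes the minimum meaningful in any case.\<close>
  define \<beta> where "\<beta> = Min (insert 1 ?P) / 2"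
  have \<beta>: "\<beta> > 0" using finP unfolding \<beta>_def by auto
  have \<beta>x: "2 * \<beta> \<le> x i" if "x i > 0" for i
  proof -
    have "i \<le> t" using t[of i] that by (cases "i \<le> t") auto
    then show ?thesis using finP that unfolding \<beta>_def by (auto intro: Min_le)
  qed
  obtain N1 where N1: "\<And>n. n \<ge> N1 \<Longrightarrow> 1 \<le> \<beta> * real n" using eventually_le_mult[OF \<beta>] by blast
  have "good_colouring k \<gamma> M \<kappa> \<beta> n (g n)" if n: "n \<ge> Max {N0, N1, k}" for n
  proof unfold_locales
    have n': "n \<ge> N0" "n \<ge> N1" "n \<ge> k" using n by simp_all
    show "\<kappa> > 0" by (rule \<kappa>_pos)
    show "\<beta> > 0" by (rule \<beta>)
    show "n \<ge> k" by (rule n')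
    show "\<kappa> * Q n \<le> Lam k \<gamma> (R n) - Lam k \<gamma> (flip (R n) a b)" if "a \<in> {1..n}" "b \<in> {1..n}" "a \<noteq> b" for a b
      using flip_loss_R[OF n'(1,3) that] .
    show "\<exists>u\<in>{1..n}. \<kappa> * real (card (sym_diff N (cnb {1..n} (g n) (g n u)))) * Q n
      \<le> lam k \<gamma> (R n) * real (n choose (k - 1)) - rsum (edges (R n)) N {1..n}"
      if "N \<subseteq> {1..n}" "\<And>a b. a \<in> {1..n} \<Longrightarrow> b \<in> {1..n} \<Longrightarrow> g n a \<noteq> 0 \<Longrightarrow> g n a = g n b \<Longrightarrow> a \<in> N \<Longrightarrow> b \<in> N" for N
      using clone_loss_R[OF n'(1,3) that(1)] that(2) by blast
    show "\<beta> * real n \<le> real (card {b \<in> {1..n}. g n b = g n a})" if a: "a \<in> {1..n}" for a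
    proof (cases "g n a = 0")
      case False
      have "a \<in> V n (g n a)" by (rule part_index_mem[OF V a])
      then have "V n (g n a) \<noteq> {}" by auto
      then have "x (g n a) > 0" "real (card (V n (g n a))) \<ge> x (g n a) * real n - 1"
        using realisation_part_pos[OF V x, of "g n a" n] False by auto
      moreover from this have "2 * \<beta> * real n \<le> x (g n a) * real n" by (intro mult_right_mono \<beta>x) auto
      ultimately show ?thesis using N1[OF n'(2)] unfolding part_index_class[OF V] by linarith
    next
      case True
      then have "a \<in> V n 0" using part_index_iff[OF V a] by simp
      then have x0: "x 0 \<noteq> 0" using V[of n] unfolding realisation_parts_def by (auto split: if_splits)
      then have x0': "x 0 > 0" using part_weights_nonneg[OF x, of 0] by simp
      \<comment> \<open>For x 0 \<noteq> 0 every other class is rounded down or emptied, so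
        \<open>V n 0\<close> receives at least its full share x 0 * n.\<close>
      have le: "real (card (V n i)) \<le> x i * real n" if "i \<ge> 1" for i
      proof (cases "x i * real n \<ge> 2")
        case True
        then have "int (card (V n i)) = \<lfloor>x i * real n\<rfloor>" using V[of n] x0 that unfolding realisation_parts_def by auto
        then have "real (card (V n i)) = of_int \<lfloor>x i * real n\<rfloor>" by (metis of_int_of_nat_eq)
        then show ?thesis by linarith
      next
        case False
        then have "V n i = {}" using V[of n] x0 that unfolding realisation_parts_def by auto
        then show ?thesis using part_weights_nonneg[OF x, of i] by simp
      qed
      have empty: "V n i = {}" if "i > t" "i \<ge> 1" for i
      proof -
        have "finite (V n i)" using finite_subset[OF realisation_part_subset[OF V]] by simp
        moreover have "card (V n i) = 0" using le[OF that(2)] t[OF that(1)] by simp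
        ultimately show ?thesis by simp
      qed
      have "{1..n} \<subseteq> V n 0 \<union> (\<Union>i<t. V n (Suc i))"
      proof
        fix w assume "w \<in> {1..n}"
        then obtain i where i: "w \<in> V n i" using part_index_iff[OF V] by blast
        show "w \<in> V n 0 \<union> (\<Union>i<t. V n (Suc i))"
        proof (cases i)
          case (Suc j)
          then have "i \<le> t" using empty[of i] i by (cases "i \<le> t") auto
          then show ?thesis using i Suc by auto
        qed (use i in auto)
      qed
      moreover have fin: "finite (V n i)" for i using finite_subset[OF realisation_part_subset[OF V]] by simp
      ultimately have "card {1..n} \<le> card (V n 0 \<union> (\<Union>i<t. V n (Suc i)))" by (intro card_mono) auto
      also have "\<dots> \<le> card (V n 0) + card (\<Union>i<t. V n (Suc i))" by (rule card_Un_le)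
      also have "card (\<Union>i<t. V n (Suc i)) \<le> (\<Sum>i<t. card (V n (Suc i)))" by (rule card_UN_le) simp
      finally have "real n \<le> real (card (V n 0)) + (\<Sum>i<t. real (card (V n (Suc i))))"
        by (simp flip: of_nat_sum)
      also have "(\<Sum>i<t. real (card (V n (Suc i)))) \<le> (\<Sum>i<t. x (Suc i) * real n)"
        using le by (intro sum_mono) auto
      also have "\<dots> = (\<Sum>i<t. x (Suc i)) * real n" by (simp add: sum_distrib_right)
      also have "(\<Sum>i<t. x (Suc i)) \<le> (\<Sum>i. x (Suc i))"
        using x part_weights_nonneg[OF x] unfolding part_weights_def by (intro sum_le_suminf) auto
      also have "(\<Sum>i. x (Suc i)) = 1 - x 0" using x by (simp add: part_weights_def)
      finally have "x 0 * real n \<le> real (card (V n 0))" by (simp add: algebra_simps mult_right_mono)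
      moreover have "2 * \<beta> * real n \<le> x 0 * real n" using \<beta>x[OF x0'] by (intro mult_right_mono) auto
      moreover have "\<beta> * real n \<ge> 0" using \<beta> by simp
      ultimately show ?thesis unfolding True part_index_class[OF V] by linarith
    qed
  qed
  then show ?thesis using \<beta> by blast
qed

end

subsection \<open>Comparing colourings\<close>

lemma sum_card_classes:
  assumes "finite W" "f ` W \<subseteq> {..t::nat}"
  shows "(\<Sum>i\<le>t. card {v \<in> W. f v = i}) = card W"
  using sum.group[OF assms(1) finite_atMost assms(2), of "\<lambda>_. 1::nat"] by simp

text \<open>In each colour as many vertices as possible are matched, and the leftovers are matched
  arbitrarily. The size of colour 0 is determined by the others, hence off by at most t d; the
  colours 1 to t contribute another t d.\<close>

lemma match_colourings:
  assumes W: "finite W" and f: "f ` W \<subseteq> {..t::nat}" and g: "g ` W \<subseteq> {..t}"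
    and d: "\<And>i. 1 \<le> i \<Longrightarrow> i \<le> t \<Longrightarrow> \<bar>real (card {v \<in> W. f v = i}) - real (card {v \<in> W. g v = i})\<bar> \<le> d" "d \<ge> 0"
  obtains \<sigma> where "bij_betw \<sigma> W W" "real (card {v \<in> W. f v \<noteq> g (\<sigma> v)}) \<le> 2 * real t * d"
proof -
  let ?F = "\<lambda>i. {v \<in> W. f v = i}" and ?G = "\<lambda>i. {v \<in> W. g v = i}"
  let ?m = "\<lambda>i. min (card (?F i)) (card (?G i))"
  have "\<forall>i. \<exists>T. fst T \<subseteq> ?F i \<and> fst (snd T) \<subseteq> ?G i \<and> card (fst T) = ?m i \<and> bij_betw (snd (snd T)) (fst T) (fst (snd T))"
  proof
    fix i
    obtain A where A: "A \<subseteq> ?F i" "card A = ?m i" "finite A" by (rule obtain_subset_with_card_n[of "?m i" "?F i"]) auto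
    obtain B where B: "B \<subseteq> ?G i" "card B = ?m i" "finite B" by (rule obtain_subset_with_card_n[of "?m i" "?G i"]) auto
    obtain \<tau> where "bij_betw \<tau> A B" using finite_same_card_bij[OF A(3) B(3)] A(2) B(2) by auto
    then show "\<exists>T. fst T \<subseteq> ?F i \<and> fst (snd T) \<subseteq> ?G i \<and> card (fst T) = ?m i \<and> bij_betw (snd (snd T)) (fst T) (fst (snd T))"
      using A B by (intro exI[of _ "(A, B, \<tau>)"]) simp
  qed
  then obtain T where T: "\<forall>i. fst (T i) \<subseteq> ?F i \<and> fst (snd (T i)) \<subseteq> ?G i \<and> card (fst (T i)) = ?m i \<and>
      bij_betw (snd (snd (T i))) (fst (T i)) (fst (snd (T i)))"
    by (rule choice[THEN exE])
  define A B \<tau> where "A i = fst (T i)" and "B i = fst (snd (T i))" and "\<tau> i = snd (snd (T i))" for i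
  have AB: "A i \<subseteq> ?F i" "B i \<subseteq> ?G i" "card (A i) = ?m i" "bij_betw (\<tau> i) (A i) (B i)" for i
    using T unfolding A_def B_def \<tau>_def by blast+
  define U where "U = (\<Union>i\<in>{..t}. A i)"
  define U' where "U' = (\<Union>i\<in>{..t}. B i)"
  have UW: "U \<subseteq> W" "U' \<subseteq> W" using AB(1,2) unfolding U_def U'_def by blast+
  have fA: "f v = i" if "v \<in> A i" for v i using AB(1)[of i] that by auto
  have bU: "bij_betw (\<lambda>v. \<tau> (f v) v) U U'"
    unfolding U_def U'_def
  proof (rule bij_betw_UNION_disjoint)
    show "disjoint_family_on B {..t}" using AB(2) unfolding disjoint_family_on_def by blast
    show "bij_betw (\<lambda>v. \<tau> (f v) v) (A i) (B i)" for i
      using AB(4)[of i] fA by (simp cong: bij_betw_cong)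
  qed
  have finU: "finite U" "finite U'" using UW W finite_subset by auto
  have "card (W - U) = card (W - U')"
    using bij_betw_same_card[OF bU] UW finU by (simp add: card_Diff_subset)
  then obtain \<rho> where \<rho>: "bij_betw \<rho> (W - U) (W - U')"
    using finite_same_card_bij[of "W - U" "W - U'"] W by auto
  define \<sigma> where "\<sigma> v = (if v \<in> U then \<tau> (f v) v else \<rho> v)" for v
  have "bij_betw \<sigma> (U \<union> (W - U)) (U' \<union> (W - U'))"
    unfolding \<sigma>_def by (rule bij_betw_disjoint_Un[OF bU \<rho>]) auto
  moreover have "U \<union> (W - U) = W" "U' \<union> (W - U') = W" using UW by auto
  ultimately have \<sigma>: "bij_betw \<sigma> W W" by simp
  have "{v \<in> W. f v \<noteq> g (\<sigma> v)} \<subseteq> W - U"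
  proof
    fix v assume v: "v \<in> {v \<in> W. f v \<noteq> g (\<sigma> v)}"
    have "v \<notin> U"
    proof
      assume "v \<in> U"
      then obtain i where i: "v \<in> A i" by (auto simp: U_def)
      then have "\<tau> i v \<in> B i" using AB(4)[of i] by (auto simp: bij_betw_def)
      then have "g (\<tau> i v) = i" using AB(2) by auto
      then show False using v fA[OF i] \<open>v \<in> U\<close> by (simp add: \<sigma>_def)
    qed
    then show "v \<in> W - U" using v by simp
  qed
  then have "card {v \<in> W. f v \<noteq> g (\<sigma> v)} \<le> card (W - U)" using W by (intro card_mono) auto
  also have "card (W - U) = card W - card U" using UW finU by (simp add: card_Diff_subset)
  finally have le: "real (card {v \<in> W. f v \<noteq> g (\<sigma> v)}) \<le> real (card W) - real (card U)"
    using card_mono[OF W UW(1)] by linarith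
  have "card U = (\<Sum>i\<le>t. card (A i))"
    unfolding U_def
  proof (rule card_UN_disjoint)
    show "\<forall>i\<in>{..t}. finite (A i)" using finite_subset[OF AB(1)] W by simp
    show "\<forall>i\<in>{..t}. \<forall>j\<in>{..t}. i \<noteq> j \<longrightarrow> A i \<inter> A j = {}" using fA by blast
  qed simp
  then have cU: "real (card U) = (\<Sum>i\<le>t. real (?m i))" using AB(3) by simp
  have sF: "(\<Sum>i\<le>t. real (card (?F i))) = real (card W)" and sG: "(\<Sum>i\<le>t. real (card (?G i))) = real (card W)"
    using sum_card_classes[OF W f] sum_card_classes[OF W g] by (metis of_nat_sum)+
  have split: "(\<Sum>i\<le>t. h i) = h 0 + (\<Sum>i=1..t. h i)" for h :: "nat \<Rightarrow> real"
    by (simp add: atMost_atLeast0 sum.atLeast_Suc_atMost)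
  have "(\<Sum>i=1..t. real (card (?G i)) - real (card (?F i))) \<le> (\<Sum>i=1..t. d)"
    using d(1) by (intro sum_mono) (auto simp: abs_le_iff)
  then have "real (card (?F 0)) - real (card (?G 0)) \<le> real t * d"
    using sF sG unfolding split[of "\<lambda>i. real (card (?F i))"] split[of "\<lambda>i. real (card (?G i))"] sum_subtractf by simp
  then have z: "real (card (?F 0)) - real (?m 0) \<le> real t * d" using d(2) by (auto simp: min_def)
  have "real (card (?F i)) - real (?m i) \<le> d" if "i \<in> {1..t}" for i
    using d(1)[of i] d(2) that by (auto simp: min_def)
  then have "(\<Sum>i=1..t. real (card (?F i)) - real (?m i)) \<le> (\<Sum>i=1..t. d)" by (rule sum_mono)
  then have "real (card W) - real (card U) \<le> 2 * real t * d"
    using z sF unfolding cU split[of "\<lambda>i. real (card (?F i))"] split[of "\<lambda>i. real (?m i)"] sum_subtractf by simp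
  then show ?thesis using that[OF \<sigma>] le by linarith
qed

text \<open>Replaces the sorted multiset of sizes behind \<open>nth_largest\<close> by an
  enumeration of the parts themselves, so that sizes can be tied to vertices.\<close>

lemma nth_largest_enum:
  assumes "finite P"
  obtains A where "bij_betw A {1..card P} P" "\<And>i. i \<in> {1..card P} \<Longrightarrow> card (A i) = nth_largest P i"
    "\<And>i j. 1 \<le> i \<Longrightarrow> i \<le> j \<Longrightarrow> nth_largest P j \<le> nth_largest P i"
proof -
  obtain l where l: "set l = P" "distinct l" using finite_distinct_list[OF assms] by blast
  define ys where "ys = rev (sort_key card l)"
  have ys: "set ys = P" "distinct ys" "length ys = card P"
    using l distinct_card[OF l(2)] by (simp_all add: ys_def)
  have "sorted_list_of_multiset (image_mset card (mset_set P)) = map card (sort_key card l)"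
  proof -
    have "image_mset card (mset_set P) = mset (map card (sort_key card l))"
      using mset_set_set[OF l(2)] l(1) by simp
    then have "sorted_list_of_multiset (image_mset card (mset_set P)) = sort (map card (sort_key card l))"
      by (simp only: sorted_list_of_multiset_mset)
    also have "\<dots> = map card (sort_key card l)" by (rule sorted_sort_id) simp
    finally show ?thesis .
  qed
  then have L: "rev (sorted_list_of_multiset (image_mset card (mset_set P))) = map card ys"
    by (simp add: ys_def rev_map)
  have nth: "nth_largest P i = card (ys ! (i - 1))" if "i \<in> {1..card P}" for i
    unfolding nth_largest_def L using that ys(3) by auto
  have "bij_betw (\<lambda>i. i - 1) {1..card P} {..<card P}"
    by (rule bij_betwI[of _ _ _ Suc]) auto
  moreover have "bij_betw ((!) ys) {..<card P} P" by (rule bij_betw_nth) (simp_all add: ys)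
  ultimately have "bij_betw ((!) ys \<circ> (\<lambda>i. i - 1)) {1..card P} P" by (rule bij_betw_trans)
  then have bij: "bij_betw (\<lambda>i. ys ! (i - 1)) {1..card P} P" by (simp add: comp_def)
  have sorted: "sorted (rev (map card ys))" by (simp add: ys_def rev_map)
  have mono: "nth_largest P j \<le> nth_largest P i" if ij: "1 \<le> i" "i \<le> j" for i j
  proof (cases "j \<le> card P")
    case True
    have "map card ys ! (j - 1) \<le> map card ys ! (i - 1)"
      using sorted_rev_nth_mono[OF sorted, of "i - 1" "j - 1"] ij True ys(3) by simp
    then show ?thesis using nth[of i] nth[of j] ij True ys(3) by simp
  qed (simp add: nth_largest_def)
  show ?thesis by (rule that[OF bij _ mono]) (use nth in auto)
qed

text \<open>Keeps every partial sum of limiting part weights at most 1.\<close>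

lemma sum_nth_largest_le:
  assumes V: "finite V" and P: "partition_on V P"
  shows "(\<Sum>i<t. nth_largest P (Suc i)) \<le> card V"
proof -
  have finP: "finite P" using finite_elements[OF V P] .
  obtain A where A: "bij_betw A {1..card P} P" "\<And>i. i \<in> {1..card P} \<Longrightarrow> card (A i) = nth_largest P i"
    using nth_largest_enum[OF finP] by metis
  have "(\<Sum>i<t. nth_largest P (Suc i)) = (\<Sum>i=1..t. nth_largest P i)"
    by (rule sum.reindex_bij_witness[of _ "\<lambda>i. i - 1" Suc]) auto
  also have "\<dots> \<le> (\<Sum>i\<in>{1..t} \<union> {1..card P}. nth_largest P i)" by (rule sum_mono2) auto
  also have "\<dots> = (\<Sum>i\<in>{1..card P}. nth_largest P i)"
    by (rule sum.mono_neutral_right) (auto simp: nth_largest_def)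
  also have "\<dots> = (\<Sum>i\<in>{1..card P}. card (A i))" using A(2) by simp
  also have "\<dots> = (\<Sum>p\<in>P. card p)" by (rule sum.reindex_bij_betw[OF A(1)])
  also have "\<dots> = card (\<Union>P)"
  proof (rule card_Union_disjoint[symmetric])
    show "disjoint P" using P by (rule partition_onD2)
    show "finite p" if "p \<in> P" for p
    proof (rule finite_subset[OF _ V])
      show "p \<subseteq> V" using partition_onD1[OF P] that by blast
    qed
  qed
  also have "\<dots> = card V" using P by (simp add: partition_on_def)
  finally show ?thesis .
qed

text \<open>The two graphs differ only in pairs inside a part that is not among the \<open>t\<close> largest.\<close>

lemma colour_largest_parts:
  assumes G: "is_graph G" "partite_sets G P"
  obtains h where "h ` verts G \<subseteq> {..t}" "\<And>i. 1 \<le> i \<Longrightarrow> i \<le> t \<Longrightarrow> card {v \<in> verts G. h v = i} = nth_largest P i"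
    "card (sym_diff (edges G) (edges (cgraph (verts G) h))) \<le> card (verts G) * nth_largest P (Suc t)"
proof -
  let ?W = "verts G"
  have W: "finite ?W" using is_graph_finite[OF G(1)] .
  have P: "partition_on ?W P" and E: "edges G = {{x, y} | x y. \<exists>A\<in>P. \<exists>B\<in>P. A \<noteq> B \<and> x \<in> A \<and> y \<in> B}"
    using G(2) by (auto simp: partite_sets_def)
  have finP: "finite P" using finite_elements[OF W P] .
  obtain A where A: "bij_betw A {1..card P} P" "\<And>i. i \<in> {1..card P} \<Longrightarrow> card (A i) = nth_largest P i"
    "\<And>i j. 1 \<le> i \<Longrightarrow> i \<le> j \<Longrightarrow> nth_largest P j \<le> nth_largest P i"
    using nth_largest_enum[OF finP] by metis
  have AP: "A i \<in> P" if "i \<in> {1..card P}" for i using A(1) that by (auto simp: bij_betw_def)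
  have Ainj: "A i = A j \<longleftrightarrow> i = j" if "i \<in> {1..card P}" "j \<in> {1..card P}" for i j
    using inj_on_eq_iff[OF bij_betw_imp_inj_on[OF A(1)] that] .
  have disj: "p = q" if "p \<in> P" "q \<in> P" "v \<in> p" "v \<in> q" for p q v
    using P that by (auto simp: partition_on_def disjoint_def)
  define idx where "idx v = (THE i. i \<in> {1..card P} \<and> v \<in> A i)" for v
  have idx: "idx v = i" if "i \<in> {1..card P}" "v \<in> A i" for v i
    unfolding idx_def
  proof (rule the_equality)
    fix j assume j: "j \<in> {1..card P} \<and> v \<in> A j"
    then have "A j = A i" using disj[OF AP AP, of j i v] that by blast
    then show "j = i" using Ainj j that by blast
  qed (use that in simp)
  have idxW: "idx v \<in> {1..card P}" "v \<in> A (idx v)" if vW: "v \<in> ?W" for v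
  proof -
    obtain p where p: "p \<in> P" "v \<in> p" using partition_onD1[OF P] vW by blast
    then obtain i where "i \<in> {1..card P}" "v \<in> A i"
      using A(1) unfolding bij_betw_def by blast
    then show "idx v \<in> {1..card P}" "v \<in> A (idx v)" using idx[of i v] by simp_all
  qed
  have AW: "A i \<subseteq> ?W" if "i \<in> {1..card P}" for i using AP[OF that] P by (auto simp: partition_on_def)
  define h where "h v = (if idx v \<le> t then idx v else 0)" for v
  have h1: "h ` ?W \<subseteq> {..t}" by (auto simp: h_def)
  have h2: "card {v \<in> ?W. h v = i} = nth_largest P i" if i: "1 \<le> i" "i \<le> t" for i
  proof (cases "i \<le> card P")
    case True
    have "{v \<in> ?W. h v = i} = A i"
    proof
      show "{v \<in> ?W. h v = i} \<subseteq> A i" using idxW i by (auto simp: h_def split: if_splits)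
      show "A i \<subseteq> {v \<in> ?W. h v = i}" using AW[of i] idx[of i] i True by (auto simp: h_def)
    qed
    then show ?thesis using A(2)[of i] i True by simp
  next
    case False
    have "{v \<in> ?W. h v = i} = {}" using idxW(1) False i by (fastforce simp: h_def split: if_splits)
    then have "card {v \<in> ?W. h v = i} = 0" by (simp only: card.empty)
    then show ?thesis using False by (simp add: nth_largest_def)
  qed
  have edge: "{a, b} \<in> edges G \<longleftrightarrow> idx a \<noteq> idx b" if ab: "a \<in> ?W" "b \<in> ?W" for a b
  proof
    assume "{a, b} \<in> edges G"
    then obtain x y p q where xy: "{a, b} = {x, y}" "p \<in> P" "q \<in> P" "p \<noteq> q" "x \<in> p" "y \<in> q" unfolding E by blast
    have "p = A (idx x)" "q = A (idx y)"
      using disj xy idxW[of x] idxW[of y] AP ab by (metis doubleton_eq_iff)+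
    then show "idx a \<noteq> idx b" using xy(1,4) by (auto simp: doubleton_eq_iff)
  next
    assume "idx a \<noteq> idx b"
    then have "A (idx a) \<noteq> A (idx b)" using Ainj idxW(1) ab by blast
    then show "{a, b} \<in> edges G" unfolding E using AP idxW ab by blast
  qed
  let ?D = "sym_diff (edges G) (edges (cgraph ?W h))"
  \<comment> \<open>A pair inside a small part is reached from both of its ends, and a vertex is
    also paired with itself. The overcount is harmless for an upper bound.\<close>
  let ?S = "SIGMA a:{a \<in> ?W. idx a > t}. A (idx a)"
  have "?D \<subseteq> (\<lambda>(a, b). {a, b}) ` ?S"
  proof
    fix e assume e: "e \<in> ?D"
    then have "e \<in> ksets ?W 2" using G(1) cgraph_edges_subset[of ?W h] unfolding is_graph_iff by blast
    then obtain a b where ab: "e = {a, b}" "a \<in> ?W" "b \<in> ?W" "a \<noteq> b" by (rule ksets_2E)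
    have "{a, b} \<in> edges (cgraph ?W h) \<longleftrightarrow> h a = 0 \<or> h a \<noteq> h b" using ab by (simp add: cgraph_edge)
    then have ne: "(idx a \<noteq> idx b) \<noteq> (h a = 0 \<or> h a \<noteq> h b)" using e edge[OF ab(2,3)] ab(1) by blast
    have "idx a \<ge> 1" "idx b \<ge> 1" using idxW(1) ab by auto
    then have "idx a = idx b \<and> idx a > t" using ne by (auto simp: h_def split: if_splits)
    then have "(a, b) \<in> ?S" using idxW(2)[OF ab(3)] ab(2) by auto
    then show "e \<in> (\<lambda>(a, b). {a, b}) ` ?S" using ab(1) by force
  qed
  moreover have finA: "finite (A (idx a))" if "a \<in> ?W" for a
    using finite_subset[OF AW[OF idxW(1)[OF that]] W] .
  moreover from this have finS: "finite ?S" using W by (intro finite_SigmaI) auto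
  ultimately have "card ?D \<le> card ((\<lambda>(a, b). {a, b}) ` ?S)" by (intro card_mono) auto
  also have "\<dots> \<le> card ?S" by (rule card_image_le[OF finS])
  also have "\<dots> = (\<Sum>a\<in>{a \<in> ?W. idx a > t}. card (A (idx a)))" using W finA by (intro card_SigmaI) auto
  also have "\<dots> \<le> (\<Sum>a\<in>{a \<in> ?W. idx a > t}. nth_largest P (Suc t))"
  proof (rule sum_mono)
    fix a assume a: "a \<in> {a \<in> ?W. idx a > t}"
    then show "card (A (idx a)) \<le> nth_largest P (Suc t)"
      using A(2)[OF idxW(1)] A(3)[of "Suc t" "idx a"] by auto
  qed
  also have "\<dots> \<le> card ?W * nth_largest P (Suc t)"
    using W by (auto intro: mult_right_mono card_mono)
  finally have h3: "card ?D \<le> card ?W * nth_largest P (Suc t)" .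
  show ?thesis by (rule that[OF h1 h2 h3])
qed

text \<open>In each coordinate a monotone subsequence converges because the values are bounded; the
  diagonal subsequence serves all coordinates.\<close>

lemma diagonal_convergent_subsequence:
  fixes s :: "nat \<Rightarrow> nat \<Rightarrow> real"
  assumes "\<And>m i. s m i \<in> {0..1}"
  obtains r where "strict_mono r" "\<And>i. convergent (\<lambda>m. s (r m) i)"
proof -
  let ?P = "\<lambda>i r. convergent (\<lambda>m. s (r m) i)"
  have ex: "\<exists>r'. strict_mono r' \<and> ?P i (q \<circ> r')" for q :: "nat \<Rightarrow> nat" and i
  proof -
    obtain r' where r': "strict_mono r'" "monoseq (\<lambda>m. s (q (r' m)) i)"
      using seq_monosub[of "\<lambda>m. s (q m) i"] by auto
    have "Bseq (\<lambda>m. s (q (r' m)) i)" by (rule BseqI'[of _ 1]) (use assms in auto)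
    then show ?thesis using Bseq_monoseq_convergent r' by auto
  qed
  interpret subseqs ?P by unfold_locales (use ex in auto)
  have "convergent (\<lambda>m. s (diagseq m) i)" for i
  proof -
    have "?P i (diagseq \<circ> ((+) (Suc i)))"
    proof (rule diagseq_holds)
      fix r q n assume "strict_mono (r :: nat \<Rightarrow> nat)" "?P n q"
      then show "?P n (q \<circ> r)"
        using convergent_subseq_convergent[of "\<lambda>m. s (q m) n" r] by (simp add: comp_def)
    qed
    then have "convergent (\<lambda>m. s (diagseq (m + Suc i)) i)" by (simp add: comp_def add.commute)
    then show ?thesis using convergent_ignore_initial_segment[of "\<lambda>m. s (diagseq m) i" "Suc i"] by simp
  qed
  then show ?thesis using that subseq_diagseq by blast
qed

subsection \<open>Compactness\<close>

lemma map_cgraph: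
  assumes "bij_betw \<sigma> W W"
  shows "map_graph \<sigma> (cgraph W (f \<circ> \<sigma>)) = cgraph W f"
proof -
  have inj: "inj_on \<sigma> W" and surj: "\<sigma> ` W = W" using assms by (auto simp: bij_betw_def)
  have "(`) \<sigma> ` edges (cgraph W (f \<circ> \<sigma>)) = edges (cgraph W f)"
  proof
    show "(`) \<sigma> ` edges (cgraph W (f \<circ> \<sigma>)) \<subseteq> edges (cgraph W f)"
    proof
      fix e assume "e \<in> (`) \<sigma> ` edges (cgraph W (f \<circ> \<sigma>))"
      then obtain u w where "e = {\<sigma> u, \<sigma> w}" "u \<in> W" "w \<in> W" "u \<noteq> w" "f (\<sigma> u) = 0 \<or> f (\<sigma> u) \<noteq> f (\<sigma> w)"
        by (auto simp: cgraph_def)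
      then show "e \<in> edges (cgraph W f)" using surj inj_on_eq_iff[OF inj] by (auto simp: cgraph_edge)
    qed
    show "edges (cgraph W f) \<subseteq> (`) \<sigma> ` edges (cgraph W (f \<circ> \<sigma>))"
    proof
      fix e assume e: "e \<in> edges (cgraph W f)"
      then have "e \<in> ksets W 2" using cgraph_edges_subset[of W f] by blast
      then obtain a b where ab: "e = {a, b}" "a \<in> W" "b \<in> W" "a \<noteq> b" by (rule ksets_2E)
      then have "a \<in> \<sigma> ` W" "b \<in> \<sigma> ` W" using surj by simp_all
      then obtain u w where uw: "u \<in> W" "w \<in> W" "a = \<sigma> u" "b = \<sigma> w" by blast
      then have "{u, w} \<in> edges (cgraph W (f \<circ> \<sigma>))" using e ab by (auto simp: cgraph_edge)
      then show "e \<in> (`) \<sigma> ` edges (cgraph W (f \<circ> \<sigma>))" using ab(1) uw by (intro image_eqI[of _ _ "{u, w}"]) auto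
    qed
  qed
  then show ?thesis using surj by (simp add: map_graph_def cgraph_def)
qed

lemma card_sym_diff_map:
  assumes "is_graph G" "is_graph H" "verts G = verts H" "inj_on \<sigma> (verts G)"
  shows "card (sym_diff (edges (map_graph \<sigma> G)) (edges (map_graph \<sigma> H))) = card (sym_diff (edges G) (edges H))"
proof -
  have inj: "inj_on ((`) \<sigma>) (Pow (verts G))" using assms(4) by (rule inj_on_image_Pow)
  have sub: "edges G \<subseteq> Pow (verts G)" "edges H \<subseteq> Pow (verts G)"
    using assms(1-3) by (auto simp: is_graph_def)
  have "sym_diff (edges (map_graph \<sigma> G)) (edges (map_graph \<sigma> H)) = (`) \<sigma> ` sym_diff (edges G) (edges H)"
  proof -
    have "(`) \<sigma> ` (edges G - edges H) = (`) \<sigma> ` edges G - (`) \<sigma> ` edges H"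
      by (rule inj_on_image_set_diff[OF inj]) (use sub in blast)+
    moreover have "(`) \<sigma> ` (edges H - edges G) = (`) \<sigma> ` edges H - (`) \<sigma> ` edges G"
      by (rule inj_on_image_set_diff[OF inj]) (use sub in blast)+
    ultimately show ?thesis by (simp only: image_Un map_graph_sel)
  qed
  moreover have "inj_on ((`) \<sigma>) (sym_diff (edges G) (edges H))"
    by (rule inj_on_subset[OF inj]) (use sub in blast)
  ultimately show ?thesis by (simp add: card_image)
qed

lemma finite_edges: "is_graph G \<Longrightarrow> finite (edges G)"
  unfolding is_graph_iff using finite_subset finite_ksets by blast

text \<open>The relabelling acts on the colouring and not on G, so closeness can be passed between
  graphs on {1..n} with \<sigma> held fixed.\<close>

definition near :: "real \<Rightarrow> nat \<Rightarrow> (nat \<Rightarrow> nat) \<Rightarrow> ugraph \<Rightarrow> bool" where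
  "near \<eta> n g G \<longleftrightarrow> (\<exists>\<sigma>. bij_betw \<sigma> {1..n} {1..n} \<and>
     real (card (sym_diff (edges G) (edges (cgraph {1..n} (g \<circ> \<sigma>))))) \<le> \<eta> * real n ^ 2)"

lemma near_trans:
  assumes "near \<eta> n g G'" "is_graph G" "is_graph G'"
    "real (card (sym_diff (edges G) (edges G'))) \<le> \<eta>' * real n ^ 2" "\<eta> + \<eta>' \<le> \<eta>''"
  shows "near \<eta>'' n g G"
proof -
  obtain \<sigma> where \<sigma>: "bij_betw \<sigma> {1..n} {1..n}"
    "real (card (sym_diff (edges G') (edges (cgraph {1..n} (g \<circ> \<sigma>))))) \<le> \<eta> * real n ^ 2"
    using assms(1) unfolding near_def by blast
  have "card (sym_diff (edges G) (edges (cgraph {1..n} (g \<circ> \<sigma>)))) \<le>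
    card (sym_diff (edges G) (edges G')) + card (sym_diff (edges G') (edges (cgraph {1..n} (g \<circ> \<sigma>))))"
    by (intro card_sym_diff_triangle finite_edges assms is_graph_cgraph) simp
  then have "real (card (sym_diff (edges G) (edges (cgraph {1..n} (g \<circ> \<sigma>))))) \<le> (\<eta> + \<eta>') * real n ^ 2"
    using \<sigma>(2) assms(4) unfolding distrib_right by linarith
  also have "\<dots> \<le> \<eta>'' * real n ^ 2" using assms(5) by (intro mult_right_mono) auto
  finally show ?thesis unfolding near_def using \<sigma>(1) by blast
qed

lemma realisation_part_empty:
  assumes "realisation_parts n x V" "i \<ge> 1" "x i = 0"
  shows "V i = {}"
proof (cases "x 0 = 0")
  case True
  then have "\<bar>real (card (V i))\<bar> < 1" using assms unfolding realisation_parts_def by auto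
  then have "card (V i) = 0" by simp
  moreover have "finite (V i)" using finite_subset[OF realisation_part_subset[OF assms(1)]] by simp
  ultimately show ?thesis by simp
next
  case False
  then show ?thesis using assms unfolding realisation_parts_def by auto
qed

text \<open>With finite support, a single order suffices for all positive weights to pass the
  threshold of \<open>realisation_part_size\<close>; classes of weight 0 are empty.\<close>

lemma realisation_sizes:
  assumes V: "\<And>n. realisation_parts n x (V n)" and x: "part_weights x" and t: "\<And>i. i > t \<Longrightarrow> x i = 0"
  obtains N where "\<And>n i. n \<ge> N \<Longrightarrow> i \<ge> 1 \<Longrightarrow> \<bar>real (card (V n i)) - x i * real n\<bar> \<le> 1"
proof -
  have "\<exists>N. \<forall>n\<ge>N. x i > 0 \<longrightarrow> 2 \<le> x i * real n" for i
    using eventually_le_mult[of "x i" 2] by metis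
  then have "\<forall>i. \<exists>N. \<forall>n\<ge>N. x i > 0 \<longrightarrow> 2 \<le> x i * real n" by blast
  then obtain N where "\<forall>i. \<forall>n\<ge>N i. x i > 0 \<longrightarrow> 2 \<le> x i * real n" by (rule choice[THEN exE])
  then have N: "2 \<le> x i * real n" if "n \<ge> N i" "x i > 0" for i n using that by blast
  have "\<bar>real (card (V n i)) - x i * real n\<bar> \<le> 1" if n: "n \<ge> Max (N ` {..t})" and i: "i \<ge> 1" for n i
  proof (cases "x i > 0")
    case True
    then have "i \<le> t" using t[of i] by (cases "i \<le> t") auto
    then have "n \<ge> N i" using n by simp
    then show ?thesis using realisation_part_size[OF V x i] N True by blast
  next
    case False
    then have "x i = 0" using part_weights_nonneg[OF x, of i] by simp
    then show ?thesis using realisation_part_empty[OF V i] by simp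
  qed
  then show ?thesis by (rule that)
qed

context bounded_invariant
begin

text \<open>Relabelling G by \<sigma> brings it close to the labelled realisation, and the colouring
  found there is pulled back along \<sigma>.\<close>

lemma local_stability_near:
  assumes L: "\<And>G. is_graph G \<Longrightarrow> verts G = {1..n} \<Longrightarrow>
      real (card (sym_diff (edges G) (edges (cgraph {1..n} g)))) \<le> \<eta> * real n ^ 2 \<Longrightarrow>
      \<exists>f. c * real (card (sym_diff (edges G) (edges (cgraph {1..n} f))))
        \<le> (lam k \<gamma> (cgraph {1..n} f) - lam k \<gamma> G) * real n ^ 2"
    and G: "is_graph G" "verts G = {1..n}" "near \<eta> n g G"
  shows "\<exists>f. c * real (card (sym_diff (edges G) (edges (cgraph {1..n} f))))
        \<le> (lam k \<gamma> (cgraph {1..n} f) - lam k \<gamma> G) * real n ^ 2"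
proof -
  let ?W = "{1..n}"
  obtain \<sigma> where \<sigma>: "bij_betw \<sigma> ?W ?W"
    and close: "real (card (sym_diff (edges G) (edges (cgraph ?W (g \<circ> \<sigma>))))) \<le> \<eta> * real n ^ 2"
    using G(3) unfolding near_def by blast
  have inj: "inj_on \<sigma> ?W" using \<sigma> by (simp add: bij_betw_def)
  let ?G = "map_graph \<sigma> G"
  have G': "is_graph ?G" "verts ?G = ?W"
    using is_graph_map[OF G(1)] G(2) inj \<sigma> by (simp_all add: bij_betw_def)
  have card: "card (sym_diff (edges ?G) (edges (cgraph ?W f))) = card (sym_diff (edges G) (edges (cgraph ?W (f \<circ> \<sigma>))))" for f
  proof -
    have "card (sym_diff (edges ?G) (edges (map_graph \<sigma> (cgraph ?W (f \<circ> \<sigma>))))) = card (sym_diff (edges G) (edges (cgraph ?W (f \<circ> \<sigma>))))"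
      by (rule card_sym_diff_map[OF G(1) is_graph_cgraph]) (use G(2) inj in simp_all)
    then show ?thesis unfolding map_cgraph[OF \<sigma>] .
  qed
  obtain f where f: "c * real (card (sym_diff (edges ?G) (edges (cgraph ?W f))))
        \<le> (lam k \<gamma> (cgraph ?W f) - lam k \<gamma> ?G) * real n ^ 2"
    using L[OF G'] close unfolding card by blast
  have "lam k \<gamma> ?G = lam k \<gamma> G" using lam_map[OF G(1)] G(2) inj by simp
  moreover have "lam k \<gamma> (cgraph ?W f) = lam k \<gamma> (cgraph ?W (f \<circ> \<sigma>))"
    using lam_map[OF is_graph_cgraph[of ?W "f \<circ> \<sigma>"], of \<sigma>] map_cgraph[OF \<sigma>, of f] inj by simp
  ultimately show ?thesis using f card[of f] by (intro exI[of _ "f \<circ> \<sigma>"]) simp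
qed

text \<open>Scaled part sizes lie in [0,1], so a subsequence converges in every coordinate.
  Monotonicity and bounds on partial sums pass to the limit, and weight that escapes into ever
  smaller parts becomes x 0. The densities are squeezed against the maximum densities.\<close>

lemma limit_maximiser:
  fixes H :: "nat \<Rightarrow> ugraph" and P :: "nat \<Rightarrow> nat set set"
  assumes H: "\<And>m. is_graph (H m)" "\<And>m. partite_sets (H m) (P m)" "\<And>m. order (H m) \<ge> Suc m"
    and lam: "\<And>m. lam k \<gamma> (H m) \<ge> lam_order k \<gamma> (order (H m)) - 1 / real (Suc m)"
  obtains r x where "strict_mono r" "x \<in> OPT k \<gamma>"
    "\<And>i. i \<ge> 1 \<Longrightarrow> (\<lambda>m. real (nth_largest (P (r m)) i) / real (order (H (r m)))) \<longlonglongrightarrow> x i"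
proof -
  \<comment> \<open>Coordinates start at 0 here, while index 0 of a weight sequence is reserved for
    x 0; hence the shift.\<close>
  define s where "s m i = real (nth_largest (P m) (Suc i)) / real (order (H m))" for m i
  have part: "partition_on (verts (H m)) (P m)" for m using H(2) by (simp add: partite_sets_def)
  have finV: "finite (verts (H m))" for m using is_graph_finite[OF H(1)] .
  have ord: "order (H m) > 0" for m using H(3)[of m] by simp
  have ssum: "(\<Sum>i<t. s m i) \<le> 1" for m t
  proof -
    have "(\<Sum>i<t. s m i) = real (\<Sum>i<t. nth_largest (P m) (Suc i)) / real (order (H m))"
      unfolding s_def by (simp add: sum_divide_distrib)
    also have "\<dots> \<le> 1"
      using sum_nth_largest_le[OF finV part, of m t] ord[of m] by (simp add: order_def divide_le_eq_1 del: of_nat_sum)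
    finally show ?thesis .
  qed
  have s0: "0 \<le> s m i" for m i by (simp add: s_def)
  have smono: "s m (Suc i) \<le> s m i" for m i
  proof -
    have "nth_largest (P m) (Suc (Suc i)) \<le> nth_largest (P m) (Suc i)"
      using nth_largest_enum[OF finite_elements[OF finV part], of m]
      by (metis One_nat_def Suc_leI le_SucI order_refl zero_less_Suc)
    then show ?thesis unfolding s_def by (intro divide_right_mono) auto
  qed
  have "s m i \<le> 1" for m i
    using ssum[of m "Suc i"] sum_nonneg[of "{..<i}" "s m"] s0 by simp
  then obtain r where r: "strict_mono r" "\<And>i. convergent (\<lambda>m. s (r m) i)"
    using diagonal_convergent_subsequence[of s] s0 by auto
  define y where "y i = lim (\<lambda>m. s (r m) i)" for i
  have y: "(\<lambda>m. s (r m) i) \<longlonglongrightarrow> y i" for i using r(2) unfolding y_def by (simp add: convergent_LIMSEQ_iff)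
  have y0: "y i \<ge> 0" for i by (rule LIMSEQ_le_const[OF y]) (use s0 in auto)
  have ymono: "y (Suc i) \<le> y i" for i by (rule LIMSEQ_le[OF y y]) (use smono in auto)
  have ysum: "(\<Sum>i<t. y i) \<le> 1" for t
  proof (rule LIMSEQ_le_const2)
    show "(\<lambda>m. \<Sum>i<t. s (r m) i) \<longlonglongrightarrow> (\<Sum>i<t. y i)" using y by (intro tendsto_sum) auto
  qed (use ssum in auto)
  have summ: "summable y" by (rule summableI_nonneg_bounded[OF y0 ysum])
  define x where "x i = (if i = 0 then 1 - suminf y else y (i - 1))" for i
  have xS: "(\<lambda>i. x (Suc i)) = y" by (simp add: x_def fun_eq_iff)
  have lim: "(\<lambda>m. real (nth_largest (P (r m)) i) / real (order (H (r m)))) \<longlonglongrightarrow> x i" if "i \<ge> 1" for i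
    using y[of "i - 1"] that unfolding s_def x_def by simp
  have pw: "part_weights x"
    unfolding part_weights_def xS
  proof (intro conjI allI impI)
    show "x (Suc i) \<le> x i" if "1 \<le> i" for i using ymono[of "i - 1"] that by (simp add: x_def)
    show "0 \<le> x i" if "1 \<le> i" for i using y0 that by (simp add: x_def)
    show "suminf y \<le> 1" by (rule suminf_le_const[OF summ ysum])
  qed (use summ in \<open>auto simp: x_def\<close>)
  have oinf: "filterlim (\<lambda>m. order (H (r m))) at_top sequentially"
  proof (rule filterlim_at_top_mono[OF filterlim_ident])
    show "eventually (\<lambda>m. m \<le> order (H (r m))) sequentially"
    proof (rule always_eventually, rule allI)
      fix m show "m \<le> order (H (r m))" using H(3)[of "r m"] seq_suble[OF r(1), of m] by linarith
    qed
  qed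
  have llim: "(\<lambda>m. lam k \<gamma> (H (r m))) \<longlonglongrightarrow> lam_max k \<gamma>"
  proof -
    have up: "(\<lambda>m. lam_order k \<gamma> (order (H (r m)))) \<longlonglongrightarrow> lam_max k \<gamma>"
      by (rule filterlim_compose[OF lam_order_tendsto oinf])
    have "(\<lambda>m. 1 / real (Suc (r m))) \<longlonglongrightarrow> 0"
      using LIMSEQ_subseq_LIMSEQ[OF LIMSEQ_inverse_real_of_nat r(1)] by (simp add: comp_def inverse_eq_divide)
    then have low: "(\<lambda>m. lam_order k \<gamma> (order (H (r m))) - 1 / real (Suc (r m))) \<longlonglongrightarrow> lam_max k \<gamma>"
      using tendsto_diff[OF up] by fastforce
    have le1: "\<forall>\<^sub>F m in sequentially. lam_order k \<gamma> (order (H (r m))) - 1 / real (Suc (r m)) \<le> lam k \<gamma> (H (r m))"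
      using lam by (intro always_eventually) blast
    have le2: "\<forall>\<^sub>F m in sequentially. lam k \<gamma> (H (r m)) \<le> lam_order k \<gamma> (order (H (r m)))"
      using lam_le_lam_order[OF H(1)] by (intro always_eventually) blast
    show ?thesis by (rule tendsto_sandwich[OF le1 le2 low up])
  qed
  have "maximiser k \<gamma> x"
    unfolding maximiser_def
    by (intro conjI pw exI[of _ "\<lambda>m. H (r m)"] exI[of _ "\<lambda>m. P (r m)"] allI impI oinf llim H(1,2) lim)
  then show ?thesis using that[OF r(1) _ lim] by (simp add: OPT_def)
qed

text \<open>Counterexamples with \<delta> = 1/(m+1) and order above m would have a limit x in
  \<open>OPT\<close>. As x has finite support, all parts beyond the t-th largest have o(n) vertices,
  so dissolving them into singletons changes o(n^2) pairs, and the other t parts have nearly the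
  sizes prescribed by the realisation.\<close>

lemma compactness:
  assumes V: "\<And>n x. x \<in> OPT k \<gamma> \<Longrightarrow> realisation_parts n x (V n x)"
    and supp: "\<And>x. x \<in> OPT k \<gamma> \<Longrightarrow> \<exists>t. \<forall>i>t. x i = 0"
    and \<eta>: "\<eta> > 0"
  obtains \<delta> N where "\<delta> > 0" "\<And>n H. n \<ge> N \<Longrightarrow> complete_partite H \<Longrightarrow> verts H = {1..n} \<Longrightarrow>
    lam k \<gamma> H \<ge> lam_order k \<gamma> n - \<delta> \<Longrightarrow> \<exists>x\<in>OPT k \<gamma>. near \<eta> n (part_index (V n x)) H"
proof -
  have "\<exists>m. \<forall>n H. n \<ge> Suc m \<longrightarrow> complete_partite H \<longrightarrow> verts H = {1..n} \<longrightarrow>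
    lam k \<gamma> H \<ge> lam_order k \<gamma> n - 1 / real (Suc m) \<longrightarrow> (\<exists>x\<in>OPT k \<gamma>. near \<eta> n (part_index (V n x)) H)"
  proof (rule ccontr)
    assume neg: "\<not> ?thesis"
    have "\<forall>m. \<exists>H. order H \<ge> Suc m \<and> complete_partite H \<and> verts H = {1..order H} \<and>
      lam k \<gamma> H \<ge> lam_order k \<gamma> (order H) - 1 / real (Suc m) \<and>
      \<not> (\<exists>x\<in>OPT k \<gamma>. near \<eta> (order H) (part_index (V (order H) x)) H)"
    proof
      fix m
      obtain n H where nH: "n \<ge> Suc m" "complete_partite H" "verts H = {1..n}"
        "lam k \<gamma> H \<ge> lam_order k \<gamma> n - 1 / real (Suc m)"
        "\<not> (\<exists>x\<in>OPT k \<gamma>. near \<eta> n (part_index (V n x)) H)" using neg by blast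
      have "order H = n" using nH(3) by (simp add: order_def)
      then show "\<exists>H. order H \<ge> Suc m \<and> complete_partite H \<and> verts H = {1..order H} \<and>
        lam k \<gamma> H \<ge> lam_order k \<gamma> (order H) - 1 / real (Suc m) \<and>
        \<not> (\<exists>x\<in>OPT k \<gamma>. near \<eta> (order H) (part_index (V (order H) x)) H)" using nH by blast
    qed
    then obtain H where H: "\<forall>m. order (H m) \<ge> Suc m \<and> complete_partite (H m) \<and> verts (H m) = {1..order (H m)} \<and>
      lam k \<gamma> (H m) \<ge> lam_order k \<gamma> (order (H m)) - 1 / real (Suc m) \<and>
      \<not> (\<exists>x\<in>OPT k \<gamma>. near \<eta> (order (H m)) (part_index (V (order (H m)) x)) (H m))"
      by (rule choice[THEN exE])
    have gr: "is_graph (H m)" for m using H by (simp add: complete_partite_def)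
    have "\<forall>m. \<exists>P. partite_sets (H m) P" using H by (simp add: complete_partite_def)
    then obtain P where "\<forall>m. partite_sets (H m) (P m)" by (rule choice[THEN exE])
    then have P: "partite_sets (H m) (P m)" for m by blast
    obtain r x where r: "strict_mono r" "x \<in> OPT k \<gamma>"
      and lim: "\<And>i. i \<ge> 1 \<Longrightarrow> (\<lambda>m. real (nth_largest (P (r m)) i) / real (order (H (r m)))) \<longlonglongrightarrow> x i"
      by (rule limit_maximiser[of H P]) (use gr P H in blast)+
    obtain t where t: "\<And>i. i > t \<Longrightarrow> x i = 0" using supp[OF r(2)] by blast
    have x: "part_weights x" using r(2) by (simp add: OPT_def maximiser_def)
    obtain N1 where N1: "\<And>n i. n \<ge> N1 \<Longrightarrow> i \<ge> 1 \<Longrightarrow> \<bar>real (card (V n x i)) - x i * real n\<bar> \<le> 1"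
      using realisation_sizes[of x "\<lambda>n. V n x" t, OF V[OF r(2)] x t] by blast
    \<comment> \<open>Dissolving small parts costs \<epsilon> and \<open>match_colourings\<close>
      costs 2 t \<epsilon>, in total half of \<eta>. The other half absorbs the rounding term 2 t
      once n is large.\<close>
    define \<epsilon> where "\<epsilon> = \<eta> / (2 * (2 * real t + 1))"
    have \<epsilon>: "\<epsilon> > 0" "(2 * real t + 1) * \<epsilon> = \<eta> / 2"
    proof -
      have "2 * real t + 1 > 0" by simp
      then show "\<epsilon> > 0" "(2 * real t + 1) * \<epsilon> = \<eta> / 2" using \<eta> by (auto simp: \<epsilon>_def field_simps)
    qed
    have "\<eta> / 2 > 0" using \<eta> by simp
    then obtain N2 where N2: "\<And>n. n \<ge> N2 \<Longrightarrow> 2 * real t \<le> \<eta> / 2 * real n" using eventually_le_mult by blast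
    have "\<forall>i\<in>{1..Suc t}. \<forall>\<^sub>F m in sequentially. \<bar>real (nth_largest (P (r m)) i) / real (order (H (r m))) - x i\<bar> < \<epsilon>"
      using lim tendstoD[OF _ \<epsilon>(1)] by (fastforce simp: dist_real_def)
    then have "\<forall>\<^sub>F m in sequentially. \<forall>i\<in>{1..Suc t}. \<bar>real (nth_largest (P (r m)) i) / real (order (H (r m))) - x i\<bar> < \<epsilon>"
      by (intro eventually_ball_finite) auto
    then obtain m0 where m0: "\<And>m i. m \<ge> m0 \<Longrightarrow> i \<in> {1..Suc t} \<Longrightarrow>
        \<bar>real (nth_largest (P (r m)) i) / real (order (H (r m))) - x i\<bar> < \<epsilon>"
      unfolding eventually_sequentially by blast
    define m where "m = Max {m0, N1, N2}"
    have m: "m \<ge> m0" "m \<ge> N1" "m \<ge> N2" by (simp_all add: m_def)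
    define n where "n = order (H (r m))"
    have "n \<ge> Suc (r m)" using H by (simp add: n_def)
    then have n: "n > 0" "n \<ge> N1" "n \<ge> N2" using m seq_suble[OF r(1), of m] by linarith+
    let ?W = "{1..n}" and ?G = "H (r m)" and ?P = "P (r m)"
    have vG: "verts ?G = ?W" using H by (simp add: n_def)
    have size: "\<bar>real (nth_largest ?P i) - x i * real n\<bar> \<le> \<epsilon> * real n" if "i \<in> {1..Suc t}" for i
    proof -
      have "\<bar>real (nth_largest ?P i) / real n - x i\<bar> * real n \<le> \<epsilon> * real n"
        using m0[OF m(1) that] unfolding n_def by (intro mult_right_mono) auto
      moreover have "\<bar>real (nth_largest ?P i) / real n - x i\<bar> * real n = \<bar>real (nth_largest ?P i) - x i * real n\<bar>"
      proof -
        have "real (nth_largest ?P i) - x i * real n = (real (nth_largest ?P i) / real n - x i) * real n"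
          using n(1) by (simp add: field_simps)
        then show ?thesis by (simp only: abs_mult abs_of_nat)
      qed
      ultimately show ?thesis by simp
    qed
    obtain h where h: "h ` ?W \<subseteq> {..t}" "\<And>i. 1 \<le> i \<Longrightarrow> i \<le> t \<Longrightarrow> card {v \<in> ?W. h v = i} = nth_largest ?P i"
      "card (sym_diff (edges ?G) (edges (cgraph ?W h))) \<le> n * nth_largest ?P (Suc t)"
      using colour_largest_parts[OF gr P, of "r m" t] vG by (auto simp: n_def[symmetric])
    let ?g = "part_index (V n x)"
    have rp: "realisation_parts n x (V n x)" by (rule V[OF r(2)])
    have g: "?g ` ?W \<subseteq> {..t}"
    proof
      fix j assume "j \<in> ?g ` ?W"
      then obtain w where w: "w \<in> ?W" "j = ?g w" by blast
      then have "w \<in> V n x j" using part_index_mem[OF rp] by blast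
      then show "j \<in> {..t}" using realisation_part_empty[OF rp, of j] t[of j] by (cases "j \<le> t") auto
    qed
    have "\<bar>real (card {v \<in> ?W. h v = i}) - real (card {v \<in> ?W. ?g v = i})\<bar> \<le> \<epsilon> * real n + 1" if "1 \<le> i" "i \<le> t" for i
      using size[of i] N1[OF n(2), of i] that unfolding h(2)[OF that] part_index_class[OF rp] by auto
    then obtain \<sigma> where \<sigma>: "bij_betw \<sigma> ?W ?W" "real (card {v \<in> ?W. h v \<noteq> ?g (\<sigma> v)}) \<le> 2 * real t * (\<epsilon> * real n + 1)"
      using match_colourings[OF _ h(1) g, of "\<epsilon> * real n + 1"] \<epsilon>(1) by auto
    let ?B = "{v \<in> ?W. h v \<noteq> ?g (\<sigma> v)}"
    have "card (sym_diff (edges (cgraph ?W h)) (edges (cgraph ?W (?g \<circ> \<sigma>)))) \<le> card {e \<in> ksets ?W 2. e \<inter> ?B \<noteq> {}}"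
      by (intro card_mono cgraph_recolour_diff) auto
    moreover have "real (card {e \<in> ksets ?W 2. e \<inter> ?B \<noteq> {}}) \<le> real (card ?B) * real n"
      using card_pairs_meeting[of ?W ?B] by simp
    moreover have "real (card ?B) * real n \<le> 2 * real t * (\<epsilon> * real n + 1) * real n"
      using \<sigma>(2) by (intro mult_right_mono) auto
    moreover have "real (card (sym_diff (edges ?G) (edges (cgraph ?W h)))) \<le> \<epsilon> * real n * real n"
    proof -
      have "real (nth_largest ?P (Suc t)) \<le> \<epsilon> * real n" using size[of "Suc t"] t[of "Suc t"] by simp
      then have "real n * real (nth_largest ?P (Suc t)) \<le> real n * (\<epsilon> * real n)" by (rule mult_left_mono) simp
      moreover have "real (card (sym_diff (edges ?G) (edges (cgraph ?W h)))) \<le> real n * real (nth_largest ?P (Suc t))"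
        using h(3) by (simp flip: of_nat_mult)
      ultimately show ?thesis by (simp add: mult_ac)
    qed
    moreover have "card (sym_diff (edges ?G) (edges (cgraph ?W (?g \<circ> \<sigma>)))) \<le>
      card (sym_diff (edges ?G) (edges (cgraph ?W h))) + card (sym_diff (edges (cgraph ?W h)) (edges (cgraph ?W (?g \<circ> \<sigma>))))"
      by (intro card_sym_diff_triangle finite_edges gr is_graph_cgraph) simp_all
    ultimately have "real (card (sym_diff (edges ?G) (edges (cgraph ?W (?g \<circ> \<sigma>))))) \<le>
       \<epsilon> * real n * real n + 2 * real t * (\<epsilon> * real n + 1) * real n" by linarith
    also have "\<dots> = ((2 * real t + 1) * \<epsilon> * real n + 2 * real t) * real n" by (simp add: algebra_simps)
    also have "\<dots> \<le> (\<eta> / 2 * real n + \<eta> / 2 * real n) * real n"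
      using N2[OF n(3)] unfolding \<epsilon>(2) by (intro mult_right_mono add_left_mono) auto
    also have "\<dots> = \<eta> * real n ^ 2" by (simp add: power2_eq_square algebra_simps)
    finally have "near \<eta> n ?g ?G" unfolding near_def using \<sigma>(1) by blast
    then show False using H r(2) unfolding n_def by blast
  qed
  then obtain m where m: "\<forall>n H. n \<ge> Suc m \<longrightarrow> complete_partite H \<longrightarrow> verts H = {1..n} \<longrightarrow>
    lam k \<gamma> H \<ge> lam_order k \<gamma> n - 1 / real (Suc m) \<longrightarrow> (\<exists>x\<in>OPT k \<gamma>. near \<eta> n (part_index (V n x)) H)" by blast
  show ?thesis by (rule that[of "1 / real (Suc m)" "Suc m"]) (use m in auto)
qed

end

subsection \<open>From local to perfect stability\<close>

text \<open>This is where finiteness of the set of maximisers is spent: the least \<eta>, the least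
  c and the largest N serve all of them.\<close>

lemma uniform_constants:
  fixes \<Phi> :: "'a \<Rightarrow> real \<Rightarrow> real \<Rightarrow> nat \<Rightarrow> bool"
  assumes "finite S" "\<And>x. x \<in> S \<Longrightarrow> \<exists>\<eta>>0. \<exists>c>0. \<exists>N. \<Phi> x \<eta> c N"
    and anti: "\<And>x \<eta> \<eta>' c c' N N'. \<Phi> x \<eta> c N \<Longrightarrow> \<eta>' \<le> \<eta> \<Longrightarrow> c' \<le> c \<Longrightarrow> N \<le> N' \<Longrightarrow> \<Phi> x \<eta>' c' N'"
  shows "\<exists>\<eta>>0. \<exists>c>0. \<exists>N. \<forall>x\<in>S. \<Phi> x \<eta> c N"
  using assms(1,2)
proof (induction S)
  case empty
  then show ?case by (auto intro: exI[of _ "1::real"])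
next
  case (insert a S)
  obtain \<eta> c N where 1: "\<eta> > 0" "c > 0" "\<forall>x\<in>S. \<Phi> x \<eta> c N" using insert by auto
  obtain \<eta>' c' N' where 2: "\<eta>' > 0" "c' > 0" "\<Phi> a \<eta>' c' N'" using insert.prems[of a] by auto
  have "\<forall>x\<in>insert a S. \<Phi> x (min \<eta> \<eta>') (min c c') (max N N')"
  proof
    fix x assume x: "x \<in> insert a S"
    show "\<Phi> x (min \<eta> \<eta>') (min c c') (max N N')"
    proof (cases "x = a")
      case True
      show ?thesis unfolding True by (rule anti[OF 2(3)]) auto
    next
      case False
      then have "\<Phi> x \<eta> c N" using 1(3) x by blast
      then show ?thesis by (rule anti) auto
    qed
  qed
  moreover have "min \<eta> \<eta>' > 0" "min c c' > 0" using 1 2 by simp_all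
  ultimately show ?case by blast
qed

lemma edit_dist_le:
  assumes G: "is_graph G" and H: "is_graph H" "verts H = {1..n}" and n: "order G = n"
    and \<sigma>: "bij_betw \<sigma> (verts G) {1..n}"
  shows "edit_dist G H \<le> 2 / real n ^ 2 * real (card (sym_diff (edges H) (edges (map_graph \<sigma> G))))"
proof -
  let ?S = "{card (sym_diff (edges H) ((`) \<tau> ` edges G)) | \<tau>. bij_betw \<tau> (verts G) (verts H)}"
  have "?S \<subseteq> {..card (ksets {1..n} 2)}"
  proof
    fix s assume "s \<in> ?S"
    then obtain \<tau> where \<tau>: "s = card (sym_diff (edges H) ((`) \<tau> ` edges G))" "bij_betw \<tau> (verts G) {1..n}"
      using H(2) by auto
    then have "is_graph (map_graph \<tau> G)" "verts (map_graph \<tau> G) = {1..n}"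
      using is_graph_map[OF G] by (simp_all add: bij_betw_def)
    then have "sym_diff (edges H) ((`) \<tau> ` edges G) \<subseteq> ksets {1..n} 2"
      using H unfolding is_graph_iff by auto
    then show "s \<in> {..card (ksets {1..n} 2)}" unfolding \<tau>(1) by (simp add: card_mono)
  qed
  then have fin: "finite ?S" using finite_subset by blast
  have "card (sym_diff (edges H) (edges (map_graph \<sigma> G))) \<in> ?S" using \<sigma> H(2) by auto
  then have "Min ?S \<le> card (sym_diff (edges H) (edges (map_graph \<sigma> G)))" by (rule Min_le[OF fin])
  then show ?thesis unfolding edit_dist_def n by (intro mult_left_mono) auto
qed

context bounded_invariant
begin

text \<open>Along a symmetrisation sequence the first graph close to a realisation has distance about
  \<open>\<eta>\<close> from all of them, contradicting local stability and compactness.\<close>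

lemma global_closeness:
  assumes sym: "symmetrisable k \<gamma>"
    and V: "\<And>n x. x \<in> OPT k \<gamma> \<Longrightarrow> realisation_parts n x (V n x)"
    and supp: "\<And>x. x \<in> OPT k \<gamma> \<Longrightarrow> \<exists>t. \<forall>i>t. x i = 0"
    and \<eta>: "\<eta> > 0" and c: "c > 0"
    and L: "\<And>n x G. n \<ge> N0 \<Longrightarrow> x \<in> OPT k \<gamma> \<Longrightarrow> is_graph G \<Longrightarrow> verts G = {1..n} \<Longrightarrow> near \<eta> n (part_index (V n x)) G \<Longrightarrow>
      \<exists>f. c * real (card (sym_diff (edges G) (edges (cgraph {1..n} f))))
        \<le> (lam k \<gamma> (cgraph {1..n} f) - lam k \<gamma> G) * real n ^ 2"
  shows "\<exists>\<delta>>0. \<exists>N. \<forall>n\<ge>N. \<forall>G. is_graph G \<and> verts G = {1..n} \<and> lam k \<gamma> G \<ge> lam_order k \<gamma> n - \<delta> \<longrightarrow>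
    (\<exists>x\<in>OPT k \<gamma>. near \<eta> n (part_index (V n x)) G)"
proof -
  have "\<eta> / 4 > 0" using \<eta> by simp
  obtain \<delta>1 N1 where \<delta>1: "\<delta>1 > 0" and N1: "\<And>n H. n \<ge> N1 \<Longrightarrow> complete_partite H \<Longrightarrow> verts H = {1..n} \<Longrightarrow>
    lam k \<gamma> H \<ge> lam_order k \<gamma> n - \<delta>1 \<Longrightarrow> \<exists>x\<in>OPT k \<gamma>. near (\<eta> / 4) n (part_index (V n x)) H"
    using compactness[OF V supp \<open>\<eta> / 4 > 0\<close>] by blast
  have "\<eta> / 2 > 0" using \<eta> by simp
  then obtain N2 where N2: "\<And>G. is_graph G \<Longrightarrow> order G \<ge> N2 \<Longrightarrow> Sym1 k \<gamma> (\<eta> / 2) G"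
    using sym unfolding symmetrisable_def by meson
  \<comment> \<open>An increase of at most \<delta> forces, by local stability, a distance of at
    most \<delta> n^2 / c, hence at most \<eta> n^2 / 4.\<close>
  define \<delta> where "\<delta> = min \<delta>1 (c * \<eta> / 4)"
  have \<delta>: "\<delta> > 0" "\<delta> \<le> \<delta>1" "\<delta> \<le> c * \<eta> / 4" using \<delta>1 c \<eta> by (simp_all add: \<delta>_def)
  show ?thesis
  proof (intro exI[of _ \<delta>] exI[of _ "Max {N0, N1, N2, 1}"] conjI allI impI \<delta>(1))
    fix n G
    assume "n \<ge> Max {N0, N1, N2, 1}"
      and asm: "is_graph G \<and> verts G = {1..n} \<and> lam k \<gamma> G \<ge> lam_order k \<gamma> n - \<delta>"
    then have G: "is_graph G" "verts G = {1..n}" and lamG: "lam k \<gamma> G \<ge> lam_order k \<gamma> n - \<delta>"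
      and n: "n \<ge> N0" "n \<ge> N1" "n \<ge> N2" "n > 0" by simp_all
    let ?near = "\<lambda>\<eta> G. \<exists>x\<in>OPT k \<gamma>. near \<eta> n (part_index (V n x)) G"
    have oG: "order G = n" using G(2) by (simp add: order_def)
    obtain m and S :: "nat \<Rightarrow> ugraph" where S0: "S 0 = G" and Sm: "complete_partite (S m)"
      and S1: "\<forall>i\<le>m. is_graph (S i) \<and> verts (S i) = verts G"
      and S2: "\<forall>i\<in>{1..m}. lam k \<gamma> (S (i - 1)) \<le> lam k \<gamma> (S i) \<and>
           real (card (sym_diff (edges (S (i - 1))) (edges (S i)))) < \<eta> / 2 * real (order G choose 2)"
      using N2[OF G(1)] n(3) oG unfolding Sym1_def by auto
    have gS: "is_graph (S i)" "verts (S i) = {1..n}" if "i \<le> m" for i using S1 that G(2) by auto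
    have lamS: "lam k \<gamma> (S i) \<ge> lam_order k \<gamma> n - \<delta>" if "i \<le> m" for i
      using that
    proof (induction i)
      case 0
      then show ?case using S0 lamG by simp
    next
      case (Suc i)
      then show ?case using bspec[OF S2, of "Suc i"] by simp
    qed
    have "?near (\<eta> / 4) (S m)" using N1[OF n(2) Sm gS(2)] lamS[of m] \<delta>(2) by simp
    then have nm: "?near \<eta> (S m)"
      using near_trans[OF _ gS(1) gS(1), of "\<eta> / 4" n _ m m 0 \<eta>] \<eta> by auto
    have "?near \<eta> (S 0)"
    proof (rule ccontr)
      assume n0: "\<not> ?near \<eta> (S 0)"
      define Far where "Far i \<longleftrightarrow> \<not> ?near \<eta> (S i)" for i
      have "Far 0" "\<not> Far m" using n0 nm unfolding Far_def by blast+
      then obtain i where "i < m" "Far i" "\<not> Far (Suc i)" by (rule discrete_crossing)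
      then have i: "i < m" "\<not> ?near \<eta> (S i)" "?near \<eta> (S (Suc i))" unfolding Far_def by blast+
      then obtain x where x: "x \<in> OPT k \<gamma>" "near \<eta> n (part_index (V n x)) (S (Suc i))" by blast
      have Si: "Suc i \<le> m" "i \<le> m" using i by simp_all
      obtain f where f: "c * real (card (sym_diff (edges (S (Suc i))) (edges (cgraph {1..n} f))))
        \<le> (lam k \<gamma> (cgraph {1..n} f) - lam k \<gamma> (S (Suc i))) * real n ^ 2"
        using L[OF n(1) x(1) gS[OF Si(1)] x(2)] by blast
      let ?H = "cgraph {1..n} f"
      let ?d = "real (card (sym_diff (edges (S (Suc i))) (edges ?H)))"
      have "0 \<le> c * ?d" using c by simp
      then have "0 \<le> (lam k \<gamma> ?H - lam k \<gamma> (S (Suc i))) * real n ^ 2" using f by linarith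
      then have "lam k \<gamma> ?H \<ge> lam k \<gamma> (S (Suc i))" using n(4) by (simp add: zero_le_mult_iff)
      then have "lam k \<gamma> ?H \<ge> lam_order k \<gamma> n - \<delta>1" using lamS[OF Si(1)] \<delta>(2) by linarith
      \<comment> \<open>Compactness may lead to a maximiser other than x. This is harmless, since
        being far means being far from all of them.\<close>
      then have "?near (\<eta> / 4) ?H" using N1[OF n(2) complete_partite_cgraph] by simp
      then obtain x' where x': "x' \<in> OPT k \<gamma>" "near (\<eta> / 4) n (part_index (V n x')) ?H" by blast
      have "lam k \<gamma> ?H \<le> lam_order k \<gamma> n" using lam_le_lam_order[OF is_graph_cgraph, of "{1..n}" f] by simp
      then have "lam k \<gamma> ?H - lam k \<gamma> (S (Suc i)) \<le> c * \<eta> / 4" using lamS[OF Si(1)] \<delta>(3) by linarith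
      then have "(lam k \<gamma> ?H - lam k \<gamma> (S (Suc i))) * real n ^ 2 \<le> c * \<eta> / 4 * real n ^ 2"
        by (rule mult_right_mono) simp
      then have "c * ?d \<le> c * (\<eta> / 4 * real n ^ 2)" using f by simp
      then have d: "?d \<le> \<eta> / 4 * real n ^ 2" using c by simp
      \<comment> \<open>The distances \<eta>/4 of ?H from the realisation and \<eta>/4 of the graph
        from ?H give \<eta>/2. One step of (Sym1) adds at most \<eta>/2, so the preceding graph is
        within \<eta> as well, against the choice of i.\<close>
      have "near (\<eta> / 2) n (part_index (V n x')) (S (Suc i))"
        by (rule near_trans[OF x'(2) gS(1)[OF Si(1)] is_graph_cgraph d]) simp_all
      moreover have "real (card (sym_diff (edges (S i)) (edges (S (Suc i))))) \<le> \<eta> / 2 * real n ^ 2"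
      proof -
        have "\<eta> / 2 * real (n choose 2) \<le> \<eta> / 2 * real n ^ 2"
          using choose_le_pow[of n 2] \<eta> by (intro mult_left_mono) (simp_all flip: of_nat_power)
        then show ?thesis using bspec[OF S2, of "Suc i"] Si oG by simp
      qed
      ultimately have "near \<eta> n (part_index (V n x')) (S i)"
        using near_trans[OF _ gS(1)[OF Si(2)] gS(1)[OF Si(1)]] by fastforce
      then show False using i(2) x'(1) by blast
    qed
    then show "?near \<eta> G" using S0 by simp
  qed
qed

end

theorem theorem1p4:
  fixes k :: nat and \<gamma> :: "ugraph \<Rightarrow> real"
    and V :: "nat \<Rightarrow> (nat \<Rightarrow> real) \<Rightarrow> nat \<Rightarrow> nat set"
    and G :: "nat \<Rightarrow> (nat \<Rightarrow> real) \<Rightarrow> ugraph"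
  assumes "k \<ge> 3"
    and "graph_invariant k \<gamma>"
    and "symmetrisable k \<gamma>"
    and "finite (OPT k \<gamma>)"
    and "\<And>n x. x \<in> OPT k \<gamma> \<Longrightarrow> realisation_parts n x (V n x)"
    and "\<And>n x. x \<in> OPT k \<gamma> \<Longrightarrow> G n x = realisation_graph n (V n x)"
    and "\<exists>c>0. \<exists>N0. \<forall>n\<ge>N0. \<forall>x\<in>OPT k \<gamma>.
           (\<forall>a\<in>verts (G n x). \<forall>b\<in>verts (G n x). a \<noteq> b \<longrightarrow>
              lam k \<gamma> (G n x) - lam k \<gamma> (flip (G n x) a b) \<ge> c / real n ^ 2) \<and>
           (\<forall>v N. v \<notin> verts (G n x) \<and> N \<subseteq> verts (G n x) \<and>
              (\<forall>i\<ge>1. V n x i \<subseteq> N \<or> V n x i \<inter> N = {}) \<longrightarrow>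
              real (edits_to_clone (G n x) (V n x 0) N)
                \<le> real n * (lam k \<gamma> (G n x) - lam_at k \<gamma> (add_vertex (G n x) v N) v) / c)"
  shows "perfectly_stable k \<gamma>"
proof -
  obtain M where "bounded_invariant k \<gamma> M" by (rule ex_bounded_invariant[OF assms(1,2)])
  then interpret bounded_invariant k \<gamma> M .
  note sym = assms(3) and V = assms(5)
  obtain c0 N0 where c0: "c0 > 0" and strict0: "\<forall>n\<ge>N0. \<forall>x\<in>OPT k \<gamma>.
           (\<forall>a\<in>verts (G n x). \<forall>b\<in>verts (G n x). a \<noteq> b \<longrightarrow>
              lam k \<gamma> (G n x) - lam k \<gamma> (flip (G n x) a b) \<ge> c0 / real n ^ 2) \<and>
           (\<forall>v N. v \<notin> verts (G n x) \<and> N \<subseteq> verts (G n x) \<and>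
              (\<forall>i\<ge>1. V n x i \<subseteq> N \<or> V n x i \<inter> N = {}) \<longrightarrow>
              real (edits_to_clone (G n x) (V n x 0) N)
                \<le> real n * (lam k \<gamma> (G n x) - lam_at k \<gamma> (add_vertex (G n x) v N) v) / c0)"
    using assms(7) by (elim exE conjE) (rule that)
  have strict: "a \<in> verts (G n x) \<Longrightarrow> b \<in> verts (G n x) \<Longrightarrow> a \<noteq> b \<Longrightarrow>
      lam k \<gamma> (G n x) - lam k \<gamma> (flip (G n x) a b) \<ge> c0 / real n ^ 2"
    "v \<notin> verts (G n x) \<and> N \<subseteq> verts (G n x) \<and> (\<forall>i\<ge>1. V n x i \<subseteq> N \<or> V n x i \<inter> N = {}) \<Longrightarrow>
      real (edits_to_clone (G n x) (V n x 0) N)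
        \<le> real n * (lam k \<gamma> (G n x) - lam_at k \<gamma> (add_vertex (G n x) v N) v) / c0"
    if "n \<ge> N0" "x \<in> OPT k \<gamma>" for n x a b v N
    using strict0[rule_format, OF that] by blast+
  have vR: "verts (realisation_graph n W) = {1..n}" for n W by (simp add: realisation_graph_def)
  have loc: "strict_realisations k \<gamma> M x (\<lambda>n. V n x) c0 N0" if x: "x \<in> OPT k \<gamma>" for x
  proof unfold_locales
    show "part_weights x" using x by (simp add: OPT_def maximiser_def)
    show "realisation_parts n x (V n x)" for n by (rule V[OF x])
    show "c0 > 0" by (rule c0)
    show "c0 / real n ^ 2 \<le> lam k \<gamma> (realisation_graph n (V n x)) - lam k \<gamma> (flip (realisation_graph n (V n x)) a b)"
      if "N0 \<le> n" "a \<in> {1..n}" "b \<in> {1..n}" "a \<noteq> b" for n a b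
      using strict(1)[OF that(1) x, of a b] that(2-4) unfolding assms(6)[OF x] vR by simp
    show "real (edits_to_clone (realisation_graph n (V n x)) (V n x 0) N)
        \<le> real n * (lam k \<gamma> (realisation_graph n (V n x)) - lam_at k \<gamma> (add_vertex (realisation_graph n (V n x)) 0 N) 0) / c0"
      if "N0 \<le> n" "N \<subseteq> {1..n}" "\<forall>i\<ge>1. V n x i \<subseteq> N \<or> V n x i \<inter> N = {}" for n N
    proof -
      have "0 \<notin> {1..n}" by simp
      then show ?thesis using strict(2)[OF that(1) x, of 0 N] that(2,3) unfolding assms(6)[OF x] vR by blast
    qed
  qed
  have supp: "\<exists>t. \<forall>i>t. x i = 0" if "x \<in> OPT k \<gamma>" for x
    by (rule strict_realisations.finite_support[OF loc[OF that]])
  let ?stable = "\<lambda>x \<eta> c N. \<forall>n\<ge>N. \<forall>F. is_graph F \<and> verts F = {1..n} \<and> near \<eta> n (part_index (V n x)) F \<longrightarrow>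
      (\<exists>f. c * real (card (sym_diff (edges F) (edges (cgraph {1..n} f))))
        \<le> (lam k \<gamma> (cgraph {1..n} f) - lam k \<gamma> F) * real n ^ 2)"
  have "\<exists>\<eta>>0. \<exists>c>0. \<exists>N. \<forall>x\<in>OPT k \<gamma>. ?stable x \<eta> c N"
  proof (rule uniform_constants[OF assms(4)])
    fix x assume x: "x \<in> OPT k \<gamma>"
    let ?\<kappa> = "strict_realisations.\<kappa> k c0"
    obtain \<beta> N1 where \<beta>: "\<beta> > 0" and N1: "\<And>n. n \<ge> N1 \<Longrightarrow> good_colouring k \<gamma> M ?\<kappa> \<beta> n (part_index (V n x))"
      using strict_realisations.good_colouring_R[OF loc[OF x]] by blast
    obtain \<eta> c N2 where \<eta>: "\<eta> > 0" "c > 0"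
      and N2: "\<And>n g F. n \<ge> N2 \<Longrightarrow> good_colouring k \<gamma> M ?\<kappa> \<beta> n g \<Longrightarrow> is_graph F \<Longrightarrow> verts F = {1..n} \<Longrightarrow>
      real (card (sym_diff (edges F) (edges (cgraph {1..n} g)))) \<le> \<eta> * real n ^ 2 \<Longrightarrow>
      \<exists>f. c * real (card (sym_diff (edges F) (edges (cgraph {1..n} f))))
        \<le> (lam k \<gamma> (cgraph {1..n} f) - lam k \<gamma> F) * real n ^ 2"
      using uniform_local_stability[OF sym strict_realisations.\<kappa>_pos[OF loc[OF x]] \<beta>] by blast
    have "?stable x \<eta> c (max N1 N2)"
    proof (intro allI impI)
      fix n F assume n: "max N1 N2 \<le> n" and F: "is_graph F \<and> verts F = {1..n} \<and> near \<eta> n (part_index (V n x)) F"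
      have n12: "n \<ge> N1" "n \<ge> N2" using n by simp_all
      show "\<exists>f. c * real (card (sym_diff (edges F) (edges (cgraph {1..n} f))))
        \<le> (lam k \<gamma> (cgraph {1..n} f) - lam k \<gamma> F) * real n ^ 2"
        by (rule local_stability_near[OF N2[OF n12(2) N1[OF n12(1)]]]) (use F in blast)+
    qed
    then show "\<exists>\<eta>>0. \<exists>c>0. \<exists>N. ?stable x \<eta> c N" using \<eta> by blast
  next
    fix x and \<eta> \<eta>' c c' :: real and N N' :: nat
    assume st: "?stable x \<eta> c N" and le: "\<eta>' \<le> \<eta>" "c' \<le> c" "N \<le> N'"
    show "?stable x \<eta>' c' N'"
    proof (intro allI impI)
      fix n F assume n: "N' \<le> n" and F: "is_graph F \<and> verts F = {1..n} \<and> near \<eta>' n (part_index (V n x)) F"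
      have "near \<eta> n (part_index (V n x)) F"
        using near_trans[of \<eta>' n _ F F 0 \<eta>] F le by simp
      then obtain f where f: "c * real (card (sym_diff (edges F) (edges (cgraph {1..n} f))))
        \<le> (lam k \<gamma> (cgraph {1..n} f) - lam k \<gamma> F) * real n ^ 2"
        using st F n le(3) by (meson order_trans)
      have "c' * real (card (sym_diff (edges F) (edges (cgraph {1..n} f)))) \<le> c * real (card (sym_diff (edges F) (edges (cgraph {1..n} f))))"
        using le(2) by (rule mult_right_mono) simp
      then show "\<exists>f. c' * real (card (sym_diff (edges F) (edges (cgraph {1..n} f))))
        \<le> (lam k \<gamma> (cgraph {1..n} f) - lam k \<gamma> F) * real n ^ 2"
        using f order_trans by blast
    qed
  qed
  then obtain \<eta> c N1 where \<eta>: "\<eta> > 0" and c: "c > 0" and N1: "\<forall>x\<in>OPT k \<gamma>. ?stable x \<eta> c N1" by blast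
  have L: "\<exists>f. c * real (card (sym_diff (edges F) (edges (cgraph {1..n} f))))
        \<le> (lam k \<gamma> (cgraph {1..n} f) - lam k \<gamma> F) * real n ^ 2"
    if "n \<ge> N1" "x \<in> OPT k \<gamma>" "is_graph F" "verts F = {1..n}" "near \<eta> n (part_index (V n x)) F" for n x F
    using N1 that by blast
  have "\<exists>\<delta>>0. \<exists>N. \<forall>n\<ge>N. \<forall>F. is_graph F \<and> verts F = {1..n} \<and> lam k \<gamma> F \<ge> lam_order k \<gamma> n - \<delta> \<longrightarrow>
    (\<exists>x\<in>OPT k \<gamma>. near \<eta> n (part_index (V n x)) F)"
    by (rule global_closeness[OF sym V supp \<eta> c L])
  then obtain \<delta> N2 where \<delta>: "\<delta> > 0" and "\<forall>n\<ge>N2. \<forall>F. is_graph F \<and> verts F = {1..n} \<and>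
    lam k \<gamma> F \<ge> lam_order k \<gamma> n - \<delta> \<longrightarrow> (\<exists>x\<in>OPT k \<gamma>. near \<eta> n (part_index (V n x)) F)"
    by (elim exE conjE) (rule that)
  then have N2: "\<exists>x\<in>OPT k \<gamma>. near \<eta> n (part_index (V n x)) F"
    if "n \<ge> N2" "is_graph F" "verts F = {1..n}" "lam k \<gamma> F \<ge> lam_order k \<gamma> n - \<delta>" for n F
    using that by blast
  \<comment> \<open>The entry 1/\<delta> serves graphs whose deficit exceeds \<delta>, the entry 2/c
    those that are close to a realisation; N1 and N2 make the order large enough for both.\<close>
  define C where "C = Max {1, real N1, real N2, 1 / \<delta>, 2 / c}"
  have C: "C \<ge> 1" "C \<ge> real N1" "C \<ge> real N2" "C \<ge> 1 / \<delta>" "C \<ge> 2 / c" by (simp_all add: C_def)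
  have "\<exists>H. complete_partite H \<and> order H = order F \<and> edit_dist F H \<le> C * (lam_order k \<gamma> (order F) - lam k \<gamma> F)"
    if F: "is_graph F" "real (order F) \<ge> C" for F
  proof -
    define n where "n = order F"
    have n: "n \<ge> N1" "n \<ge> N2" "n > 0" using F(2) C(1-3) by (simp_all add: n_def)
    obtain \<sigma> where \<sigma>: "bij_betw \<sigma> (verts F) {1..n}" using ex_canonical_copy[OF F(1)] unfolding n_def .
    let ?F = "map_graph \<sigma> F"
    have inj: "inj_on \<sigma> (verts F)" using \<sigma> by (simp add: bij_betw_def)
    have F': "is_graph ?F" "verts ?F = {1..n}" "lam k \<gamma> ?F = lam k \<gamma> F"
      using is_graph_map[OF F(1) inj] lam_map[OF F(1) inj] \<sigma> by (simp_all add: bij_betw_def)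
    have dist: "edit_dist F (cgraph {1..n} f) \<le> 2 / real n ^ 2 * real (card (sym_diff (edges ?F) (edges (cgraph {1..n} f))))" for f
      using edit_dist_le[OF F(1) is_graph_cgraph verts_cgraph n_def[symmetric] \<sigma>, of f]
      by (simp only: finite_atLeastAtMost True_implies_equals sym_diff_commute[of "edges (cgraph {1..n} f)"])
    have "\<exists>f. edit_dist F (cgraph {1..n} f) \<le> C * (lam_order k \<gamma> n - lam k \<gamma> F)"
    proof (cases "lam k \<gamma> F \<ge> lam_order k \<gamma> n - \<delta>")
      case True
      then obtain x where "x \<in> OPT k \<gamma>" "near \<eta> n (part_index (V n x)) ?F"
        using N2[OF n(2) F'(1,2)] F'(3) by auto
      then obtain f where f: "c * real (card (sym_diff (edges ?F) (edges (cgraph {1..n} f))))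
        \<le> (lam k \<gamma> (cgraph {1..n} f) - lam k \<gamma> ?F) * real n ^ 2"
        using L[OF n(1) _ F'(1,2)] by blast
      let ?d = "real (card (sym_diff (edges ?F) (edges (cgraph {1..n} f))))" and ?\<Delta> = "lam_order k \<gamma> n - lam k \<gamma> F"
      have "lam k \<gamma> (cgraph {1..n} f) \<le> lam_order k \<gamma> n" using lam_le_lam_order[OF is_graph_cgraph, of "{1..n}" f] by simp
      then have "(lam k \<gamma> (cgraph {1..n} f) - lam k \<gamma> ?F) * real n ^ 2 \<le> ?\<Delta> * real n ^ 2"
        unfolding F'(3) by (intro mult_right_mono) auto
      then have "c * ?d \<le> ?\<Delta> * real n ^ 2" using f by linarith
      then have "2 / real n ^ 2 * ?d \<le> 2 / c * ?\<Delta>" using c n(3) by (simp add: field_simps)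
      moreover have "?\<Delta> \<ge> 0" using lam_le_lam_order[OF F(1)] by (simp add: n_def)
      then have "2 / c * ?\<Delta> \<le> C * ?\<Delta>" by (rule mult_right_mono[OF C(5)])
      ultimately show ?thesis using dist[of f] by (meson order_trans)
    next
      case False
      \<comment> \<open>Normalised edit distance never exceeds 1, so any complete partite graph will
        do. The colouring \<open>id\<close> is injective and avoids 0 on {1..n}, so this is the
        complete graph.\<close>
      let ?d = "real (card (sym_diff (edges ?F) (edges (cgraph {1..n} id))))"
      have "sym_diff (edges ?F) (edges (cgraph {1..n} id)) \<subseteq> ksets {1..n} 2"
        using F'(1,2) cgraph_edges_subset[of "{1..n}" id] unfolding is_graph_iff by auto
      then have "?d \<le> real (n choose 2)"
        using card_mono[of "ksets {1..n} 2"] card_ksets[of "{1..n}" 2] by fastforce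
      also have "\<dots> \<le> real n ^ 2 / 2"
        by (simp add: choose_two real_of_nat_div power2_eq_square algebra_simps)
      finally have "2 / real n ^ 2 * ?d \<le> 1" using n(3) by (simp add: field_simps)
      also have "1 = 1 / \<delta> * \<delta>" using \<delta> by simp
      also have "\<dots> \<le> C * (lam_order k \<gamma> n - lam k \<gamma> F)"
        using C(1,4) False \<delta> by (intro mult_mono) auto
      finally show ?thesis using dist[of id] by (meson order_trans)
    qed
    then obtain f where "edit_dist F (cgraph {1..n} f) \<le> C * (lam_order k \<gamma> n - lam k \<gamma> F)" by blast
    then show ?thesis using complete_partite_cgraph[of "{1..n}" f] unfolding n_def by (intro exI[of _ "cgraph {1..order F} f"]) simp
  qed
  then show ?thesis unfolding perfectly_stable_def using C(1) by (intro exI[of _ C]) auto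
qed

end
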